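(* Let $R\subset S$ be an extension of commutative unital rings having FCP. Then $\Lambda(S/R)=\Lambda(S(X)/R(X))$.
   Context: All rings are commutative and unital. For a ring extension $R\subseteq S$, $[R,S]$ denotes the set of all $R$-subalgebras of $S$, ordered by inclusion. The extension has FCP if every chain in $[R,S]$ is finite. The length $\ell[R,S]$ is the supremum of the lengths of chains in $[R,S]$, where a chain $R_0\subset R_1\subset\cdots\subset R_n$ has length $n$. The residual extensions of $R\subseteq S$ are the field extensions $R_P/PR_P\to S_Q/QS_Q$ for $Q\in\mathrm{Spec}(S)$ and $P:=Q\cap R$. $\Lambda(S/R)$ is the supremum of the lengths $\ell[\kappa(P),\kappa(Q)]$ of all the residual extensions $\kappa(P)\to\kappa(Q)$ of $R\subseteq S$, considered as ring extensions. For a ring $R$ and an indeterminate $X$, the Nagata ring of $R$ is $R(X):=R[X]_{\Sigma_R}$, where $\Sigma_R$ is the multiplicatively closed set of polynomials in $R[X]$ whose coefficients generate the unit ideal $R$; an extension $R\subseteq S$ induces an extension $R(X)\subseteq S(X)$. *)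

theory Defs
  imports "HOL-Algebra.Algebra" "HOL-Library.Extended_Nat"
begin

section \<open>Localization of a commutative ring at a multiplicatively closed subset\<close>

definition frac_rel :: "('a, 'm) ring_scheme \<Rightarrow> 'a set \<Rightarrow> (('a \<times> 'a) \<times> ('a \<times> 'a)) set" where
  "frac_rel A M =
     {((a, s), (b, t)). a \<in> carrier A \<and> s \<in> M \<and> b \<in> carrier A \<and> t \<in> M \<and>
        (\<exists>u\<in>M. u \<otimes>\<^bsub>A\<^esub> (t \<otimes>\<^bsub>A\<^esub> a) = u \<otimes>\<^bsub>A\<^esub> (s \<otimes>\<^bsub>A\<^esub> b))}"

definition frac_class :: "('a, 'm) ring_scheme \<Rightarrow> 'a set \<Rightarrow> 'a \<Rightarrow> 'a \<Rightarrow> ('a \<times> 'a) set" where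
  "frac_class A M a s = frac_rel A M `` {(a, s)}"

(* As usual for operations on a quotient, the union over all representatives is a union of
   equal classes. *)
definition localization :: "('a, 'm) ring_scheme \<Rightarrow> 'a set \<Rightarrow> ('a \<times> 'a) set ring" where
  "localization A M =
     \<lparr>carrier = (carrier A \<times> M) // frac_rel A M,
      monoid.mult = (\<lambda>C D. \<Union>(a, s)\<in>C. \<Union>(b, t)\<in>D. frac_class A M (a \<otimes>\<^bsub>A\<^esub> b) (s \<otimes>\<^bsub>A\<^esub> t)),
      one = frac_class A M \<one>\<^bsub>A\<^esub> \<one>\<^bsub>A\<^esub>,
      ring.zero = frac_class A M \<zero>\<^bsub>A\<^esub> \<one>\<^bsub>A\<^esub>,
      add = (\<lambda>C D. \<Union>(a, s)\<in>C. \<Union>(b, t)\<in>D.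
               frac_class A M ((t \<otimes>\<^bsub>A\<^esub> a) \<oplus>\<^bsub>A\<^esub> (s \<otimes>\<^bsub>A\<^esub> b)) (s \<otimes>\<^bsub>A\<^esub> t))\<rparr>"

(* The map A[1/M] \<rightarrow> B[1/N], a/s \<mapsto> h(a)/h(s), induced by a ring homomorphism h : A \<rightarrow> B
   with h(M) \<subseteq> N. *)
definition localization_map ::
    "('b, 'n) ring_scheme \<Rightarrow> 'b set \<Rightarrow> ('a \<Rightarrow> 'b) \<Rightarrow> ('a \<times> 'a) set \<Rightarrow> ('b \<times> 'b) set" where
  "localization_map B N h C = (\<Union>(a, s)\<in>C. frac_class B N (h a) (h s))"


section \<open>Ring extensions, FCP, length\<close>

text \<open>
  A ring extension is given by an injective ring homomorphism \<open>h\<close> from \<open>A\<close> to \<open>B\<close>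
  (the inclusion \<open>id\<close> if \<open>A\<close> is literally a subring of \<open>B\<close>).  This covers uniformly the
  extension \<open>R \<subseteq> S\<close>, the residual extensions and \<open>R(X) \<subseteq> S(X)\<close>.  The \<open>A\<close>-subalgebras
  of \<open>B\<close> are the subrings of \<open>B\<close> containing \<open>h(A)\<close>.
\<close>

definition subalgebras ::
    "('a, 'm) ring_scheme \<Rightarrow> ('b, 'n) ring_scheme \<Rightarrow> ('a \<Rightarrow> 'b) \<Rightarrow> 'b set set" where
  "subalgebras A B h = {T. subcring T B \<and> h ` carrier A \<subseteq> T}"

definition FCP :: "('a, 'm) ring_scheme \<Rightarrow> ('b, 'n) ring_scheme \<Rightarrow> ('a \<Rightarrow> 'b) \<Rightarrow> bool" where
  "FCP A B h \<longleftrightarrow> (\<forall>C. subset.chain (subalgebras A B h) C \<longrightarrow> finite C)"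

definition extension_length ::
    "('a, 'm) ring_scheme \<Rightarrow> ('b, 'n) ring_scheme \<Rightarrow> ('a \<Rightarrow> 'b) \<Rightarrow> enat" where
  "extension_length A B h =
     Sup {enat n | n. \<exists>T :: nat \<Rightarrow> 'b set.
       (\<forall>i\<le>n. T i \<in> subalgebras A B h) \<and> (\<forall>i<n. T i \<subset> T (Suc i))}"


section \<open>Residual extensions\<close>

(* The extension P A\<^sub>P of the prime ideal P to the localization A\<^sub>P *)
definition local_ideal :: "('a, 'm) ring_scheme \<Rightarrow> 'a set \<Rightarrow> ('a \<times> 'a) set set" where
  "local_ideal A P =
     Idl\<^bsub>localization A (carrier A - P)\<^esub> ((\<lambda>a. frac_class A (carrier A - P) a \<one>\<^bsub>A\<^esub>) ` P)"

definition residue_field :: "('a, 'm) ring_scheme \<Rightarrow> 'a set \<Rightarrow> ('a \<times> 'a) set set ring" where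
  "residue_field A P = localization A (carrier A - P) Quot local_ideal A P"

(* The map from the residue field of A at the contraction of Q to the residue field of B at Q
   induced by h; the union is again over equal cosets. *)
definition residual_map ::
    "('b, 'n) ring_scheme \<Rightarrow> ('a \<Rightarrow> 'b) \<Rightarrow> 'b set \<Rightarrow> ('a \<times> 'a) set set \<Rightarrow> ('b \<times> 'b) set set" where
  "residual_map B h Q K =
     (\<Union>x\<in>K. local_ideal B Q +>\<^bsub>localization B (carrier B - Q)\<^esub>
        localization_map B (carrier B - Q) h x)"

definition contraction :: "('a, 'm) ring_scheme \<Rightarrow> ('a \<Rightarrow> 'b) \<Rightarrow> 'b set \<Rightarrow> 'a set" where
  "contraction A h Q = {a \<in> carrier A. h a \<in> Q}"

definition Lambda :: "('a, 'm) ring_scheme \<Rightarrow> ('b, 'n) ring_scheme \<Rightarrow> ('a \<Rightarrow> 'b) \<Rightarrow> enat" where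
  "Lambda A B h =
     (SUP Q\<in>{Q. primeideal Q B}.
        extension_length (residue_field A (contraction A h Q)) (residue_field B Q)
          (residual_map B h Q))"


section \<open>Nagata rings\<close>

definition unit_content :: "('a, 'm) ring_scheme \<Rightarrow> (nat \<Rightarrow> 'a) set" where
  "unit_content A =
     {p \<in> carrier (UP A). Idl\<^bsub>A\<^esub> (range (coeff (UP A) p)) = carrier A}"

definition nagata :: "('a, 'm) ring_scheme \<Rightarrow> ((nat \<Rightarrow> 'a) \<times> (nat \<Rightarrow> 'a)) set ring" where
  "nagata A = localization (UP A) (unit_content A)"

(* R(X) \<rightarrow> S(X) for a subring R of S: polynomials are coefficient sequences, so that R[X] is
   literally a subset of S[X] and the map of polynomial rings is the identity. *)
definition nagata_map ::
    "('a, 'm) ring_scheme \<Rightarrow>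
     ((nat \<Rightarrow> 'a) \<times> (nat \<Rightarrow> 'a)) set \<Rightarrow> ((nat \<Rightarrow> 'a) \<times> (nat \<Rightarrow> 'a)) set" where
  "nagata_map S = localization_map (UP S) (unit_content S) id"

end

theory Submission
  imports Defs
begin

text \<open>
  Let \<open>Q\<close> be a prime of \<open>S\<close> with contraction \<open>P\<close> to \<open>R\<close>. By FCP, every element outside \<open>Q\<close> divides,
  modulo \<open>Q\<close>, an element of \<open>R\<close> outside \<open>P\<close>. Hence the intermediate rings of
  \<open>\<kappa>(P) \<subseteq> \<kappa>(Q)\<close> correspond to the intermediate rings \<open>U\<close> of \<open>R + Q \<subseteq> S\<close> that are saturated with
  respect to \<open>R - P\<close>, and \<open>U \<mapsto> U[X]\<close> embeds the latter into the intermediate rings of the residual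
  extension at \<open>QS(X)\<close>; this gives one inequality.

  Conversely let \<open>Q'\<close> be a prime of \<open>S(X)\<close> over \<open>Q\<close>. If \<open>\<kappa>(P) = \<kappa>(Q)\<close>, the residual extension at
  \<open>Q'\<close> is trivial too, because \<open>\<kappa>(Q')\<close> is generated by \<open>\<kappa>(Q)\<close> and the image of \<open>X\<close>. Otherwise FCP
  forces \<open>P\<close> and \<open>Q\<close> to be maximal with \<open>S/Q\<close> finite over \<open>R/P\<close>, so \<open>Q' = QS(X)\<close>, and one has to
  compare the intermediate rings of \<open>k(X) \<subseteq> K(X)\<close> with those of the finite field extension
  \<open>k \<subseteq> K\<close>. Not every intermediate field of \<open>k(X) \<subseteq> K(X)\<close> is extended from \<open>k \<subseteq> K\<close>, but specialization
  at \<open>X = \<infinity>\<close>, that is, passing to the ring of leading coefficients of the polynomials in an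
  intermediate ring, preserves strict inclusions.
\<close>

section \<open>Localization\<close>

text \<open>Both residual extensions are studied upstairs, in \<open>S\<close> and in S[X], modulo
  \<open>Q\<close>: residue fields enter only through the canonical maps to them, and quotients only
  through cleared denominators. Lengths are compared by strictly monotone maps, and no such map has
  to be a bijection. This freedom matters for leading coefficients: over k = F_p(s,t), the field
  generated over k(X) by s^(1/p) X + t^(1/p) is not extended from any field between k and K =
  k(s^(1/p), t^(1/p)), yet it has the same ring of leading coefficients as the extended field
  k(s^(1/p))(X). FCP is given for \<open>R\<close> in \<open>S\<close> only. On the polynomial side,
  finiteness has to come from S/Q being finite over the field R/P: polynomials of bounded degree
  over S/Q form a finite-dimensional space. This one fact yields both the common denominators in
  R[X] and the strictness for leading coefficients.\<close>

locale mult_closed = cring A for A (structure) +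
  fixes M
  assumes M_sub: "M \<subseteq> carrier A"
    and M_one [simp, intro]: "\<one> \<in> M"
    and M_mult [simp, intro]: "\<lbrakk>s \<in> M; t \<in> M\<rbrakk> \<Longrightarrow> s \<otimes> t \<in> M"
begin

lemma M_carr [simp, intro]: "s \<in> M \<Longrightarrow> s \<in> carrier A"
  using M_sub by blast

lemma frac_rel_equiv: "equiv (carrier A \<times> M) (frac_rel A M)"
proof (rule equivI)
  show "frac_rel A M \<subseteq> (carrier A \<times> M) \<times> carrier A \<times> M"
    by (auto simp: frac_rel_def)
  show "refl_on (carrier A \<times> M) (frac_rel A M)"
    by (auto simp: refl_on_def frac_rel_def)
  show "sym (frac_rel A M)"
    by (auto simp: sym_def frac_rel_def) metis
  show "trans (frac_rel A M)"
  proof (rule transI, clarsimp simp: frac_rel_def)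
    fix a s b t c w u v
    assume c: "a \<in> carrier A" "s \<in> M" "b \<in> carrier A" "t \<in> M" "c \<in> carrier A" "w \<in> M" "u \<in> M" "v \<in> M"
      and 1: "u \<otimes> (t \<otimes> a) = u \<otimes> (s \<otimes> b)" and 2: "v \<otimes> (w \<otimes> b) = v \<otimes> (t \<otimes> c)"
    have "(u \<otimes> t \<otimes> v) \<otimes> (w \<otimes> a) = v \<otimes> w \<otimes> (u \<otimes> (t \<otimes> a))"
      using c by (simp add: m_ac)
    also have "\<dots> = u \<otimes> s \<otimes> (v \<otimes> (w \<otimes> b))"
      unfolding 1 using c by (simp add: m_ac)
    also have "\<dots> = (u \<otimes> t \<otimes> v) \<otimes> (s \<otimes> c)"
      unfolding 2 using c by (simp add: m_ac)
    finally show "\<exists>u\<in>M. u \<otimes> (w \<otimes> a) = u \<otimes> (s \<otimes> c)"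
      using c by blast
  qed
qed

abbreviation frac where "frac \<equiv> frac_class A M"
abbreviation L where "L \<equiv> localization A M"

lemma frac_eq_iff:
  assumes "a \<in> carrier A" "s \<in> M" "b \<in> carrier A" "t \<in> M"
  shows "frac a s = frac b t \<longleftrightarrow> (\<exists>u\<in>M. u \<otimes> (t \<otimes> a) = u \<otimes> (s \<otimes> b))"
proof -
  have "frac a s = frac b t \<longleftrightarrow> ((a, s), (b, t)) \<in> frac_rel A M"
    unfolding frac_class_def using eq_equiv_class_iff[OF frac_rel_equiv] assms by auto
  then show ?thesis using assms by (simp add: frac_rel_def)
qed

lemma frac_eqI:
  assumes "a \<in> carrier A" "s \<in> M" "b \<in> carrier A" "t \<in> M" "t \<otimes> a = s \<otimes> b"
  shows "frac a s = frac b t"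
  using frac_eq_iff[OF assms(1-4)] assms by auto

lemma carrier_L: "carrier L = {frac a s | a s. a \<in> carrier A \<and> s \<in> M}"
  by (auto simp: localization_def quotient_def frac_class_def)

lemma frac_closed [simp, intro]: "\<lbrakk>a \<in> carrier A; s \<in> M\<rbrakk> \<Longrightarrow> frac a s \<in> carrier L"
  by (auto simp: carrier_L)

lemma L_cases:
  assumes "x \<in> carrier L"
  obtains a s where "a \<in> carrier A" "s \<in> M" "x = frac a s"
  using assms by (auto simp: carrier_L)

lemma frac_mult:
  assumes "a \<in> carrier A" "s \<in> M" "b \<in> carrier A" "t \<in> M"
  shows "frac a s \<otimes>\<^bsub>L\<^esub> frac b t = frac (a \<otimes> b) (s \<otimes> t)"
proof -
  have "congruent2 (frac_rel A M) (frac_rel A M) (\<lambda>(a, s) (b, t). frac (a \<otimes> b) (s \<otimes> t))"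
  proof (rule congruent2I[OF frac_rel_equiv frac_rel_equiv]; clarsimp simp: frac_rel_def)
    fix a s b t u c w
    assume c: "a \<in> carrier A" "s \<in> M" "b \<in> carrier A" "t \<in> M" "c \<in> carrier A" "w \<in> M" "u \<in> M"
      and 1: "u \<otimes> (w \<otimes> b) = u \<otimes> (t \<otimes> c)"
    have "u \<otimes> (a \<otimes> w \<otimes> (s \<otimes> b)) = a \<otimes> s \<otimes> (u \<otimes> (w \<otimes> b))" using c by (simp add: m_ac)
    also have "\<dots> = u \<otimes> (s \<otimes> t \<otimes> (a \<otimes> c))" unfolding 1 using c by (simp add: m_ac)
    finally have *: "u \<otimes> (a \<otimes> w \<otimes> (s \<otimes> b)) = u \<otimes> (s \<otimes> t \<otimes> (a \<otimes> c))" .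
    show "frac (a \<otimes> b) (s \<otimes> t) = frac (a \<otimes> c) (s \<otimes> w)"
      using c * by (subst frac_eq_iff) (auto simp: m_ac intro!: bexI[of _ u])
    show "frac (b \<otimes> a) (t \<otimes> s) = frac (c \<otimes> a) (w \<otimes> s)"
      using c * by (subst frac_eq_iff) (auto simp: m_ac intro!: bexI[of _ u])
  qed
  from UN_equiv_class2[OF frac_rel_equiv frac_rel_equiv this, of "(a, s)" "(b, t)"]
  show ?thesis using assms
    by (simp add: localization_def frac_class_def split_def)
qed

lemma frac_add:
  assumes "a \<in> carrier A" "s \<in> M" "b \<in> carrier A" "t \<in> M"
  shows "frac a s \<oplus>\<^bsub>L\<^esub> frac b t = frac ((t \<otimes> a) \<oplus> (s \<otimes> b)) (s \<otimes> t)"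
proof -
  have "congruent2 (frac_rel A M) (frac_rel A M)
      (\<lambda>(a, s) (b, t). frac ((t \<otimes> a) \<oplus> (s \<otimes> b)) (s \<otimes> t))"
  proof (rule congruent2I[OF frac_rel_equiv frac_rel_equiv]; clarsimp simp: frac_rel_def)
    fix a s b t u c w
    assume c: "a \<in> carrier A" "s \<in> M" "b \<in> carrier A" "t \<in> M" "c \<in> carrier A" "w \<in> M" "u \<in> M"
      and 1: "u \<otimes> (w \<otimes> b) = u \<otimes> (t \<otimes> c)"
    have "u \<otimes> ((s \<otimes> w) \<otimes> (t \<otimes> a \<oplus> s \<otimes> b)) =
       u \<otimes> s \<otimes> w \<otimes> t \<otimes> a \<oplus> s \<otimes> s \<otimes> (u \<otimes> (w \<otimes> b))" using c by (simp add: m_ac r_distr)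
    also have "\<dots> = u \<otimes> ((s \<otimes> t) \<otimes> (w \<otimes> a \<oplus> s \<otimes> c))" unfolding 1 using c by (simp add: m_ac r_distr)
    finally have *: "u \<otimes> ((s \<otimes> w) \<otimes> (t \<otimes> a \<oplus> s \<otimes> b)) = u \<otimes> ((s \<otimes> t) \<otimes> (w \<otimes> a \<oplus> s \<otimes> c))" .
    show "frac (t \<otimes> a \<oplus> s \<otimes> b) (s \<otimes> t) = frac (w \<otimes> a \<oplus> s \<otimes> c) (s \<otimes> w)"
      using c * by (subst frac_eq_iff) (auto intro!: bexI[of _ u])
    then show "frac (s \<otimes> b \<oplus> t \<otimes> a) (t \<otimes> s) = frac (s \<otimes> c \<oplus> w \<otimes> a) (w \<otimes> s)"
      using c by (simp add: a_comm m_comm)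
  qed
  from UN_equiv_class2[OF frac_rel_equiv frac_rel_equiv this, of "(a, s)" "(b, t)"]
  show ?thesis using assms
    by (simp add: localization_def frac_class_def split_def)
qed

lemma L_one: "\<one>\<^bsub>L\<^esub> = frac \<one> \<one>" and L_zero: "\<zero>\<^bsub>L\<^esub> = frac \<zero> \<one>"
  by (auto simp: localization_def)

lemma cring_L: "cring L"
proof (rule cringI)
  show "abelian_group L"
  proof (rule abelian_groupI)
    fix x y z assume "x \<in> carrier L" "y \<in> carrier L" "z \<in> carrier L"
    then obtain a s b t c u where
      c: "a \<in> carrier A" "s \<in> M" "b \<in> carrier A" "t \<in> M" "c \<in> carrier A" "u \<in> M"
      and e: "x = frac a s" "y = frac b t" "z = frac c u" by (auto simp: carrier_L)
    show "x \<oplus>\<^bsub>L\<^esub> y \<oplus>\<^bsub>L\<^esub> z = x \<oplus>\<^bsub>L\<^esub> (y \<oplus>\<^bsub>L\<^esub> z)"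
      unfolding e using c by (simp add: frac_add r_distr m_ac a_ac)
  next
    fix x y assume "x \<in> carrier L" "y \<in> carrier L"
    then obtain a s b t where
      c: "a \<in> carrier A" "s \<in> M" "b \<in> carrier A" "t \<in> M"
      and e: "x = frac a s" "y = frac b t" by (auto simp: carrier_L)
    show "x \<oplus>\<^bsub>L\<^esub> y \<in> carrier L" "x \<oplus>\<^bsub>L\<^esub> y = y \<oplus>\<^bsub>L\<^esub> x"
      unfolding e using c by (simp_all add: frac_add r_distr m_ac a_ac)
  next
    fix x assume "x \<in> carrier L"
    then obtain a s where c: "a \<in> carrier A" "s \<in> M" and e: "x = frac a s" by (auto simp: carrier_L)
    show "\<zero>\<^bsub>L\<^esub> \<oplus>\<^bsub>L\<^esub> x = x" unfolding e L_zero using c by (simp add: frac_add)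
    have "frac (\<ominus> a) s \<oplus>\<^bsub>L\<^esub> x = \<zero>\<^bsub>L\<^esub>" unfolding e L_zero using c
      by (simp add: frac_add) (rule frac_eqI, auto simp: r_minus l_neg)
    then show "\<exists>y\<in>carrier L. y \<oplus>\<^bsub>L\<^esub> x = \<zero>\<^bsub>L\<^esub>" using c by blast
  qed (auto simp: L_zero)
  show "comm_monoid L"
  proof (rule comm_monoidI)
    fix x y z assume "x \<in> carrier L" "y \<in> carrier L" "z \<in> carrier L"
    then obtain a s b t c u where
      c: "a \<in> carrier A" "s \<in> M" "b \<in> carrier A" "t \<in> M" "c \<in> carrier A" "u \<in> M"
      and e: "x = frac a s" "y = frac b t" "z = frac c u" by (auto simp: carrier_L)
    show "x \<otimes>\<^bsub>L\<^esub> y \<otimes>\<^bsub>L\<^esub> z = x \<otimes>\<^bsub>L\<^esub> (y \<otimes>\<^bsub>L\<^esub> z)"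
      unfolding e using c by (simp add: frac_mult m_ac)
    show "x \<otimes>\<^bsub>L\<^esub> y \<in> carrier L" "x \<otimes>\<^bsub>L\<^esub> y = y \<otimes>\<^bsub>L\<^esub> x"
      unfolding e using c by (simp_all add: frac_mult m_ac)
  next
    fix x assume "x \<in> carrier L"
    then obtain a s where c: "a \<in> carrier A" "s \<in> M" and e: "x = frac a s" by (auto simp: carrier_L)
    show "\<one>\<^bsub>L\<^esub> \<otimes>\<^bsub>L\<^esub> x = x" unfolding e L_one using c by (simp add: frac_mult)
  qed (auto simp: L_one)
next
  fix x y z assume "x \<in> carrier L" "y \<in> carrier L" "z \<in> carrier L"
  then obtain a s b t c u where
    c: "a \<in> carrier A" "s \<in> M" "b \<in> carrier A" "t \<in> M" "c \<in> carrier A" "u \<in> M"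
    and e: "x = frac a s" "y = frac b t" "z = frac c u" by (auto simp: carrier_L)
  show "(x \<oplus>\<^bsub>L\<^esub> y) \<otimes>\<^bsub>L\<^esub> z = x \<otimes>\<^bsub>L\<^esub> z \<oplus>\<^bsub>L\<^esub> y \<otimes>\<^bsub>L\<^esub> z"
    unfolding e using c by (simp add: frac_mult frac_add) (rule frac_eqI, auto simp: r_distr l_distr m_ac)
qed

lemma of_ring_hom: "(\<lambda>a. frac a \<one>) \<in> ring_hom A L"
  by (rule ring_hom_memI) (auto simp: frac_mult frac_add L_one)

lemma frac_cancel: "\<lbrakk>a \<in> carrier A; s \<in> M\<rbrakk> \<Longrightarrow> frac a s \<otimes>\<^bsub>L\<^esub> frac s \<one> = frac a \<one>"
  by (simp add: frac_mult) (rule frac_eqI, auto simp: m_ac)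

lemma frac_unit: "\<lbrakk>s \<in> M\<rbrakk> \<Longrightarrow> frac \<one> s \<otimes>\<^bsub>L\<^esub> frac s \<one> = \<one>\<^bsub>L\<^esub>"
  by (simp add: frac_mult L_one) (rule frac_eqI, auto simp: m_ac)

section \<open>Extension of prime ideals to a localization\<close>

definition extended :: "'a set \<Rightarrow> ('a \<times> 'a) set set" where
  "extended q = {frac a s | a s. a \<in> q \<and> s \<in> M}"

text \<open>Different fractions of the same class have numerators related by u t a = u s b with u t
  in \<open>M\<close>, hence outside \<open>q\<close>; primality cancels this factor, so membership
  does not depend on the representative.\<close>

lemma mem_extended:
  assumes "primeideal q A" "q \<inter> M = {}" "a \<in> carrier A" "s \<in> M"
  shows "frac a s \<in> extended q \<longleftrightarrow> a \<in> q"
proof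
  interpret q: primeideal q A by fact
  assume "frac a s \<in> extended q"
  then obtain b t where b: "b \<in> q" "t \<in> M" "frac a s = frac b t" by (auto simp: extended_def)
  then have bc: "b \<in> carrier A" using q.Icarr by auto
  obtain u where u: "u \<in> M" "u \<otimes> (t \<otimes> a) = u \<otimes> (s \<otimes> b)"
    using b frac_eq_iff[of a s b t] assms bc by auto
  have "(u \<otimes> t) \<otimes> a \<in> q"
    using u b assms bc q.I_l_closed[of b "u \<otimes> s"] by (simp add: m_assoc)
  then show "a \<in> q" using q.I_prime[of "u \<otimes> t" a] u b assms by auto
qed (use assms in \<open>auto simp: extended_def\<close>)

lemma extended_primeideal:
  assumes q: "primeideal q A" and d: "q \<inter> M = {}"
  shows "primeideal (extended q) L"
proof -
  interpret q: primeideal q A by fact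
  interpret L: cring L by (rule cring_L)
  have mem: "frac a s \<in> extended q \<longleftrightarrow> a \<in> q" if "a \<in> carrier A" "s \<in> M" for a s
    using mem_extended q d that by blast
  have sub: "extended q \<subseteq> carrier L" by (auto simp: extended_def q.Icarr)
  show ?thesis
  proof (rule primeidealI)
    show "ideal (extended q) L"
    proof (rule idealI)
      show "ring L" by (rule L.ring_axioms)
      show "subgroup (extended q) (add_monoid L)"
      proof (rule L.add.subgroupI)
        show "extended q \<subseteq> carrier L" by (rule sub)
        show "extended q \<noteq> {}" using mem[of \<zero> \<one>] by auto
      next
        fix x assume "x \<in> extended q"
        then obtain a s where x: "a \<in> q" "s \<in> M" "x = frac a s" by (auto simp: extended_def)
        have "x \<oplus>\<^bsub>L\<^esub> frac (\<ominus> a) s = \<zero>\<^bsub>L\<^esub>" unfolding x L_zero using x q.Icarr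
          by (simp add: frac_add) (rule frac_eqI, auto simp: r_minus r_neg)
        then have "\<ominus>\<^bsub>L\<^esub> x = frac (\<ominus> a) s" using x q.Icarr
          by (intro L.minus_equality) (auto simp: L.a_comm)
        then show "\<ominus>\<^bsub>L\<^esub> x \<in> extended q" using x mem q.Icarr by auto
      next
        fix x y assume "x \<in> extended q" "y \<in> extended q"
        then obtain a s b t where "a \<in> q" "s \<in> M" "x = frac a s" "b \<in> q" "t \<in> M" "y = frac b t"
          by (auto simp: extended_def)
        then show "x \<oplus>\<^bsub>L\<^esub> y \<in> extended q"
          using q.Icarr by (auto simp: frac_add mem intro!: q.a_closed q.I_l_closed)
      qed
      fix a x assume "a \<in> extended q" "x \<in> carrier L"
      then obtain a' s b t where c: "a' \<in> q" "s \<in> M" "a = frac a' s" "b \<in> carrier A" "t \<in> M" "x = frac b t"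
        by (auto simp: extended_def elim: L_cases)
      then show "x \<otimes>\<^bsub>L\<^esub> a \<in> extended q" "a \<otimes>\<^bsub>L\<^esub> x \<in> extended q"
        using q.Icarr q.I_l_closed[OF c(1,4)] q.I_r_closed[OF c(1,4)] by (auto simp: frac_mult mem)
    qed
    show "cring L" by (rule cring_L)
    show "carrier L \<noteq> extended q"
    proof
      assume "carrier L = extended q"
      then have "\<one> \<in> q" using mem[of \<one> \<one>] frac_closed[of \<one> \<one>] by auto
      then show False using d by auto
    qed
    fix a b assume "a \<in> carrier L" "b \<in> carrier L" "a \<otimes>\<^bsub>L\<^esub> b \<in> extended q"
    then obtain a' s b' t where c: "a' \<in> carrier A" "s \<in> M" "a = frac a' s"
      "b' \<in> carrier A" "t \<in> M" "b = frac b' t" "a' \<otimes> b' \<in> q"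
      by (elim L_cases) (auto simp: frac_mult mem)
    then show "a \<in> extended q \<or> b \<in> extended q"
      using q.I_prime[of a' b'] by (auto simp: mem)
  qed
qed

end

section \<open>Functoriality of localization\<close>

lemma localization_map_frac:
  assumes "mult_closed A M" "mult_closed B N" "h \<in> ring_hom A B" "h ` M \<subseteq> N"
    "a \<in> carrier A" "s \<in> M"
  shows "localization_map B N h (frac_class A M a s) = frac_class B N (h a) (h s)"
proof -
  interpret A: mult_closed A M by fact
  interpret B: mult_closed B N by fact
  note h = ring_hom_closed[OF assms(3)] ring_hom_mult[OF assms(3), symmetric]
  have "congruent (frac_rel A M) (\<lambda>(a, s). B.frac (h a) (h s))"
  proof (rule congruentI, clarsimp simp: frac_rel_def)
    fix a s b t u
    assume c: "a \<in> carrier A" "s \<in> M" "b \<in> carrier A" "t \<in> M" "u \<in> M"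
      and "u \<otimes>\<^bsub>A\<^esub> (t \<otimes>\<^bsub>A\<^esub> a) = u \<otimes>\<^bsub>A\<^esub> (s \<otimes>\<^bsub>A\<^esub> b)"
    then have "h u \<otimes>\<^bsub>B\<^esub> (h t \<otimes>\<^bsub>B\<^esub> h a) = h u \<otimes>\<^bsub>B\<^esub> (h s \<otimes>\<^bsub>B\<^esub> h b)"
      by (simp add: h)
    then show "B.frac (h a) (h s) = B.frac (h b) (h t)"
      using c h(1) assms(4) by (subst B.frac_eq_iff) blast+
  qed
  from UN_equiv_class[OF A.frac_rel_equiv this, of "(a, s)"] show ?thesis
    using assms by (simp add: localization_map_def frac_class_def split_def)
qed

lemma localization_map_hom:
  assumes "mult_closed A M" "mult_closed B N" "h \<in> ring_hom A B" "h ` M \<subseteq> N"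
  shows "localization_map B N h \<in> ring_hom (localization A M) (localization B N)"
proof -
  interpret A: mult_closed A M by fact
  interpret B: mult_closed B N by fact
  note m = localization_map_frac[OF assms]
  have N: "s \<in> M \<Longrightarrow> h s \<in> N" for s using assms(4) by auto
  note h = ring_hom_closed[OF assms(3)] ring_hom_mult[OF assms(3)]
    ring_hom_add[OF assms(3)] ring_hom_one[OF assms(3)]
  show ?thesis
    by (rule ring_hom_memI)
      (auto elim!: A.L_cases simp: m h N A.frac_mult A.frac_add B.frac_mult B.frac_add A.L_one B.L_one)
qed

declare (in mult_closed) M_carr [simp del, rule del] and M_one [rule del] and M_mult [rule del]

section \<open>Length of an interval of subrings\<close>

text \<open>Stated for an arbitrary family of sets because the comparisons pass through families of
  saturated subrings, which are not given as all subalgebras of one extension.\<close>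

definition family_length :: "'b set set \<Rightarrow> enat" where
  "family_length F =
     Sup {enat n | n. \<exists>T :: nat \<Rightarrow> 'b set. (\<forall>i\<le>n. T i \<in> F) \<and> (\<forall>i<n. T i \<subset> T (Suc i))}"

lemma extension_length_eq: "extension_length A B h = family_length (subalgebras A B h)"
  by (simp add: extension_length_def family_length_def)

lemma psubset_witnessI: "\<lbrakk>A \<subseteq> B; x \<in> B; x \<notin> A\<rbrakk> \<Longrightarrow> A \<subset> B"
  by blast

text \<open>Chains go to chains of the same length, so only comparable pairs have to be kept
  apart.\<close>

lemma family_length_le:
  assumes "\<And>U. U \<in> F \<Longrightarrow> g U \<in> G"
    and "\<And>U V. \<lbrakk>U \<in> F; V \<in> F; U \<subset> V\<rbrakk> \<Longrightarrow> g U \<subset> g V"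
  shows "family_length F \<le> family_length G"
  unfolding family_length_def
proof (rule Sup_least)
  fix x
  let ?P = "\<lambda>n T. (\<forall>i\<le>n. T i \<in> G) \<and> (\<forall>i<n. T i \<subset> T (Suc i))"
  assume "x \<in> {enat n | n. \<exists>T. (\<forall>i\<le>n. T i \<in> F) \<and> (\<forall>i<n. T i \<subset> T (Suc i))}"
  then obtain n T where x: "x = enat n" and T: "\<forall>i\<le>n. T i \<in> F" "\<forall>i<n. T i \<subset> T (Suc i)"
    by (elim CollectE exE conjE)
  have "\<forall>i\<le>n. g (T i) \<in> G" using T(1) assms(1) by simp
  moreover have "\<forall>i<n. g (T i) \<subset> g (T (Suc i))"
  proof (intro allI impI)
    fix i assume "i < n"
    then have "T i \<in> F" "T (Suc i) \<in> F" "T i \<subset> T (Suc i)" using T by simp_all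
    then show "g (T i) \<subset> g (T (Suc i))" by (rule assms(2))
  qed
  ultimately have "?P n (\<lambda>i. g (T i))" by (rule conjI)
  then have "\<exists>T. ?P n T" by (rule exI[where x = "\<lambda>i. g (T i)"])
  then have "x \<in> {enat n | n. \<exists>T. ?P n T}" unfolding x by blast
  then show "x \<le> Sup {enat n | n. \<exists>T. ?P n T}" by (rule Sup_upper)
qed

lemma family_length_le_singleton: "F \<subseteq> {U} \<Longrightarrow> family_length F = 0"
proof -
  assume F: "F \<subseteq> {U}"
  have "n = 0" if "\<forall>i\<le>n. T i \<in> F" "\<forall>i<n. T i \<subset> T (Suc i)" for n and T :: "nat \<Rightarrow> 'a set"
  proof (rule ccontr)
    assume "n \<noteq> 0"
    then have "T 0 \<in> F" "T (Suc 0) \<in> F" "T 0 \<subset> T (Suc 0)" using that by auto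
    then show False using F by auto
  qed
  note n = this
  have "family_length F \<le> 0"
    unfolding family_length_def
  proof (rule Sup_least, elim CollectE exE conjE)
    fix x n and T :: "nat \<Rightarrow> 'a set"
    assume x: "x = enat n" and T: "\<forall>i\<le>n. T i \<in> F" "\<forall>i<n. T i \<subset> T (Suc i)"
    show "x \<le> 0" unfolding x n[OF T] by (simp add: zero_enat_def)
  qed
  then show ?thesis by simp
qed

text \<open>Denominators are cleared so that no inverses have to be mentioned: for a field \<open>E\<close> this
  is the set of all quotients \<open>\<psi>(a)/\<psi>(b)\<close>.\<close>

definition fractions :: "('e, 'n) ring_scheme \<Rightarrow> ('b \<Rightarrow> 'e) \<Rightarrow> 'b set \<Rightarrow> 'e set" where
  "fractions E \<psi> D = {e \<in> carrier E. \<exists>a\<in>D. \<exists>b\<in>D. \<psi> b \<noteq> \<zero>\<^bsub>E\<^esub> \<and> e \<otimes>\<^bsub>E\<^esub> \<psi> b = \<psi> a}"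

definition subrings_above :: "('e, 'n) ring_scheme \<Rightarrow> 'e set \<Rightarrow> 'e set set" where
  "subrings_above E k = {T. subcring T E \<and> k \<subseteq> T}"

text \<open>For a homomorphism to a field with kernel \<open>Q\<close>, these are the preimages of
  the subrings containing all quotients from \<open>D\<close>, described inside \<open>B\<close>
  alone. Containing \<open>Q\<close> means being a union of cosets; closure under division by
  \<open>D - Q\<close> accounts for the inverses of the nonzero images of \<open>D\<close>.\<close>

definition saturated_subrings :: "('b, 'n) ring_scheme \<Rightarrow> 'b set \<Rightarrow> 'b set \<Rightarrow> 'b set set" where
  "saturated_subrings B D Q =
     {U. subring U B \<and> D \<subseteq> U \<and> Q \<subseteq> U \<and>
       (\<forall>b\<in>carrier B. \<forall>s\<in>D - Q. s \<otimes>\<^bsub>B\<^esub> b \<in> U \<longrightarrow> b \<in> U)}"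

lemma saturated_subringsI:
  assumes "subring U B" "D \<subseteq> U" "Q \<subseteq> U"
    and "\<And>b s. \<lbrakk>b \<in> carrier B; s \<in> D; s \<notin> Q; s \<otimes>\<^bsub>B\<^esub> b \<in> U\<rbrakk> \<Longrightarrow> b \<in> U"
  shows "U \<in> saturated_subrings B D Q"
  using assms unfolding saturated_subrings_def by blast

lemma saturated_subringsD:
  assumes "U \<in> saturated_subrings B D Q"
  shows "subring U B" "D \<subseteq> U" "Q \<subseteq> U"
    and "\<lbrakk>b \<in> carrier B; s \<in> D; s \<notin> Q; s \<otimes>\<^bsub>B\<^esub> b \<in> U\<rbrakk> \<Longrightarrow> b \<in> U"
  using assms unfolding saturated_subrings_def by blast+

lemma subrings_aboveD:
  assumes "T \<in> subrings_above E k"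
  shows "subring T E" "k \<subseteq> T"
  using assms by (auto simp: subrings_above_def subcring.axioms)

section \<open>Intermediate rings of a residual extension seen from above\<close>

text \<open>Instantiated with \<open>R\<close> in \<open>S\<close> and with R[X] in S[X], so that
  one argument treats the residual extensions of both sides.\<close>

locale field_valued_hom = B: cring B + E: field E for B (structure) and E (structure) +
  fixes \<psi> and D
  assumes hom: "\<psi> \<in> ring_hom B E"
    and D: "subring D B"
begin

definition ker where "ker = {b \<in> carrier B. \<psi> b = \<zero>\<^bsub>E\<^esub>}"

sublocale ring_hom_cring B E \<psi>
  using hom by unfold_locales

lemma D_carr [simp]: "d \<in> D \<Longrightarrow> d \<in> carrier B"
  using subringE(1)[OF D] by auto

lemma D_closed:
  "\<one>\<^bsub>B\<^esub> \<in> D" "\<zero>\<^bsub>B\<^esub> \<in> D" "\<lbrakk>a \<in> D; b \<in> D\<rbrakk> \<Longrightarrow> a \<otimes>\<^bsub>B\<^esub> b \<in> D" "\<lbrakk>a \<in> D; b \<in> D\<rbrakk> \<Longrightarrow> a \<oplus>\<^bsub>B\<^esub> b \<in> D" "a \<in> D \<Longrightarrow> \<ominus>\<^bsub>B\<^esub> a \<in> D"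
  using subringE[OF D] by auto

lemma image_mem_fractions: "d \<in> D \<Longrightarrow> \<psi> d \<in> fractions E \<psi> D"
proof -
  assume "d \<in> D"
  then have "\<psi> d \<in> carrier E" "\<psi> d \<otimes>\<^bsub>E\<^esub> \<psi> \<one>\<^bsub>B\<^esub> = \<psi> d" "\<psi> \<one>\<^bsub>B\<^esub> \<noteq> \<zero>\<^bsub>E\<^esub>" by auto
  then show "\<psi> d \<in> fractions E \<psi> D"
    unfolding fractions_def using D_closed(1) \<open>d \<in> D\<close> by blast
qed

lemma inverse_mem_fractions:
  assumes "d \<in> D" "\<psi> d \<noteq> \<zero>\<^bsub>E\<^esub>"
  shows "inv\<^bsub>E\<^esub> (\<psi> d) \<in> fractions E \<psi> D" "inv\<^bsub>E\<^esub> (\<psi> d) \<in> carrier E"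
    "inv\<^bsub>E\<^esub> (\<psi> d) \<otimes>\<^bsub>E\<^esub> \<psi> d = \<one>\<^bsub>E\<^esub>" "\<psi> d \<otimes>\<^bsub>E\<^esub> inv\<^bsub>E\<^esub> (\<psi> d) = \<one>\<^bsub>E\<^esub>"
proof -
  have u: "\<psi> d \<in> Units E" using assms by (simp add: E.field_Units)
  show "inv\<^bsub>E\<^esub> (\<psi> d) \<in> carrier E"
    "inv\<^bsub>E\<^esub> (\<psi> d) \<otimes>\<^bsub>E\<^esub> \<psi> d = \<one>\<^bsub>E\<^esub>" "\<psi> d \<otimes>\<^bsub>E\<^esub> inv\<^bsub>E\<^esub> (\<psi> d) = \<one>\<^bsub>E\<^esub>"
    using u by auto
  moreover have "inv\<^bsub>E\<^esub> (\<psi> d) \<otimes>\<^bsub>E\<^esub> \<psi> d = \<psi> \<one>\<^bsub>B\<^esub>" using u by auto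
  ultimately show "inv\<^bsub>E\<^esub> (\<psi> d) \<in> fractions E \<psi> D"
    unfolding fractions_def using D_closed(1) assms by blast
qed

lemma ker_iff: "b \<in> carrier B \<Longrightarrow> b \<in> ker \<longleftrightarrow> \<psi> b = \<zero>\<^bsub>E\<^esub>"
  by (simp add: ker_def)

text \<open>Send \<open>U\<close> to the quotients of its elements by elements of
  \<open>D - ker\<close>. The preimage of this ring is \<open>U\<close> again: if psi(v) =
  psi(u)/psi(s), then s v - u lies in \<open>ker\<close>, hence s v lies in \<open>U\<close>, and
  saturation gives v in \<open>U\<close>.\<close>

lemma family_length_saturated_le:
  "family_length (saturated_subrings B D ker) \<le> family_length (subrings_above E (fractions E \<psi> D))"
proof (rule family_length_le)
  let ?g = "\<lambda>U. {e \<in> carrier E. \<exists>u\<in>U. \<exists>s\<in>D - ker. e \<otimes>\<^bsub>E\<^esub> \<psi> s = \<psi> u}"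
  fix U assume U: "U \<in> saturated_subrings B D ker"
  note sU = saturated_subringsD(1)[OF U] and DU = saturated_subringsD(2)[OF U]
  note Uc = subringE(1)[OF sU, THEN subsetD]
  note cl = subringE(5-7)[OF sU]
  have s1: "\<one>\<^bsub>B\<^esub> \<in> D - ker" using D_closed by (auto simp: ker_def)
  have sm: "s \<otimes>\<^bsub>B\<^esub> t \<in> D - ker" if "s \<in> D - ker" "t \<in> D - ker" for s t
    using that D_closed E.integral[of "\<psi> s" "\<psi> t"] by (auto simp: ker_def)
  have gI: "e \<in> ?g U" if "e \<in> carrier E" "u \<in> U" "s \<in> D - ker" "e \<otimes>\<^bsub>E\<^esub> \<psi> s = \<psi> u" for e u s
    using that by blast
  have "subring (?g U) E"
  proof (rule E.subringI)
    show "\<one>\<^bsub>E\<^esub> \<in> ?g U" using s1 DU by (auto intro!: bexI[of _ "\<one>\<^bsub>B\<^esub>"])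
    show "\<ominus>\<^bsub>E\<^esub> e \<in> ?g U" if "e \<in> ?g U" for e
    proof -
      from that obtain u s where e: "e \<in> carrier E" "u \<in> U" "s \<in> D - ker" "e \<otimes>\<^bsub>E\<^esub> \<psi> s = \<psi> u" by auto
      then have "\<ominus>\<^bsub>E\<^esub> e \<otimes>\<^bsub>E\<^esub> \<psi> s = \<psi> (\<ominus>\<^bsub>B\<^esub> u)" by (simp add: E.l_minus Uc)
      then show ?thesis using e cl(1) by (intro gI[of _ "\<ominus>\<^bsub>B\<^esub> u" s]) auto
    qed
  next
    fix e f assume "e \<in> ?g U" "f \<in> ?g U"
    then obtain u s v t where e: "e \<in> carrier E" "u \<in> U" "s \<in> D - ker" "e \<otimes>\<^bsub>E\<^esub> \<psi> s = \<psi> u"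
      and f: "f \<in> carrier E" "v \<in> U" "t \<in> D - ker" "f \<otimes>\<^bsub>E\<^esub> \<psi> t = \<psi> v" by auto
    have st: "s \<in> D" "t \<in> D" "s \<in> U" "t \<in> U" "s \<in> carrier B" "t \<in> carrier B" using e f DU by auto
    have "e \<otimes>\<^bsub>E\<^esub> f \<otimes>\<^bsub>E\<^esub> (\<psi> s \<otimes>\<^bsub>E\<^esub> \<psi> t) = (e \<otimes>\<^bsub>E\<^esub> \<psi> s) \<otimes>\<^bsub>E\<^esub> (f \<otimes>\<^bsub>E\<^esub> \<psi> t)"
      using e(1) f(1) st by (simp add: E.m_ac)
    then have "e \<otimes>\<^bsub>E\<^esub> f \<otimes>\<^bsub>E\<^esub> \<psi> (s \<otimes>\<^bsub>B\<^esub> t) = \<psi> (u \<otimes>\<^bsub>B\<^esub> v)"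
      using e f st by (simp add: Uc)
    then show "e \<otimes>\<^bsub>E\<^esub> f \<in> ?g U"
      by (rule gI[OF E.m_closed[OF e(1) f(1)] cl(2)[OF e(2) f(2)] sm[OF e(3) f(3)]])
    have "(e \<oplus>\<^bsub>E\<^esub> f) \<otimes>\<^bsub>E\<^esub> (\<psi> s \<otimes>\<^bsub>E\<^esub> \<psi> t) = (e \<otimes>\<^bsub>E\<^esub> \<psi> s) \<otimes>\<^bsub>E\<^esub> \<psi> t \<oplus>\<^bsub>E\<^esub> (f \<otimes>\<^bsub>E\<^esub> \<psi> t) \<otimes>\<^bsub>E\<^esub> \<psi> s"
      using e(1) f(1) st by (simp add: E.m_ac E.l_distr E.r_distr)
    then have "(e \<oplus>\<^bsub>E\<^esub> f) \<otimes>\<^bsub>E\<^esub> \<psi> (s \<otimes>\<^bsub>B\<^esub> t) = \<psi> (u \<otimes>\<^bsub>B\<^esub> t \<oplus>\<^bsub>B\<^esub> v \<otimes>\<^bsub>B\<^esub> s)"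
      using e f st by (simp add: Uc)
    then show "e \<oplus>\<^bsub>E\<^esub> f \<in> ?g U"
      by (rule gI[OF E.a_closed[OF e(1) f(1)] cl(3)[OF cl(2)[OF e(2) st(4)] cl(2)[OF f(2) st(3)]] sm[OF e(3) f(3)]])
  qed auto
  moreover have "fractions E \<psi> D \<subseteq> ?g U"
    using DU by (fastforce simp: fractions_def ker_def)
  ultimately show "?g U \<in> subrings_above E (fractions E \<psi> D)"
    using E.subcringI' by (simp add: subrings_above_def)
next
  let ?g = "\<lambda>U. {e \<in> carrier E. \<exists>u\<in>U. \<exists>s\<in>D - ker. e \<otimes>\<^bsub>E\<^esub> \<psi> s = \<psi> u}"
  fix U V assume UV: "U \<in> saturated_subrings B D ker" "V \<in> saturated_subrings B D ker" "U \<subset> V"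
  note sU = saturated_subringsD(1)[OF UV(1)] and sV = saturated_subringsD(1)[OF UV(2)]
  note kU = saturated_subringsD(3)[OF UV(1)] and satU = saturated_subringsD(4)[OF UV(1)]
  from UV obtain v where v: "v \<in> V" "v \<notin> U" by auto
  have vc: "v \<in> carrier B" using v subringE(1)[OF sV] by auto
  have "\<one>\<^bsub>B\<^esub> \<in> D - ker" "\<psi> v \<in> carrier E" "\<psi> v \<otimes>\<^bsub>E\<^esub> \<psi> \<one>\<^bsub>B\<^esub> = \<psi> v"
    using vc D_closed(1) by (auto simp: ker_def)
  then have "\<psi> v \<in> ?g V" using v(1) by blast
  moreover have "\<psi> v \<notin> ?g U"
  proof
    assume "\<psi> v \<in> ?g U"
    then obtain u s where u: "u \<in> U" "s \<in> D - ker" "\<psi> v \<otimes>\<^bsub>E\<^esub> \<psi> s = \<psi> u" by auto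
    have c: "u \<in> carrier B" "s \<in> carrier B" using u subringE(1)[OF sU] by auto
    have "\<psi> s \<otimes>\<^bsub>E\<^esub> \<psi> v = \<psi> u" using u(3) c vc by (simp add: E.m_comm)
    then have "\<psi> (s \<otimes>\<^bsub>B\<^esub> v \<ominus>\<^bsub>B\<^esub> u) = \<zero>\<^bsub>E\<^esub>" using c vc by (simp add: B.minus_eq E.r_neg)
    then have "s \<otimes>\<^bsub>B\<^esub> v \<ominus>\<^bsub>B\<^esub> u \<in> ker" unfolding ker_def using c vc by simp
    then have "s \<otimes>\<^bsub>B\<^esub> v \<ominus>\<^bsub>B\<^esub> u \<in> U" using kU by blast
    then have "(s \<otimes>\<^bsub>B\<^esub> v \<ominus>\<^bsub>B\<^esub> u) \<oplus>\<^bsub>B\<^esub> u \<in> U" using subringE(7)[OF sU _ u(1)] by simp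
    moreover have "(s \<otimes>\<^bsub>B\<^esub> v \<ominus>\<^bsub>B\<^esub> u) \<oplus>\<^bsub>B\<^esub> u = s \<otimes>\<^bsub>B\<^esub> v"
      using c vc by (simp add: B.minus_eq B.a_assoc B.l_neg)
    ultimately have "v \<in> U" using satU[OF vc, of s] u(2) by simp
    with v show False by simp
  qed
  moreover have "?g U \<subseteq> ?g V" using UV(3) by blast
  ultimately show "?g U \<subset> ?g V" by (intro psubset_witnessI)
qed

text \<open>The map is T |-> preimage of T. The hypothesis \<open>full\<close> provides strictness:
  an element that belongs to the larger ring only is psi(b)/psi(s) with s in \<open>D\<close>, and
  then b separates the two preimages.\<close>

lemma family_length_le_saturated:
  assumes full: "\<And>e. e \<in> carrier E \<Longrightarrow> \<exists>b\<in>carrier B. \<exists>s\<in>D. \<psi> s \<noteq> \<zero>\<^bsub>E\<^esub> \<and> e \<otimes>\<^bsub>E\<^esub> \<psi> s = \<psi> b"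
  shows "family_length (subrings_above E (fractions E \<psi> D)) \<le> family_length (saturated_subrings B D ker)"
proof (rule family_length_le)
  let ?g = "\<lambda>T. {b \<in> carrier B. \<psi> b \<in> T}"
  fix T assume T: "T \<in> subrings_above E (fractions E \<psi> D)"
  note sT = subrings_aboveD(1)[OF T] and DT = subrings_aboveD(2)[OF T]
  note cl = subringE[OF sT]
  have "subring (?g T) B" by (rule B.subringI) (auto simp: cl)
  moreover have "D \<subseteq> ?g T" using image_mem_fractions DT by auto
  moreover have "ker \<subseteq> ?g T" unfolding ker_def using cl(2) by auto
  moreover have "b \<in> ?g T" if b: "b \<in> carrier B" "s \<in> D" "s \<notin> ker" "s \<otimes>\<^bsub>B\<^esub> b \<in> ?g T" for b s
  proof -
    have s: "s \<in> D" "\<psi> s \<noteq> \<zero>\<^bsub>E\<^esub>" "s \<in> carrier B" using b by (auto simp: ker_def)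
    note i = inverse_mem_fractions[OF s(1,2)]
    have "inv\<^bsub>E\<^esub> (\<psi> s) \<otimes>\<^bsub>E\<^esub> \<psi> (s \<otimes>\<^bsub>B\<^esub> b) \<in> T" using cl(6)[OF subsetD[OF DT i(1)], of "\<psi> (s \<otimes>\<^bsub>B\<^esub> b)"] b(4) by simp
    moreover have "inv\<^bsub>E\<^esub> (\<psi> s) \<otimes>\<^bsub>E\<^esub> \<psi> (s \<otimes>\<^bsub>B\<^esub> b) = \<psi> b"
      using s b(1) i(2,3) by (simp flip: E.m_assoc)
    ultimately show ?thesis using b by simp
  qed
  ultimately show "?g T \<in> saturated_subrings B D ker" by (rule saturated_subringsI)
next
  let ?g = "\<lambda>T. {b \<in> carrier B. \<psi> b \<in> T}"
  fix T T' assume TT: "T \<in> subrings_above E (fractions E \<psi> D)"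
    "T' \<in> subrings_above E (fractions E \<psi> D)" "T \<subset> T'"
  note sT = subrings_aboveD(1)[OF TT(1)] subrings_aboveD(1)[OF TT(2)]
    and DT = subrings_aboveD(2)[OF TT(1)] and DT' = subrings_aboveD(2)[OF TT(2)]
  from TT obtain e where e: "e \<in> T'" "e \<notin> T" by auto
  have ec: "e \<in> carrier E" using e subringE(1)[OF sT(2)] by auto
  obtain b s where b: "b \<in> carrier B" "s \<in> D" "\<psi> s \<noteq> \<zero>\<^bsub>E\<^esub>" "e \<otimes>\<^bsub>E\<^esub> \<psi> s = \<psi> b"
    using full[OF ec] by auto
  have "\<psi> s \<in> T'" using image_mem_fractions[OF b(2)] DT' by blast
  then have "b \<in> ?g T'" using b(1) subringE(6)[OF sT(2) e(1), of "\<psi> s"] b(4) by simp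
  moreover have "b \<notin> ?g T"
  proof
    assume "b \<in> ?g T"
    then have bT: "\<psi> b \<in> T" by simp
    note i = inverse_mem_fractions[OF b(2,3)]
    have "\<psi> b \<otimes>\<^bsub>E\<^esub> inv\<^bsub>E\<^esub> (\<psi> s) \<in> T" using subringE(6)[OF sT(1) bT] subsetD[OF DT i(1)] by simp
    moreover have "\<psi> b \<otimes>\<^bsub>E\<^esub> inv\<^bsub>E\<^esub> (\<psi> s) = e"
      unfolding b(4)[symmetric] using b(2) ec i(2,4) by (simp add: E.m_assoc)
    ultimately show False using e by simp
  qed
  moreover have "?g T \<subseteq> ?g T'" using TT(3) by blast
  ultimately show "?g T \<subset> ?g T'" by (intro psubset_witnessI)
qed

lemma family_length_eq_0:
  assumes full: "carrier E \<subseteq> fractions E \<psi> D"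
  shows "family_length (subrings_above E (fractions E \<psi> D)) = 0"
proof (rule family_length_le_singleton)
  show "subrings_above E (fractions E \<psi> D) \<subseteq> {carrier E}"
    using full by (auto simp: subrings_above_def dest: subcringE(1))
qed

lemma primeideal_ker: "primeideal ker B"
proof (rule primeidealI)
  show "ideal ker B"
    using ring.kernel_is_ideal unfolding ker_def a_kernel_def' .
  show "carrier B \<noteq> ker"
  proof
    assume "carrier B = ker"
    then have "\<psi> \<one>\<^bsub>B\<^esub> = \<zero>\<^bsub>E\<^esub>" using B.one_closed ker_iff by blast
    then show False by simp
  qed
  show "a \<in> ker \<or> b \<in> ker"
    if "a \<in> carrier B" "b \<in> carrier B" "a \<otimes>\<^bsub>B\<^esub> b \<in> ker" for a b
    using that by (simp add: ker_iff E.integral_iff)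
qed (rule B.is_cring)

end

section \<open>Residue fields\<close>

text \<open>The canonical map from \<open>A\<close> to kappa(Q). Later arguments use the residue
  field only through this map: its kernel is \<open>Q\<close>, and every element of the field is a
  quotient of two of its values.\<close>

definition residue_class :: "('a, 'm) ring_scheme \<Rightarrow> 'a set \<Rightarrow> 'a \<Rightarrow> ('a \<times> 'a) set set" where
  "residue_class A Q a =
     local_ideal A Q +>\<^bsub>localization A (carrier A - Q)\<^esub> frac_class A (carrier A - Q) a \<one>\<^bsub>A\<^esub>"

locale prime_localization = primeideal Q A for Q and A (structure)

sublocale prime_localization \<subseteq> loc: mult_closed A "carrier A - Q"
proof unfold_locales
  show "\<one> \<in> carrier A - Q" using one_imp_carrier I_notcarr by auto
  show "s \<otimes> t \<in> carrier A - Q" if "s \<in> carrier A - Q" "t \<in> carrier A - Q" for s t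
    using that I_prime by auto
qed auto

context prime_localization
begin

abbreviation "LQ \<equiv> localization A (carrier A - Q)"
abbreviation "\<kappa> \<equiv> residue_field A Q"
abbreviation "\<pi> x \<equiv> local_ideal A Q +>\<^bsub>LQ\<^esub> x"

lemma one_notin [simp]: "\<one> \<notin> Q"
  using loc.M_one by blast

lemma local_ideal_eq: "local_ideal A Q = loc.extended Q"
proof -
  interpret L: cring LQ by (rule loc.cring_L)
  interpret E: primeideal "loc.extended Q" LQ
    by (rule loc.extended_primeideal) (auto intro: primeideal)
  have sub: "(\<lambda>a. loc.frac a \<one>) ` Q \<subseteq> carrier LQ" using Icarr by auto
  interpret J: ideal "local_ideal A Q" LQ
    unfolding local_ideal_def using L.genideal_ideal sub by simp
  show ?thesis
  proof
    have "(\<lambda>a. loc.frac a \<one>) ` Q \<subseteq> loc.extended Q"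
      unfolding loc.extended_def using loc.M_one by blast
    then show "local_ideal A Q \<subseteq> loc.extended Q"
      unfolding local_ideal_def using L.genideal_minimal E.is_ideal by simp
    show "loc.extended Q \<subseteq> local_ideal A Q"
    proof
      fix x assume "x \<in> loc.extended Q"
      then obtain a s where x: "a \<in> Q" "s \<in> carrier A - Q" "x = loc.frac a s"
        by (auto simp: loc.extended_def)
      have "loc.frac a \<one> \<in> local_ideal A Q"
        unfolding local_ideal_def using L.genideal_self[OF sub] x by auto
      then have "loc.frac \<one> s \<otimes>\<^bsub>LQ\<^esub> loc.frac a \<one> \<in> local_ideal A Q"
        using x by (intro J.I_l_closed) auto
      moreover have "loc.frac \<one> s \<otimes>\<^bsub>LQ\<^esub> loc.frac a \<one> = x"
        using x Icarr loc.M_one by (subst loc.frac_mult) auto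
      ultimately show "x \<in> local_ideal A Q" by simp
    qed
  qed
qed

lemma local_prime: "primeideal (local_ideal A Q) LQ"
  unfolding local_ideal_eq by (rule loc.extended_primeideal) (auto intro: primeideal)

lemma mem_local_ideal:
  "\<lbrakk>a \<in> carrier A; s \<in> carrier A - Q\<rbrakk> \<Longrightarrow> loc.frac a s \<in> local_ideal A Q \<longleftrightarrow> a \<in> Q"
  unfolding local_ideal_eq using primeideal by (intro loc.mem_extended) auto

lemma proj_hom: "(\<lambda>x. \<pi> x) \<in> ring_hom LQ \<kappa>"
proof -
  interpret J: primeideal "local_ideal A Q" LQ by (rule local_prime)
  show ?thesis unfolding residue_field_def using J.rcos_ring_hom .
qed

lemma domain_residue_field: "domain \<kappa>"
proof -
  interpret J: primeideal "local_ideal A Q" LQ by (rule local_prime)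
  show ?thesis unfolding residue_field_def by (rule J.quotient_is_domain)
qed

lemma residue_field_cases:
  assumes "x \<in> carrier \<kappa>"
  obtains a s where "a \<in> carrier A" "s \<in> carrier A - Q" "x = \<pi> (loc.frac a s)"
proof -
  have "\<exists>y\<in>carrier LQ. x = \<pi> y"
    using assms unfolding residue_field_def FactRing_simps by auto
  then show ?thesis using that by (auto simp: loc.carrier_L)
qed

lemma proj_eq_zero_iff: "x \<in> carrier LQ \<Longrightarrow> \<pi> x = \<zero>\<^bsub>\<kappa>\<^esub> \<longleftrightarrow> x \<in> local_ideal A Q"
proof -
  interpret J: primeideal "local_ideal A Q" LQ by (rule local_prime)
  have z: "\<zero>\<^bsub>\<kappa>\<^esub> = local_ideal A Q" by (simp add: residue_field_def FactRing_def)
  assume x: "x \<in> carrier LQ"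
  show ?thesis unfolding z using J.rcos_const_imp_mem[OF x] J.a_rcos_const by auto
qed

lemma residue_class_hom: "residue_class A Q \<in> ring_hom A \<kappa>"
  using ring_hom_trans[OF loc.of_ring_hom proj_hom] unfolding residue_class_def comp_def .

lemma residue_class_eq_zero_iff: "a \<in> carrier A \<Longrightarrow> residue_class A Q a = \<zero>\<^bsub>\<kappa>\<^esub> \<longleftrightarrow> a \<in> Q"
  unfolding residue_class_def using loc.M_one by (subst proj_eq_zero_iff) (auto simp: mem_local_ideal)

lemma proj_frac:
  assumes "a \<in> carrier A" "s \<in> carrier A - Q"
  shows "\<pi> (loc.frac a s) \<otimes>\<^bsub>\<kappa>\<^esub> residue_class A Q s = residue_class A Q a"
proof -
  have "\<pi> (loc.frac a s) \<otimes>\<^bsub>\<kappa>\<^esub> \<pi> (loc.frac s \<one>) = \<pi> (loc.frac a s \<otimes>\<^bsub>LQ\<^esub> loc.frac s \<one>)"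
    using assms loc.M_one by (intro ring_hom_mult[OF proj_hom, symmetric]) auto
  then show ?thesis unfolding residue_class_def using assms by (simp add: loc.frac_cancel)
qed

lemma field_residue_field: "field \<kappa>"
proof -
  interpret K: domain \<kappa> by (rule domain_residue_field)
  note hom = proj_hom
  show ?thesis
  proof (rule K.cring_fieldI)
    have "x \<in> Units \<kappa>" if x: "x \<in> carrier \<kappa>" "x \<noteq> \<zero>\<^bsub>\<kappa>\<^esub>" for x
    proof -
      obtain a s where a: "a \<in> carrier A" "s \<in> carrier A - Q" "x = \<pi> (loc.frac a s)"
        using residue_field_cases[OF x(1)] .
      have aQ: "a \<in> carrier A - Q"
        using x(2) a mem_local_ideal[OF a(1,2)] proj_eq_zero_iff[of "loc.frac a s"] by auto
      let ?y = "\<pi> (loc.frac s a)"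
      have y: "?y \<in> carrier \<kappa>" using a aQ ring_hom_closed[OF hom, of "loc.frac s a"] by simp
      have "loc.frac a s \<otimes>\<^bsub>LQ\<^esub> loc.frac s a = loc.frac (a \<otimes> s) (s \<otimes> a)"
        by (rule loc.frac_mult) (use a aQ in auto)
      also have "\<dots> = \<one>\<^bsub>LQ\<^esub>"
        unfolding loc.L_one
        by (rule loc.frac_eqI) (use a aQ loc.M_mult[of s a] in \<open>auto simp: m_comm\<close>)
      finally have "loc.frac a s \<otimes>\<^bsub>LQ\<^esub> loc.frac s a = \<one>\<^bsub>LQ\<^esub>" .
      then have "x \<otimes>\<^bsub>\<kappa>\<^esub> ?y = \<one>\<^bsub>\<kappa>\<^esub>"
        using ring_hom_mult[OF hom, of "loc.frac a s" "loc.frac s a"] ring_hom_one[OF hom] a aQ by simp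
      moreover from this have "?y \<otimes>\<^bsub>\<kappa>\<^esub> x = \<one>\<^bsub>\<kappa>\<^esub>" using K.m_comm[OF x(1) y] by simp
      ultimately show ?thesis using x(1) y unfolding Units_def by blast
    qed
    then show "Units \<kappa> = carrier \<kappa> - {\<zero>\<^bsub>\<kappa>\<^esub>}"
      using K.zero_not_one by (auto simp: Units_def)
  qed
qed

lemma residue_field_quotients:
  assumes "x \<in> carrier \<kappa>"
  obtains a s where "a \<in> carrier A" "s \<in> carrier A - Q"
    "x \<otimes>\<^bsub>\<kappa>\<^esub> residue_class A Q s = residue_class A Q a"
  using residue_field_cases[OF assms] proj_frac by metis

end

lemma contraction_primeideal:
  assumes "cring A" "primeideal Q B" "h \<in> ring_hom A B"
  shows "primeideal (contraction A h Q) A"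
proof -
  interpret A: cring A by fact
  interpret Q: primeideal Q B by fact
  interpret h: ring_hom_cring A B h using assms by unfold_locales
  show ?thesis
  proof (rule primeidealI)
    show "ideal (contraction A h Q) A"
    proof (rule idealI)
      show "subgroup (contraction A h Q) (add_monoid A)"
        by (rule A.add.subgroupI) (auto simp: contraction_def intro!: exI[of _ "\<zero>\<^bsub>A\<^esub>"])
    qed (auto simp: contraction_def A.ring_axioms Q.I_l_closed Q.I_r_closed)
    show "carrier A \<noteq> contraction A h Q"
    proof
      assume "carrier A = contraction A h Q"
      then have "h \<one>\<^bsub>A\<^esub> \<in> Q" using A.one_closed unfolding contraction_def by blast
      then show False using Q.one_imp_carrier Q.I_notcarr by simp
    qed
    show "\<And>a b. \<lbrakk>a \<in> carrier A; b \<in> carrier A; a \<otimes>\<^bsub>A\<^esub> b \<in> contraction A h Q\<rbrakk>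
      \<Longrightarrow> a \<in> contraction A h Q \<or> b \<in> contraction A h Q"
      using Q.I_prime by (auto simp: contraction_def)
  qed fact
qed

text \<open>Describes the image of kappa(P) inside kappa(Q) by quotients of values on
  \<open>h(A)\<close>. After this the residue field of \<open>A\<close> disappears, since lengths
  depend only on the image.\<close>

lemma residual_image:
  assumes "cring A" "primeideal Q B" "h \<in> ring_hom A B"
  shows "residual_map B h Q ` carrier (residue_field A (contraction A h Q)) =
    fractions (residue_field B Q) (residue_class B Q) (h ` carrier A)"
proof -
  define P where "P = contraction A h Q"
  interpret P: prime_localization P A
    unfolding P_def prime_localization_def by (rule contraction_primeideal) fact+
  interpret Q: prime_localization Q B
    unfolding prime_localization_def by fact
  interpret K: field Q.\<kappa> by (rule Q.field_residue_field)
  have hc: "h a \<in> carrier B" if "a \<in> carrier A" for a using that assms(3) ring_hom_closed by metis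
  have hP: "h a \<in> Q \<longleftrightarrow> a \<in> P" if "a \<in> carrier A" for a
    using that unfolding P_def contraction_def by blast
  have sub: "h ` (carrier A - P) \<subseteq> carrier B - Q" using hc hP by blast
  let ?F = "localization_map B (carrier B - Q) h"
  have F: "?F (P.loc.frac a s) = Q.loc.frac (h a) (h s)" if "a \<in> carrier A" "s \<in> carrier A - P" for a s
    using localization_map_frac[OF P.loc.mult_closed_axioms Q.loc.mult_closed_axioms assms(3) sub that] .
  note Fh = localization_map_hom[OF P.loc.mult_closed_axioms Q.loc.mult_closed_axioms assms(3) sub]
  interpret J: primeideal "local_ideal A P" P.LQ by (rule P.local_prime)
  \<comment> \<open>The union defining \<open>residual_map\<close> runs over a coset of the maximal
    ideal of the source; it is a union of equal cosets because that ideal is mapped into the maximal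
    ideal of the target.\<close>
  have FJ: "Q.\<pi> (?F (i \<oplus>\<^bsub>P.LQ\<^esub> y)) = Q.\<pi> (?F y)"
    if i: "i \<in> local_ideal A P" and y: "y \<in> carrier P.LQ" for i y
  proof -
    obtain a s where a: "a \<in> carrier A" "s \<in> carrier A - P" "i = P.loc.frac a s"
      using J.Icarr[OF i] by (elim P.loc.L_cases)
    have aP: "a \<in> P" using i a P.mem_local_ideal by auto
    have s: "h s \<in> carrier B - Q" using sub a by auto
    have "?F i \<in> local_ideal B Q" using a aP F Q.mem_local_ideal[OF hc s] hP by auto
    moreover have c: "?F i \<in> carrier Q.LQ" "?F y \<in> carrier Q.LQ"
      using ring_hom_closed[OF Fh] J.Icarr[OF i] y by auto
    ultimately have "Q.\<pi> (?F i) = \<zero>\<^bsub>Q.\<kappa>\<^esub>" using Q.proj_eq_zero_iff by simp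
    moreover have "Q.\<pi> (?F (i \<oplus>\<^bsub>P.LQ\<^esub> y)) = Q.\<pi> (?F i) \<oplus>\<^bsub>Q.\<kappa>\<^esub> Q.\<pi> (?F y)"
      using ring_hom_add[OF Fh J.Icarr[OF i] y] ring_hom_add[OF Q.proj_hom c] by simp
    ultimately show ?thesis using ring_hom_closed[OF Q.proj_hom c(2)] by simp
  qed
  have res: "residual_map B h Q (P.\<pi> (P.loc.frac a s)) = Q.\<pi> (Q.loc.frac (h a) (h s))"
    if a: "a \<in> carrier A" "s \<in> carrier A - P" for a s
  proof -
    let ?y = "P.loc.frac a s"
    have y: "?y \<in> carrier P.LQ" using a by auto
    have "P.\<pi> ?y = (\<lambda>i. i \<oplus>\<^bsub>P.LQ\<^esub> ?y) ` local_ideal A P" by (auto simp: a_r_coset_def')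
    moreover have "local_ideal A P \<noteq> {}" using additive_subgroup.zero_closed[OF J.additive_subgroup_axioms] by blast
    ultimately have "residual_map B h Q (P.\<pi> ?y) = Q.\<pi> (?F ?y)"
      unfolding residual_map_def using FJ[OF _ y] by auto
    then show ?thesis using F a by simp
  qed
  show ?thesis unfolding P_def[symmetric]
  proof (intro equalityI subsetI)
    fix x assume "x \<in> residual_map B h Q ` carrier P.\<kappa>"
    then obtain z where z: "z \<in> carrier P.\<kappa>" "x = residual_map B h Q z" by auto
    obtain a s where a: "a \<in> carrier A" "s \<in> carrier A - P" "z = P.\<pi> (P.loc.frac a s)"
      using P.residue_field_cases[OF z(1)] .
    have s: "h a \<in> carrier B" "h s \<in> carrier B - Q" using sub hc a by auto
    have x: "x = Q.\<pi> (Q.loc.frac (h a) (h s))" using res a z by simp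
    have "x \<in> carrier Q.\<kappa>" unfolding x using s by (intro ring_hom_closed[OF Q.proj_hom]) auto
    moreover have "x \<otimes>\<^bsub>Q.\<kappa>\<^esub> residue_class B Q (h s) = residue_class B Q (h a)"
      unfolding x by (rule Q.proj_frac[OF s])
    moreover have "residue_class B Q (h s) \<noteq> \<zero>\<^bsub>Q.\<kappa>\<^esub>" using s Q.residue_class_eq_zero_iff by auto
    ultimately show "x \<in> fractions Q.\<kappa> (residue_class B Q) (h ` carrier A)"
      unfolding fractions_def using a by blast
  next
    fix x assume "x \<in> fractions Q.\<kappa> (residue_class B Q) (h ` carrier A)"
    then obtain a s where x: "x \<in> carrier Q.\<kappa>" "a \<in> carrier A" "s \<in> carrier A"
      "residue_class B Q (h s) \<noteq> \<zero>\<^bsub>Q.\<kappa>\<^esub>"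
      "x \<otimes>\<^bsub>Q.\<kappa>\<^esub> residue_class B Q (h s) = residue_class B Q (h a)"
      by (auto simp: fractions_def)
    have s: "s \<in> carrier A - P" "h s \<in> carrier B - Q"
      using x hc hP Q.residue_class_eq_zero_iff by auto
    let ?z = "P.\<pi> (P.loc.frac a s)"
    have z: "?z \<in> carrier P.\<kappa>" using x s by (intro ring_hom_closed[OF P.proj_hom]) auto
    let ?x = "Q.\<pi> (Q.loc.frac (h a) (h s))"
    have xc: "?x \<in> carrier Q.\<kappa>" using hc x s by (intro ring_hom_closed[OF Q.proj_hom]) auto
    have "?x \<otimes>\<^bsub>Q.\<kappa>\<^esub> residue_class B Q (h s) = x \<otimes>\<^bsub>Q.\<kappa>\<^esub> residue_class B Q (h s)"
      using Q.proj_frac hc x s by simp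
    then have "?x = x"
      using K.m_rcancel[of "residue_class B Q (h s)" ?x x] xc x s
        ring_hom_closed[OF Q.residue_class_hom, of "h s"] by auto
    then show "x \<in> residual_map B h Q ` carrier P.\<kappa>" using res[of a s] x s z by force
  qed
qed

lemma extension_length_residual:
  assumes "cring A" "primeideal Q B" "h \<in> ring_hom A B"
  shows "extension_length (residue_field A (contraction A h Q)) (residue_field B Q) (residual_map B h Q) =
    family_length (subrings_above (residue_field B Q)
      (fractions (residue_field B Q) (residue_class B Q) (h ` carrier A)))"
  unfolding extension_length_eq subalgebras_def residual_image[OF assms] subrings_above_def ..

section \<open>Finitely generated submodules modulo an ideal\<close>

text \<open>The value \<open>Q\<close> at the empty list makes this a span modulo \<open>Q\<close>,
  so that linear algebra over the quotient ring takes place in the ring itself.\<close>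

primrec (in cring) lspan :: "'a set \<Rightarrow> 'a set \<Rightarrow> 'a list \<Rightarrow> 'a set" where
  "lspan U Q [] = Q"
| "lspan U Q (z # zs) = {u \<otimes> z \<oplus> v | u v. u \<in> U \<and> v \<in> lspan U Q zs}"

text \<open>The exponents run downwards from d - 1 to 0, so that \<open>lspan_ConsE\<close> splits
  off the leading term. With this convention \<open>z [^] d \<in> lspan U Q (pows z d)\<close> is an
  integral equation of degree d modulo \<open>Q\<close>.\<close>

primrec (in cring) pows :: "'a \<Rightarrow> nat \<Rightarrow> 'a list" where
  "pows z 0 = []"
| "pows z (Suc d) = z [^] d # pows z d"

context cring
begin

lemma lspan_ConsI: "\<lbrakk>u \<in> U; v \<in> lspan U Q zs; w = u \<otimes> z \<oplus> v\<rbrakk> \<Longrightarrow> w \<in> lspan U Q (z # zs)"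
  by auto

lemma lspan_ConsE:
  assumes "w \<in> lspan U Q (z # zs)"
  obtains u v where "u \<in> U" "v \<in> lspan U Q zs" "w = u \<otimes> z \<oplus> v"
  using assms by auto

lemma lspan_mono: "U \<subseteq> U' \<Longrightarrow> lspan U Q zs \<subseteq> lspan U' Q zs"
  by (induction zs) auto

lemma set_pows: "z \<in> carrier R \<Longrightarrow> set (pows z d) \<subseteq> carrier R"
  by (induction d) auto

lemma subring_plus_ideal:
  assumes U: "subring U R" and I: "ideal I R"
  shows "subring {u \<oplus> i | u i. u \<in> U \<and> i \<in> I} R"
proof -
  interpret I: ideal I R by fact
  note cl = subringE[OF U]
  have Uc: "u \<in> carrier R" if "u \<in> U" for u using cl(1) that by blast
  show ?thesis
  proof (rule subringI)
    show "{u \<oplus> i | u i. u \<in> U \<and> i \<in> I} \<subseteq> carrier R" using Uc I.Icarr by auto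
    have "\<one> = \<one> \<oplus> \<zero>" by simp
    then show "\<one> \<in> {u \<oplus> i | u i. u \<in> U \<and> i \<in> I}"
      using cl(3) additive_subgroup.zero_closed[OF I.additive_subgroup_axioms] by blast
  next
    fix x assume "x \<in> {u \<oplus> i | u i. u \<in> U \<and> i \<in> I}"
    then obtain u i where x: "u \<in> U" "i \<in> I" "x = u \<oplus> i" by auto
    have "\<ominus> x = \<ominus> u \<oplus> \<ominus> i" unfolding x(3) using x Uc I.Icarr by (simp add: minus_add a_comm)
    then show "\<ominus> x \<in> {u \<oplus> i | u i. u \<in> U \<and> i \<in> I}" using cl(5)[OF x(1)] I.a_inv_closed[OF x(2)] by blast
  next
    fix x y assume "x \<in> {u \<oplus> i | u i. u \<in> U \<and> i \<in> I}" "y \<in> {u \<oplus> i | u i. u \<in> U \<and> i \<in> I}"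
    then obtain u i v j where x: "u \<in> U" "i \<in> I" "x = u \<oplus> i" and y: "v \<in> U" "j \<in> I" "y = v \<oplus> j"
      by auto
    have c: "u \<in> carrier R" "i \<in> carrier R" "v \<in> carrier R" "j \<in> carrier R"
      using x y Uc I.Icarr by auto
    have "x \<otimes> y = u \<otimes> v \<oplus> (u \<otimes> j \<oplus> (i \<otimes> v \<oplus> i \<otimes> j))" unfolding x y using c
      by (simp add: l_distr r_distr a_ac)
    moreover have "u \<otimes> j \<oplus> (i \<otimes> v \<oplus> i \<otimes> j) \<in> I"
      using I.I_l_closed[OF y(2) c(1)] I.I_r_closed[OF x(2) c(3)] I.I_r_closed[OF x(2) c(4)] by auto
    ultimately show "x \<otimes> y \<in> {u \<oplus> i | u i. u \<in> U \<and> i \<in> I}" using cl(6)[OF x(1) y(1)] by blast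
    have "x \<oplus> y = (u \<oplus> v) \<oplus> (i \<oplus> j)" unfolding x y using c by (simp add: a_ac)
    then show "x \<oplus> y \<in> {u \<oplus> i | u i. u \<in> U \<and> i \<in> I}"
      using cl(7)[OF x(1) y(1)] I.a_closed[OF x(2) y(2)] by blast
  qed
qed

end

text \<open>The scalars \<open>U\<close> vary: they are \<open>R\<close>, a larger intermediate
  ring, and the constant polynomials over \<open>R\<close> in S[X].\<close>

locale ideal_span = ideal Q A + cring A for Q and A (structure) +
  fixes U
  assumes U: "subring U A"
begin

abbreviation "sp \<equiv> lspan U Q"

lemma U_carr: "u \<in> U \<Longrightarrow> u \<in> carrier A"
  using subringE(1)[OF U] by blast

lemmas U_closed = subringE(2,3,5,6,7)[OF U]

lemma U_pow: "u \<in> U \<Longrightarrow> u [^] (n::nat) \<in> U"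
  by (induction n) (auto simp: U_closed)

lemma sp_carr: "set zs \<subseteq> carrier A \<Longrightarrow> w \<in> sp zs \<Longrightarrow> w \<in> carrier A"
  by (induction zs arbitrary: w) (auto simp: U_carr Icarr)

lemma sp_tail: "\<lbrakk>set (z # zs) \<subseteq> carrier A; w \<in> sp zs\<rbrakk> \<Longrightarrow> w \<in> sp (z # zs)"
  using U_closed(1) sp_carr[of zs w] by (intro lspan_ConsI[of \<zero> _ w]) auto

lemma sp_Q: "set zs \<subseteq> carrier A \<Longrightarrow> q \<in> Q \<Longrightarrow> q \<in> sp zs"
  by (induction zs) (use sp_tail in auto)

lemma sp_add: "\<lbrakk>set zs \<subseteq> carrier A; v \<in> sp zs; w \<in> sp zs\<rbrakk> \<Longrightarrow> v \<oplus> w \<in> sp zs"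
proof (induction zs arbitrary: v w)
  case (Cons z zs)
  obtain u v' where v: "u \<in> U" "v' \<in> sp zs" "v = u \<otimes> z \<oplus> v'" using Cons.prems(2) by (rule lspan_ConsE)
  obtain t w' where w: "t \<in> U" "w' \<in> sp zs" "w = t \<otimes> z \<oplus> w'" using Cons.prems(3) by (rule lspan_ConsE)
  have c: "u \<in> carrier A" "t \<in> carrier A" "z \<in> carrier A" "v' \<in> carrier A" "w' \<in> carrier A"
    using v w Cons.prems(1) U_carr sp_carr[of zs] by auto
  show ?case
  proof (rule lspan_ConsI)
    show "u \<oplus> t \<in> U" using v w U_closed by blast
    show "v' \<oplus> w' \<in> sp zs" using v w Cons by auto
    show "v \<oplus> w = (u \<oplus> t) \<otimes> z \<oplus> (v' \<oplus> w')" unfolding v w using c by (simp add: l_distr a_ac)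
  qed
qed auto

lemma sp_smult: "\<lbrakk>set zs \<subseteq> carrier A; v \<in> sp zs; t \<in> U\<rbrakk> \<Longrightarrow> t \<otimes> v \<in> sp zs"
proof (induction zs arbitrary: v)
  case (Cons z zs)
  obtain u v' where v: "u \<in> U" "v' \<in> sp zs" "v = u \<otimes> z \<oplus> v'" using Cons.prems(2) by (rule lspan_ConsE)
  have c: "u \<in> carrier A" "t \<in> carrier A" "z \<in> carrier A" "v' \<in> carrier A"
    using v Cons.prems U_carr sp_carr[of zs] by auto
  show ?case
  proof (rule lspan_ConsI)
    show "t \<otimes> u \<in> U" using v Cons.prems U_closed by blast
    show "t \<otimes> v' \<in> sp zs" using v Cons by auto
    show "t \<otimes> v = (t \<otimes> u) \<otimes> z \<oplus> t \<otimes> v'" unfolding v using c by (simp add: r_distr m_assoc)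
  qed
qed (auto simp: I_l_closed U_carr)

lemma sp_uminus:
  assumes "set zs \<subseteq> carrier A" "v \<in> sp zs" shows "\<ominus> v \<in> sp zs"
proof -
  have "\<ominus> \<one> \<otimes> v \<in> sp zs" using assms U_closed by (intro sp_smult) auto
  then show ?thesis using sp_carr[OF assms] by (simp add: l_minus)
qed

lemma sp_minus: "\<lbrakk>set zs \<subseteq> carrier A; v \<in> sp zs; w \<in> sp zs\<rbrakk> \<Longrightarrow> v \<ominus> w \<in> sp zs"
  unfolding minus_eq by (intro sp_add sp_uminus)

lemma sp_append:
  "\<lbrakk>set xs \<subseteq> carrier A; set ys \<subseteq> carrier A; v \<in> sp xs; w \<in> sp ys\<rbrakk> \<Longrightarrow> v \<oplus> w \<in> sp (xs @ ys)"
proof (induction xs arbitrary: v)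
  case Nil
  then show ?case using sp_add[of ys] sp_Q[of ys] by auto
next
  case (Cons x xs)
  obtain u v' where v: "u \<in> U" "v' \<in> sp xs" "v = u \<otimes> x \<oplus> v'" using Cons.prems(3) by (rule lspan_ConsE)
  have c: "u \<in> carrier A" "x \<in> carrier A" "v' \<in> carrier A" "w \<in> carrier A"
    using v Cons.prems U_carr sp_carr[of xs] sp_carr[of ys] by auto
  have "v \<oplus> w \<in> sp (x # (xs @ ys))"
  proof (rule lspan_ConsI)
    show "v' \<oplus> w \<in> sp (xs @ ys)" using v Cons by auto
    show "v \<oplus> w = u \<otimes> x \<oplus> (v' \<oplus> w)" unfolding v using c by (simp add: a_assoc)
  qed (use v in simp)
  then show ?case by simp
qed

lemma sp_map_mult:
  "\<lbrakk>set zs \<subseteq> carrier A; v \<in> sp zs; x \<in> carrier A\<rbrakk> \<Longrightarrow> x \<otimes> v \<in> sp (map (\<lambda>z. z \<otimes> x) zs)"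
proof (induction zs arbitrary: v)
  case (Cons z zs)
  obtain u v' where v: "u \<in> U" "v' \<in> sp zs" "v = u \<otimes> z \<oplus> v'" using Cons.prems(2) by (rule lspan_ConsE)
  have c: "u \<in> carrier A" "x \<in> carrier A" "z \<in> carrier A" "v' \<in> carrier A"
    using v Cons.prems U_carr sp_carr[of zs] by auto
  have "x \<otimes> v \<in> sp (z \<otimes> x # map (\<lambda>z. z \<otimes> x) zs)"
  proof (rule lspan_ConsI)
    show "x \<otimes> v' \<in> sp (map (\<lambda>z. z \<otimes> x) zs)" using v Cons by auto
    show "x \<otimes> v = u \<otimes> (z \<otimes> x) \<oplus> x \<otimes> v'" unfolding v using c by (simp add: r_distr m_ac)
  qed (use v in simp)
  then show ?case by simp
qed (auto simp: I_l_closed)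

text \<open>Transitivity of finite generation: the products of the two lists of generators
  generate.\<close>

lemma sp_trans:
  assumes es: "set es \<subseteq> carrier A" and V: "V \<subseteq> sp es"
  shows "set zs \<subseteq> carrier A \<Longrightarrow>
    lspan V Q zs \<subseteq> sp (concat (map (\<lambda>z. map (\<lambda>e. e \<otimes> z) es) zs))"
proof (induction zs)
  case (Cons z zs)
  show ?case
  proof
    fix w assume "w \<in> lspan V Q (z # zs)"
    then obtain u v where w: "u \<in> V" "v \<in> lspan V Q zs" "w = u \<otimes> z \<oplus> v" by (rule lspan_ConsE)
    have z: "z \<in> carrier A" "u \<in> carrier A" using Cons.prems sp_carr[OF es] V w by auto
    have "z \<otimes> u \<in> sp (map (\<lambda>e. e \<otimes> z) es)" using sp_map_mult[OF es _ z(1)] w V by blast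
    moreover have "v \<in> sp (concat (map (\<lambda>z. map (\<lambda>e. e \<otimes> z) es) zs))" using w Cons by auto
    ultimately have "z \<otimes> u \<oplus> v \<in> sp (map (\<lambda>e. e \<otimes> z) es @ concat (map (\<lambda>z. map (\<lambda>e. e \<otimes> z) es) zs))"
      using es Cons.prems z by (intro sp_append) auto
    then show "w \<in> sp (concat (map (\<lambda>z. map (\<lambda>e. e \<otimes> z) es) (z # zs)))"
      unfolding w using z by (simp add: m_comm)
  qed
qed auto

lemma sp_pows_mono:
  assumes z: "z \<in> carrier A" and le: "d \<le> e" and w: "w \<in> sp (pows z d)"
  shows "w \<in> sp (pows z e)"
  using le
proof (induction rule: dec_induct)
  case (step n)
  then show ?case using sp_tail[of "z [^] n" "pows z n" w] set_pows[OF z] z by simp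
qed (rule w)

lemma sp_pows_power:
  assumes z: "z \<in> carrier A" and u: "u \<in> U" and i: "i < d"
  shows "u \<otimes> z [^] i \<in> sp (pows z d)"
proof -
  have "u \<otimes> z [^] i \<in> sp (pows z (Suc i))"
    unfolding pows.simps
    by (rule lspan_ConsI[OF u, of \<zero>]) (use z U_carr[OF u] sp_Q[OF set_pows[OF z]] zero_closed in auto)
  then show ?thesis using sp_pows_mono[OF z, of "Suc i" d] i by simp
qed

lemma sp_pows_mult:
  assumes z: "z \<in> carrier A"
  shows "v \<in> sp (pows z d) \<Longrightarrow> z \<otimes> v \<in> sp (pows z (Suc d))"
proof (induction d arbitrary: v)
  case 0
  then have "z \<otimes> v \<in> Q" using z I_l_closed by simp
  then show ?case using sp_Q[OF set_pows[OF z, of "Suc 0"]] by blast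
next
  case (Suc d)
  obtain u v' where v: "u \<in> U" "v' \<in> sp (pows z d)" "v = u \<otimes> z [^] d \<oplus> v'"
    using Suc.prems unfolding pows.simps by (rule lspan_ConsE)
  have c: "u \<in> carrier A" "v' \<in> carrier A" using v U_carr sp_carr[OF set_pows[OF z]] by auto
  show ?case unfolding pows.simps(2)[of z "Suc d"]
  proof (rule lspan_ConsI)
    show "z \<otimes> v' \<in> sp (pows z (Suc d))" using Suc.IH v by blast
    show "z \<otimes> v = u \<otimes> z [^] Suc d \<oplus> z \<otimes> v'" unfolding v using c z by (simp add: r_distr m_ac)
  qed (use v in simp)
qed

text \<open>Closure under multiplication by \<open>z\<close> and by scalars gives closure under
  products, because one factor is a polynomial in \<open>z\<close> modulo \<open>Q\<close>. The
  criterion covers both a span of bounded degree with an integral equation and the whole of U[z] +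
  Q.\<close>

lemma subring_pows:
  assumes z: "z \<in> carrier A" and T: "T \<subseteq> carrier A" "\<one> \<in> T" "Q \<subseteq> T"
    and add: "\<And>v w. \<lbrakk>v \<in> T; w \<in> T\<rbrakk> \<Longrightarrow> v \<oplus> w \<in> T"
    and smult: "\<And>u v. \<lbrakk>u \<in> U; v \<in> T\<rbrakk> \<Longrightarrow> u \<otimes> v \<in> T"
    and mult: "\<And>v. v \<in> T \<Longrightarrow> z \<otimes> v \<in> T"
    and pow: "\<And>w. w \<in> T \<Longrightarrow> \<exists>e. w \<in> sp (pows z e)"
  shows "subring T A"
proof (rule subringI)
  have Tc: "v \<in> carrier A" if "v \<in> T" for v using T that by blast
  show "\<ominus> v \<in> T" if "v \<in> T" for v
  proof -
    have "\<ominus> \<one> \<in> U" using U_closed by blast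
    then have "\<ominus> \<one> \<otimes> v \<in> T" using smult that by blast
    then show ?thesis using Tc[OF that] by (simp add: l_minus)
  qed
  have zp: "z [^] (n::nat) \<otimes> v \<in> T" if "v \<in> T" for n v
  proof (induction n)
    case (Suc n)
    have "z [^] Suc n \<otimes> v = z \<otimes> (z [^] n \<otimes> v)" using Tc[OF that] z by (simp add: m_ac)
    then show ?case using mult[OF Suc] by simp
  qed (use that Tc[OF that] in simp)
  have "w \<otimes> v \<in> T" if v: "v \<in> T" and w: "w \<in> sp (pows z e)" for w v e
    using w
  proof (induction e arbitrary: w)
    case 0
    then show ?case using I_r_closed Tc[OF v] T(3) by auto
  next
    case (Suc e)
    obtain u w' where w: "u \<in> U" "w' \<in> sp (pows z e)" "w = u \<otimes> z [^] e \<oplus> w'"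
      using Suc.prems unfolding pows.simps by (rule lspan_ConsE)
    have c: "u \<in> carrier A" "w' \<in> carrier A" using w U_carr sp_carr[OF set_pows[OF z]] by auto
    have "w \<otimes> v = u \<otimes> (z [^] e \<otimes> v) \<oplus> w' \<otimes> v"
      unfolding w using c z Tc[OF v] by (simp add: l_distr m_assoc)
    then show ?case using add[OF smult[OF w(1) zp[OF v]] Suc.IH[OF w(2)]] by simp
  qed
  then show "v \<otimes> w \<in> T" if "v \<in> T" "w \<in> T" for v w
    using pow[OF that(1)] that by blast
qed (use T add in auto)

lemma one_mem_sp_pows: "\<lbrakk>z \<in> carrier A; 0 < d\<rbrakk> \<Longrightarrow> \<one> \<in> sp (pows z d)"
  using sp_pows_power[of z \<one> 0 d] U_closed(2) by simp

text \<open>Multiplication by \<open>z\<close> pushes only the term of degree d - 1 out of the span,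
  and the integral equation brings z^d back.\<close>

lemma subring_integral:
  assumes z: "z \<in> carrier A" and d: "0 < d" and int: "z [^] d \<in> sp (pows z d)"
  shows "subring (sp (pows z d)) A"
proof (rule subring_pows[OF z])
  note sub = set_pows[OF z]
  show "sp (pows z d) \<subseteq> carrier A" using sp_carr[OF sub] by blast
  show "\<one> \<in> sp (pows z d)" by (rule one_mem_sp_pows[OF z d])
  show "Q \<subseteq> sp (pows z d)" using sp_Q[OF sub] by blast
  show "z \<otimes> v \<in> sp (pows z d)" if v: "v \<in> sp (pows z d)" for v
  proof -
    obtain e where e: "d = Suc e" using d gr0_implies_Suc by blast
    obtain u v' where w: "u \<in> U" "v' \<in> sp (pows z e)" "v = u \<otimes> z [^] e \<oplus> v'"
      using v unfolding e pows.simps by (rule lspan_ConsE)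
    have c: "u \<in> carrier A" "v' \<in> carrier A" using w U_carr sp_carr[OF sub] by auto
    have "z \<otimes> v = u \<otimes> z [^] d \<oplus> z \<otimes> v'" unfolding w e using c z by (simp add: r_distr m_ac)
    moreover have "u \<otimes> z [^] d \<in> sp (pows z d)" using sp_smult[OF sub int w(1)] .
    moreover have "z \<otimes> v' \<in> sp (pows z d)" using sp_pows_mult[OF z w(2)] e by simp
    ultimately show ?thesis using sp_add[OF sub] by simp
  qed
qed (use sp_add[OF set_pows[OF z]] sp_smult[OF set_pows[OF z]] in auto)

text \<open>This is the ring U[z] + Q, exhausted by degree.\<close>

definition adjoin where "adjoin z = (\<Union>d. sp (pows z d))"

lemma adjoinI: "v \<in> sp (pows z d) \<Longrightarrow> v \<in> adjoin z"
  unfolding adjoin_def by (rule UN_I[OF UNIV_I])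

lemma adjoinE:
  assumes "v \<in> adjoin z"
  obtains d where "v \<in> sp (pows z d)"
  using assms unfolding adjoin_def by (rule UN_E)

lemma subring_adjoin:
  assumes z: "z \<in> carrier A"
  shows "subring (adjoin z) A"
proof (rule subring_pows[OF z])
  note sub = set_pows[OF z]
  show "adjoin z \<subseteq> carrier A" by (rule subsetI, elim adjoinE, rule sp_carr[OF sub])
  show "\<one> \<in> adjoin z" by (rule adjoinI[OF one_mem_sp_pows[OF z, of 1]]) simp
  show "Q \<subseteq> adjoin z" by (rule subsetI, rule adjoinI, rule sp_Q[OF sub])
  show "z \<otimes> v \<in> adjoin z" if "v \<in> adjoin z" for v
    using that by (elim adjoinE) (rule adjoinI, rule sp_pows_mult[OF z])
  show "u \<otimes> v \<in> adjoin z" if "u \<in> U" "v \<in> adjoin z" for u v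
    using that(2) by (elim adjoinE) (rule adjoinI, rule sp_smult[OF sub _ that(1)])
  show "v \<oplus> w \<in> adjoin z" if vw: "v \<in> adjoin z" "w \<in> adjoin z" for v w
  proof -
    obtain d where d: "v \<in> sp (pows z d)" using vw(1) by (rule adjoinE)
    obtain e where e: "w \<in> sp (pows z e)" using vw(2) by (rule adjoinE)
    have "v \<in> sp (pows z (max d e))" "w \<in> sp (pows z (max d e))"
      using sp_pows_mono[OF z _ d] sp_pows_mono[OF z _ e] by simp_all
    then show ?thesis by (intro adjoinI[OF sp_add[OF sub]])
  qed
  show "\<exists>e. w \<in> sp (pows z e)" if "w \<in> adjoin z" for w using that by (rule adjoinE) (rule exI)
qed

text \<open>For i \<le> k one has c^k b^i = c^(k-i) (c b)^i, and the exponents in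
  \<open>pows b e\<close> are at most e - 1; hence the bound \<open>e \<le> Suc k\<close>. Applied
  with k = d - 1, it turns a relation with leading term c b^d into an integral equation for c
  b.\<close>

lemma sp_pows_scale:
  assumes b: "b \<in> carrier A" and c: "c \<in> U"
  shows "\<lbrakk>e \<le> Suc k; v \<in> sp (pows b e)\<rbrakk> \<Longrightarrow> c [^] k \<otimes> v \<in> sp (pows (c \<otimes> b) e)"
proof (induction e arbitrary: v)
  case 0
  then show ?case using I_l_closed U_carr[OF c] by simp
next
  case (Suc e)
  obtain u v' where w: "u \<in> U" "v' \<in> sp (pows b e)" "v = u \<otimes> b [^] e \<oplus> v'"
    using Suc.prems(2) unfolding pows.simps by (rule lspan_ConsE)
  have cc: "u \<in> carrier A" "v' \<in> carrier A" "c \<in> carrier A"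
    using w U_carr sp_carr[OF set_pows[OF b]] c by auto
  show ?case unfolding pows.simps
  proof (rule lspan_ConsI)
    show "c [^] (k - e) \<otimes> u \<in> U" using U_closed(4)[OF U_pow[OF c] w(1)] .
    show "c [^] k \<otimes> v' \<in> sp (pows (c \<otimes> b) e)" using Suc w by auto
    have "c [^] k = c [^] (k - e) \<otimes> c [^] e" using Suc.prems(1) cc by (simp add: nat_pow_mult)
    then show "c [^] k \<otimes> v = c [^] (k - e) \<otimes> u \<otimes> (c \<otimes> b) [^] e \<oplus> c [^] k \<otimes> v'"
      unfolding w using cc b by (simp add: r_distr nat_pow_distrib m_ac)
  qed
qed

lemma sp_pows_unscale:
  assumes b: "b \<in> carrier A" and c: "c \<in> U"
  shows "v \<in> sp (pows (c \<otimes> b) e) \<Longrightarrow> v \<in> sp (pows b e)"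
proof (induction e arbitrary: v)
  case (Suc e)
  obtain u v' where w: "u \<in> U" "v' \<in> sp (pows (c \<otimes> b) e)" "v = u \<otimes> (c \<otimes> b) [^] e \<oplus> v'"
    using Suc.prems unfolding pows.simps by (rule lspan_ConsE)
  show ?case unfolding pows.simps
  proof (rule lspan_ConsI)
    show "u \<otimes> c [^] e \<in> U" using U_closed(4)[OF w(1) U_pow[OF c]] .
    show "v' \<in> sp (pows b e)" using Suc.IH w by blast
    show "v = u \<otimes> c [^] e \<otimes> b [^] e \<oplus> v'"
      unfolding w using b U_carr[OF w(1)] U_carr[OF c] by (simp add: nat_pow_distrib m_ac)
  qed
qed auto

lemma sp_pows_pow:
  assumes b: "b \<in> carrier A" and m: "0 < (m::nat)"
  shows "v \<in> sp (pows (b [^] m) e) \<Longrightarrow> v \<in> sp (pows b (m * e))"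
proof (induction e arbitrary: v)
  case (Suc e)
  obtain u v' where w: "u \<in> U" "v' \<in> sp (pows (b [^] m) e)" "v = u \<otimes> (b [^] m) [^] e \<oplus> v'"
    using Suc.prems unfolding pows.simps by (rule lspan_ConsE)
  have "u \<otimes> b [^] (m * e) \<in> sp (pows b (m * Suc e))" by (rule sp_pows_power[OF b w(1)]) (use m in simp)
  moreover have "v' \<in> sp (pows b (m * Suc e))"
    using sp_pows_mono[OF b _ Suc.IH[OF w(2)], of "m * Suc e"] by simp
  ultimately show ?case unfolding w nat_pow_pow[OF b] using sp_add[OF set_pows[OF b]] by simp
qed auto

end

section \<open>Ring extensions with FCP\<close>

text \<open>Comparability is stated without a direction so that ascending and descending sequences
  are both covered.\<close>

lemma infinite_chain_range:
  fixes f :: "nat \<Rightarrow> 'b set"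
  assumes f: "\<And>i j. i < j \<Longrightarrow> f i \<noteq> f j \<and> (f i \<subseteq> f j \<or> f j \<subseteq> f i)"
  shows "infinite (range f)" "subset.chain (range f) (range f)"
proof -
  have "inj f"
  proof (rule injI)
    fix i j assume "f i = f j"
    then show "i = j" using f[of i j] f[of j i] by (cases i j rule: linorder_cases) auto
  qed
  then show "infinite (range f)" by (rule range_inj_infinite)
  show "subset.chain (range f) (range f)"
  proof (rule subset.chainI)
    fix x y assume "x \<in> range f" "y \<in> range f"
    then obtain i j where "x = f i" "y = f j" by blast
    then show "(\<subset>)\<^sup>=\<^sup>= x y \<or> (\<subset>)\<^sup>=\<^sup>= y x"
      using f[of i j] f[of j i] by (cases i j rule: linorder_cases) auto
  qed simp
qed

locale fcp_extension = cring S for S (structure) +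
  fixes R
  assumes R: "subring R S"
    and finite_chain: "subset.chain {T. subring T S \<and> R \<subseteq> T} C \<Longrightarrow> finite C"
begin

lemma chain_subset: "subset.chain A A \<Longrightarrow> A \<subseteq> B \<Longrightarrow> subset.chain B A"
  by (auto simp: subset_chain_def)

lemma descending_stable:
  assumes f: "\<And>n. subring (f n) S" "\<And>n. R \<subseteq> f n" "\<And>n. f (Suc n) \<subseteq> f n"
  shows "\<exists>n. f (Suc n) = f (n::nat)"
proof (rule ccontr)
  assume "\<not> ?thesis"
  then have st: "f (Suc n) \<subset> f n" for n using f(3)[of n] by blast
  have "f j \<subset> f i" if "i < j" for i j
    using that by (induction rule: less_Suc_induct) (use st in blast)+
  then have "f i \<noteq> f j \<and> (f i \<subseteq> f j \<or> f j \<subseteq> f i)" if "i < j" for i j using that by blast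
  note i = infinite_chain_range[of f, OF this]
  have "range f \<subseteq> {T. subring T S \<and> R \<subseteq> T}" using f(1,2) by blast
  then show False using finite_chain[OF chain_subset[OF i(2)]] i(1) by blast
qed

lemma maximal_member:
  assumes "A \<noteq> {}" and sub: "\<And>T. T \<in> A \<Longrightarrow> subring T S \<and> R \<subseteq> T"
  shows "\<exists>M\<in>A. \<forall>T\<in>A. M \<subseteq> T \<longrightarrow> T = M"
proof (rule ccontr)
  assume "\<not> ?thesis"
  then have ex: "\<exists>T. T \<in> A \<and> M \<subset> T" if "M \<in> A" for M using that by blast
  obtain M0 where "M0 \<in> A" using assms(1) by blast
  then obtain f where f: "\<And>n. f n \<in> A" "\<And>n. f n \<subset> f (Suc n)"
    using dependent_nat_choice[of "\<lambda>_ T. T \<in> A" "\<lambda>_ T T'. T \<subset> T'"] ex by metis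
  have "f i \<subset> f j" if "i < j" for i j
    using lift_Suc_mono_less[of f i j] f(2) that by blast
  then have "f i \<noteq> f j \<and> (f i \<subseteq> f j \<or> f j \<subseteq> f i)" if "i < j" for i j using that by blast
  note i = infinite_chain_range[of f, OF this]
  have "range f \<subseteq> {T. subring T S \<and> R \<subseteq> T}" using f(1) sub by blast
  then show False using finite_chain[OF chain_subset[OF i(2)]] i(1) by blast
qed

end

locale fcp_prime = fcp_extension S R + primeideal Q S for S (structure) and R Q

sublocale fcp_prime \<subseteq> sp: ideal_span Q S R
  by (rule ideal_span.intro[OF is_ideal is_cring ideal_span_axioms.intro[OF R]])

context fcp_prime
begin

abbreviation sp where "sp \<equiv> lspan R Q"

lemmas R_carr = sp.U_carr
lemmas R_closed = sp.U_closed

lemma one_notin: "\<one> \<notin> Q"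
  using one_imp_carrier I_notcarr by auto

lemma Q_prime: "\<lbrakk>a \<in> carrier S; b \<in> carrier S; a \<notin> Q; b \<notin> Q\<rbrakk> \<Longrightarrow> a \<otimes> b \<notin> Q"
  using I_prime by blast

lemma Q_pow: "\<lbrakk>a \<in> carrier S; a \<notin> Q\<rbrakk> \<Longrightarrow> a [^] (n::nat) \<notin> Q"
  by (induction n) (auto simp: one_notin Q_prime)

section \<open>Consequences of chain conditions modulo a prime ideal\<close>

text \<open>The rings R + b^(n+1) S descend. Once two consecutive ones agree, b^(n+1) = r + s
  b^(n+2), that is b^(n+1) (1 - b s) = r with r in \<open>R\<close>. If r is outside
  \<open>Q\<close>, this exhibits r as a multiple of b; otherwise b s is congruent to 1.\<close>

lemma fraction_inverse:
  assumes b: "b \<in> carrier S" "b \<notin> Q"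
  shows "\<exists>b'\<in>carrier S. \<exists>r\<in>R. r \<notin> Q \<and> b \<otimes> b' \<ominus> r \<in> Q"
proof -
  \<comment> \<open>The exponent starts at 1, so that a factor b can always be split off from
    b^(n+1) (1 - b s).\<close>
  define f where "f n = {r \<oplus> i | r i. r \<in> R \<and> i \<in> PIdl (b [^] Suc n)}" for n
  have memf: "r \<oplus> s \<otimes> b [^] Suc n \<in> f n" if "r \<in> R" "s \<in> carrier S" for r s n
    using that unfolding f_def cgenideal_def by blast
  have f_E: "\<exists>r s. r \<in> R \<and> s \<in> carrier S \<and> x = r \<oplus> s \<otimes> b [^] Suc n" if "x \<in> f n" for x n
    using that unfolding f_def cgenideal_def by blast
  have "\<exists>n. f (Suc n) = f n"
  proof (rule descending_stable)
    show "subring (f n) S" for n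
      unfolding f_def using b by (intro subring_plus_ideal R cgenideal_ideal) simp
    show "R \<subseteq> f n" for n
    proof
      fix r assume r: "r \<in> R"
      then have "r \<oplus> \<zero> \<otimes> b [^] Suc n \<in> f n" by (intro memf) auto
      then show "r \<in> f n" using r b R_carr by simp
    qed
    show "f (Suc n) \<subseteq> f n" for n
    proof
      fix x assume "x \<in> f (Suc n)"
      then obtain r s where x: "r \<in> R" "s \<in> carrier S" "x = r \<oplus> s \<otimes> b [^] Suc (Suc n)"
        using f_E by blast
      have "x = r \<oplus> (s \<otimes> b) \<otimes> b [^] Suc n" unfolding x using x b by (simp add: m_ac)
      then show "x \<in> f n" using memf[of r "s \<otimes> b" n] x b by simp
    qed
  qed
  then obtain n where n: "f (Suc n) = f n" by blast
  have "\<zero> \<oplus> \<one> \<otimes> b [^] Suc n \<in> f n" by (rule memf) (auto simp: R_closed)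
  then have "b [^] Suc n \<in> f (Suc n)" using b n by simp
  then obtain r s where rs: "r \<in> R" "s \<in> carrier S" "b [^] Suc n = r \<oplus> s \<otimes> b [^] Suc (Suc n)"
    using f_E by blast
  let ?e = "\<one> \<ominus> b \<otimes> s"
  have e: "?e \<in> carrier S" using b rs by simp
  have "b [^] Suc n \<otimes> ?e = b [^] Suc n \<ominus> s \<otimes> b [^] Suc (Suc n)"
    using b rs(2) by (simp add: minus_eq r_distr r_minus m_ac)
  also have "\<dots> = r"
    using rs R_carr[OF rs(1)] b unfolding rs(3) by (simp add: minus_eq a_assoc r_neg)
  finally have r: "b [^] Suc n \<otimes> ?e = r" .
  show ?thesis
  proof (cases "r \<in> Q")
    case False
    have "b \<otimes> (b [^] n \<otimes> ?e) \<ominus> r = \<zero>"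
      using r b e R_carr[OF rs(1)] by (simp add: minus_eq r_neg m_ac)
    then show ?thesis using False rs(1) b e zero_closed
      by (intro bexI[of _ "b [^] n \<otimes> ?e"] bexI[of _ r] conjI) auto
  next
    \<comment> \<open>Powers of b stay outside \<open>Q\<close>, so 1 - b s lies in
      \<open>Q\<close>; the witnesses are then s and r = 1.\<close>
    case True
    then have "?e \<in> Q" using r Q_prime[OF _ e Q_pow[OF b, of "Suc n"]] b by auto
    then have "\<ominus> ?e \<in> Q" by simp
    moreover have "\<ominus> ?e = b \<otimes> s \<ominus> \<one>" using b rs(2) by (simp add: minus_eq minus_add a_comm)
    ultimately show ?thesis using rs(2) R_closed(2) one_notin by auto
  qed
qed

text \<open>Stability of the descending chain \<open>R[b\<^bsup>2^n\<^esup>] + Q\<close> yields an algebraic relation for \<open>b\<close>.\<close>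

lemma algebraic:
  assumes b: "b \<in> carrier S"
  shows "\<exists>d. \<exists>c\<in>R. c \<notin> Q \<and> c \<otimes> b [^] (d::nat) \<in> sp (pows b d)"
proof (rule ccontr)
  assume "\<not> ?thesis"
  then have no: "c \<in> Q" if "c \<in> R" "c \<otimes> b [^] d \<in> sp (pows b d)" for c d using that by blast
  note sub = set_pows[OF b]
  define f where "f n = sp.adjoin (b [^] ((2::nat) ^ n))" for n
  have "\<exists>n. f (Suc n) = f n"
  proof (rule descending_stable)
    show "subring (f n) S" for n unfolding f_def using b by (intro sp.subring_adjoin) simp
    show "R \<subseteq> f n" for n
    proof
      fix r assume r: "r \<in> R"
      have "r \<otimes> (b [^] ((2::nat) ^ n)) [^] (0::nat) \<in> sp (pows (b [^] ((2::nat) ^ n)) 1)"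
        using b r by (intro sp.sp_pows_power) auto
      then show "r \<in> f n" unfolding f_def using r R_carr by (intro sp.adjoinI[of _ _ 1]) simp
    qed
    show "f (Suc n) \<subseteq> f n" for n
    proof
      fix x assume "x \<in> f (Suc n)"
      then obtain d where "x \<in> sp (pows (b [^] ((2::nat) ^ Suc n)) d)"
        unfolding f_def by (rule sp.adjoinE)
      then have "x \<in> sp (pows ((b [^] ((2::nat) ^ n)) [^] (2::nat)) d)"
        using b by (simp add: nat_pow_pow mult.commute)
      from sp.sp_pows_pow[OF _ _ this] show "x \<in> f n"
        unfolding f_def using b by (intro sp.adjoinI) simp
    qed
  qed
  then obtain n where n: "f (Suc n) = f n" by blast
  define m where "m = (2::nat) ^ n"
  have m: "0 < m" by (simp add: m_def)
  define z where "z = b [^] (2 * m)"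
  have z: "z \<in> carrier S" using b by (simp add: z_def)
  have bm: "b [^] m \<in> sp (pows b e)" if "m < e" for e
    using sp.sp_pows_power[OF b R_closed(2) that] b by simp
  have "\<one> \<otimes> (b [^] m) [^] (1::nat) \<in> sp (pows (b [^] m) 2)"
    using b by (intro sp.sp_pows_power) (auto simp: R_closed)
  then have "b [^] m \<in> f n" unfolding f_def m_def[symmetric] using b by (intro sp.adjoinI) auto
  then have "b [^] m \<in> f (Suc n)" using n by simp
  then obtain d where "b [^] m \<in> sp (pows z d)"
    unfolding f_def z_def m_def power_Suc by (rule sp.adjoinE)
  \<comment> \<open>Now b^m is a polynomial in z = b^(2m) modulo \<open>Q\<close>, and its terms are
    removed from the top. Since 2 m d > m for positive d, the top term is a combination of lower
    powers of b, so its coefficient lies in \<open>Q\<close> for lack of a relation. If only a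
    constant is left, then b^m itself satisfies a relation with leading coefficient 1.\<close>
  then show False
  proof (induction d)
    case 0
    then have "\<one> \<otimes> b [^] m \<in> sp (pows b m)" using b sp.sp_Q[OF sub] by simp
    then show False using no R_closed(2) one_notin by blast
  next
    case (Suc d)
    obtain u v where w: "u \<in> R" "v \<in> sp (pows z d)" "b [^] m = u \<otimes> z [^] d \<oplus> v"
      using Suc.prems unfolding pows.simps by (rule lspan_ConsE)
    have c: "u \<in> carrier S" "v \<in> carrier S" using w R_carr sp.sp_carr[OF set_pows[OF z]] by auto
    show False
    proof (cases "d = 0")
      case True
      then have "v \<in> sp (pows b m)" using w sp.sp_Q[OF sub] by simp
      moreover have "u \<otimes> z [^] d \<in> sp (pows b m)"
        using sp.sp_pows_power[OF b w(1) m] True b c by simp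
      ultimately have "\<one> \<otimes> b [^] m \<in> sp (pows b m)" unfolding w(3)
        using sp.sp_add[OF sub] c z by simp
      then show False using no R_closed(2) one_notin by blast
    next
      case False
      have v: "v \<in> sp (pows b (2 * m * d))"
        using sp.sp_pows_pow[OF b, of "2 * m" v d] m w(2) by (simp add: z_def)
      have "u \<otimes> z [^] d = b [^] m \<ominus> v" unfolding w(3) using c z by (simp add: minus_eq a_assoc r_neg)
      also have "\<dots> \<in> sp (pows b (2 * m * d))"
        using sp.sp_minus[OF sub bm v] False m by simp
      finally have "u \<otimes> b [^] (2 * m * d) \<in> sp (pows b (2 * m * d))"
        using b by (simp add: z_def nat_pow_pow)
      then have "u \<in> Q" using no w(1) by blast
      then have "u \<otimes> z [^] d \<in> Q" using I_r_closed z by simp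
      then have "b [^] m \<in> sp (pows z d)" unfolding w(3)
        using sp.sp_add[OF set_pows[OF z] sp.sp_Q[OF set_pows[OF z]] w(2)] by blast
      then show False by (rule Suc.IH)
    qed
  qed
qed

definition P_maximal where "P_maximal \<longleftrightarrow> (\<forall>a\<in>R. a \<notin> Q \<longrightarrow> (\<exists>a'\<in>R. a \<otimes> a' \<ominus> \<one> \<in> Q))"

text \<open>Modulo \<open>Q\<close>, some multiple \<open>y\<close> of \<open>b\<close> is integral over \<open>R\<close>, of minimal degree \<open>d \<ge> 2\<close>. For \<open>a\<close>
  in \<open>R - Q\<close> the rings \<open>R[a\<^sup>n y] + Q\<close> descend; if two consecutive ones agree, comparing
  coefficients of \<open>y\<close> shows that \<open>a\<close> is invertible modulo \<open>Q\<close>.\<close>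

lemma P_maximal_if:
  assumes b: "b \<in> carrier S"
    and nf: "\<And>s r. \<lbrakk>s \<in> R; s \<notin> Q; r \<in> R\<rbrakk> \<Longrightarrow> s \<otimes> b \<ominus> r \<notin> Q"
  shows P_maximal
proof -
  let ?rel = "\<lambda>d. \<exists>c\<in>R. c \<notin> Q \<and> c \<otimes> b [^] (d::nat) \<in> sp (pows b d)"
  obtain d where d: "?rel d" and min: "\<And>e. e < d \<Longrightarrow> \<not> ?rel e"
    using exists_least_iff[of ?rel] algebraic[OF b] by blast
  then obtain c where c: "c \<in> R" "c \<notin> Q" "c \<otimes> b [^] d \<in> sp (pows b d)" by blast
  note cc = R_carr[OF c(1)]
  have "d \<noteq> 0"
  proof
    assume "d = 0" then show False using c cc by simp
  qed
  moreover have "d \<noteq> 1"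
  proof
    assume "d = 1"
    then have "c \<otimes> b \<in> sp [\<one>]" using c(3) b by simp
    then obtain u q where u: "u \<in> R" "q \<in> Q" "c \<otimes> b = u \<otimes> \<one> \<oplus> q"
      by (rule lspan_ConsE) simp
    have "c \<otimes> b \<ominus> u = q" unfolding u(3) using u R_carr Icarr by (simp add: minus_eq a_ac r_neg)
    then show False using nf[OF c(1,2) u(1)] u(2) by simp
  qed
  ultimately have d2: "2 \<le> d" by simp
  \<comment> \<open>Multiplying by the leading coefficient makes the element integral modulo
    \<open>Q\<close>, of the same degree d.\<close>
  define y where "y = c \<otimes> b"
  have y: "y \<in> carrier S" using cc b by (simp add: y_def)
  have yd: "y [^] d \<in> sp (pows y d)"
  proof -
    have "c [^] (d - 1) \<otimes> (c \<otimes> b [^] d) \<in> sp (pows y d)"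
      unfolding y_def by (rule sp.sp_pows_scale[OF b c(1) _ c(3)]) simp
    moreover have "c [^] (d - 1) \<otimes> (c \<otimes> b [^] d) = c [^] Suc (d - 1) \<otimes> b [^] d"
      using cc b by (simp add: m_assoc)
    ultimately show ?thesis unfolding y_def using d2 cc b by (simp add: nat_pow_distrib del: nat_pow_Suc)
  qed
  \<comment> \<open>Minimality of d passes from b to y, because a relation for c b is one for b with
    leading coefficient multiplied by a power of c.\<close>
  have ymin: "t \<in> Q" if e: "e < d" and t: "t \<in> R" "t \<otimes> y [^] e \<in> sp (pows y e)" for e t
  proof -
    have "t \<otimes> y [^] e = (t \<otimes> c [^] e) \<otimes> b [^] e"
      using R_carr[OF t(1)] cc b by (simp add: y_def nat_pow_distrib m_assoc)
    then have "(t \<otimes> c [^] e) \<otimes> b [^] e \<in> sp (pows b e)"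
      using sp.sp_pows_unscale[OF b c(1), of "t \<otimes> y [^] e" e] t(2) by (simp add: y_def)
    moreover have "t \<otimes> c [^] e \<in> R" using R_closed(4)[OF t(1) sp.U_pow[OF c(1)]] .
    ultimately have "t \<otimes> c [^] e \<in> Q" using min[OF e] by blast
    then show "t \<in> Q" using Q_prime[OF R_carr[OF t(1)] _ _ Q_pow[OF cc c(2)]] cc by auto
  qed
  show ?thesis unfolding P_maximal_def
  proof (intro ballI impI)
    fix a assume a: "a \<in> R" "a \<notin> Q"
    note ac = R_carr[OF a(1)]
    define z where "z n = a [^] (n::nat) \<otimes> y" for n
    have z: "z n \<in> carrier S" for n using ac y by (simp add: z_def)
    have zS: "z (Suc n) = a \<otimes> z n" for n using ac y by (simp add: z_def m_ac)
    have int: "z n [^] d \<in> sp (pows (z n) d)" for n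
    proof -
      have "(a [^] n) [^] d \<otimes> y [^] d \<in> sp (pows (z n) d)"
        unfolding z_def by (rule sp.sp_pows_scale[OF y sp.U_pow[OF a(1)] _ yd]) simp
      then show ?thesis using ac y by (simp add: z_def nat_pow_distrib)
    qed
    have "\<exists>n. sp (pows (z (Suc n)) d) = sp (pows (z n) d)"
    proof (rule descending_stable)
      show "subring (sp (pows (z n) d)) S" for n
        using d2 by (intro sp.subring_integral z int) simp
      show "R \<subseteq> sp (pows (z n) d)" for n
      proof
        fix r assume r: "r \<in> R"
        have "r \<otimes> z n [^] (0::nat) \<in> sp (pows (z n) d)"
          using r d2 by (intro sp.sp_pows_power z) auto
        then show "r \<in> sp (pows (z n) d)" using R_carr[OF r] by simp
      qed
      show "sp (pows (z (Suc n)) d) \<subseteq> sp (pows (z n) d)" for n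
        unfolding zS using sp.sp_pows_unscale[OF z a(1)] by blast
    qed
    then obtain n where n: "sp (pows (z (Suc n)) d) = sp (pows (z n) d)" by blast
    have zn: "z n \<in> sp (pows y e)" if "2 \<le> e" for e
      using sp.sp_pows_power[OF y sp.U_pow[OF a(1), of n], of 1 e] that y ac by (simp add: z_def)
    have "\<one> \<otimes> z n [^] (1::nat) \<in> sp (pows (z n) d)"
      using d2 by (intro sp.sp_pows_power z R_closed) simp
    then have "z n \<in> sp (pows (z (Suc n)) d)" using n z by simp
    then have "z n \<in> sp (pows (z (Suc n)) 2)"
    proof (rule contrapos_pp)
      assume not2: "z n \<notin> sp (pows (z (Suc n)) 2)"
      \<comment> \<open>Top terms of degree e with 2 \<le> e < d can be discarded: as
        \<open>z n\<close> is a multiple of y, the top term is a combination of powers of y below e,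
        and \<open>ymin\<close> puts its coefficient into \<open>Q\<close>. The bound 2 is needed so
        that y is among these lower powers. The induction runs upwards on the negated claim.\<close>
      have "z n \<notin> sp (pows (z (Suc n)) e)" if "2 \<le> e" "e \<le> d" for e
        using that
      proof (induction e rule: dec_induct)
        case (step e)
        show ?case
        proof
          assume "z n \<in> sp (pows (z (Suc n)) (Suc e))"
          then obtain u v where w: "u \<in> R" "v \<in> sp (pows (z (Suc n)) e)" "z n = u \<otimes> z (Suc n) [^] e \<oplus> v"
            unfolding pows.simps by (rule lspan_ConsE)
          have cu: "u \<in> carrier S" "v \<in> carrier S"
            using w R_carr sp.sp_carr[OF set_pows[OF z]] by auto
          have v: "v \<in> sp (pows y e)"
            using w(2) unfolding z_def by (rule sp.sp_pows_unscale[OF y sp.U_pow[OF a(1)]])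
          let ?t = "u \<otimes> (a [^] Suc n) [^] e"
          have "u \<otimes> z (Suc n) [^] e = z n \<ominus> v"
            unfolding w(3) using cu z by (simp add: minus_eq a_assoc r_neg)
          also have "\<dots> \<in> sp (pows y e)" using sp.sp_minus[OF set_pows[OF y] zn[OF step(1)] v] .
          finally have "?t \<otimes> y [^] e \<in> sp (pows y e)"
            using ac y cu by (simp add: z_def nat_pow_distrib m_assoc del: nat_pow_Suc)
          moreover have "?t \<in> R" using R_closed(4)[OF w(1) sp.U_pow[OF sp.U_pow[OF a(1)]]] .
          ultimately have "?t \<in> Q" using ymin[of e ?t] step by simp
          then have "u \<in> Q" using Q_prime[OF cu(1) _ _ Q_pow[OF _ Q_pow[OF ac a(2), of "Suc n"], of e]] ac by auto
          then have "u \<otimes> z (Suc n) [^] e \<in> Q" using I_r_closed z by simp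
          then have "z n \<in> sp (pows (z (Suc n)) e)"
            unfolding w(3) using sp.sp_add[OF set_pows[OF z] sp.sp_Q[OF set_pows[OF z]] w(2)] by blast
          then show False using step by simp
        qed
      qed (rule not2)
      then show "z n \<notin> sp (pows (z (Suc n)) d)" using d2 by simp
    qed
    then have "z n \<in> sp [z (Suc n), \<one>]" using z by (simp add: numeral_2_eq_2 del: lspan.simps)
    then obtain u v where u: "u \<in> R" "v \<in> sp [\<one>]" "z n = u \<otimes> z (Suc n) \<oplus> v" by (rule lspan_ConsE)
    obtain r q where r: "r \<in> R" "q \<in> Q" "v = r \<otimes> \<one> \<oplus> q" using u(2) by (rule lspan_ConsE) simp
    note cs = R_carr[OF u(1)] R_carr[OF r(1)] Icarr[OF r(2)] ac cc b
    \<comment> \<open>The relation now reads a^n y = u a^(n+1) y + r modulo \<open>Q\<close>, that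
      is a^n c (1 - u a) b is congruent to r. By \<open>nf\<close> the factor in front of b must lie
      in \<open>Q\<close>, and neither a^n nor c does.\<close>
    let ?e = "\<one> \<ominus> u \<otimes> a"
    let ?s = "a [^] n \<otimes> c \<otimes> ?e"
    have eR: "?e \<in> R" unfolding minus_eq
      using R_closed(4)[OF u(1) a(1)] R_closed(2,3,5) by blast
    have sR: "?s \<in> R" using R_closed(4) sp.U_pow[OF a(1)] c(1) eR by blast
    have "?s \<otimes> b = z n \<ominus> u \<otimes> z (Suc n)"
      unfolding z_def y_def using cs by (simp add: minus_eq r_distr l_distr r_minus l_minus m_ac)
    also have "\<dots> = v" using u z R_carr sp.sp_carr[of "[\<one>]" v] unfolding u(3)
      by (simp add: minus_eq a_ac r_neg)
    finally have "?s \<otimes> b \<ominus> r = q" unfolding r(3) using cs by (simp add: minus_eq a_ac r_neg)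
    then have "?s \<in> Q" using nf[OF sR _ r(1)] r(2) by auto
    then have "?e \<in> Q"
      using Q_prime[OF _ R_carr[OF eR] Q_prime[OF _ cc Q_pow[OF ac a(2)] c(2)]] ac cc by auto
    then have "\<ominus> ?e \<in> Q" by simp
    moreover have "\<ominus> ?e = a \<otimes> u \<ominus> \<one>" using cs by (simp add: minus_eq minus_add m_comm a_comm)
    ultimately show "\<exists>a'\<in>R. a \<otimes> a' \<ominus> \<one> \<in> Q" using u(1) by auto
  qed
qed

text \<open>Combine the multiple of b in \<open>R - Q\<close> given by
  \<open>fraction_inverse\<close> with the inverse of that element modulo \<open>Q\<close>.\<close>

lemma Q_maximal:
  assumes P_maximal and b: "b \<in> carrier S" "b \<notin> Q"
  shows "\<exists>b'\<in>carrier S. b \<otimes> b' \<ominus> \<one> \<in> Q"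
proof -
  obtain b' r where b': "b' \<in> carrier S" "r \<in> R" "r \<notin> Q" "b \<otimes> b' \<ominus> r \<in> Q"
    using fraction_inverse[OF b] by blast
  obtain r' where r': "r' \<in> R" "r \<otimes> r' \<ominus> \<one> \<in> Q" using assms(1) b' unfolding P_maximal_def by blast
  note c = b(1) b'(1) R_carr[OF b'(2)] R_carr[OF r'(1)]
  have "(b \<otimes> b' \<ominus> r) \<otimes> r' \<oplus> (r \<otimes> r' \<ominus> \<one>) = b \<otimes> (b' \<otimes> r') \<ominus> \<one>"
    using c by (simp add: minus_eq l_distr l_minus m_assoc a_assoc r_neg l_neg r_neg1)
  moreover have "(b \<otimes> b' \<ominus> r) \<otimes> r' \<oplus> (r \<otimes> r' \<ominus> \<one>) \<in> Q"
    using a_closed[OF I_r_closed[OF b'(4) c(4)] r'(2)] .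
  ultimately show ?thesis using c by auto
qed

text \<open>Ascending chains give a largest finitely generated ring \<open>M\<close> between
  \<open>R + Q\<close> and \<open>U\<close>. Any a in \<open>U\<close> is algebraic, hence integral
  modulo \<open>Q\<close> because leading coefficients are invertible; adjoining it to
  \<open>M\<close> preserves finite generation, so a lies in \<open>M\<close> already.\<close>

lemma finitely_generated:
  assumes P: P_maximal and U: "subring U S" "R \<subseteq> U" "Q \<subseteq> U"
  shows "\<exists>es. set es \<subseteq> U \<and> U \<subseteq> sp es"
proof -
  note Uc = subringE(1)[OF U(1)]
  define A where "A = {T. subring T S \<and> R \<subseteq> T \<and> Q \<subseteq> T \<and> T \<subseteq> U \<and> (\<exists>es. set es \<subseteq> U \<and> T \<subseteq> sp es)}"
  let ?T = "{r \<oplus> i | r i. r \<in> R \<and> i \<in> Q}"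
  have TA: "?T \<in> A" unfolding A_def
  proof (intro CollectI conjI exI[of _ "[\<one>]"])
    show "subring ?T S" by (rule subring_plus_ideal[OF R is_ideal])
    show "R \<subseteq> ?T"
    proof
      fix r assume "r \<in> R"
      then have "r \<in> R" "\<zero> \<in> Q" "r = r \<oplus> \<zero>" using R_carr by auto
      then show "r \<in> ?T" by blast
    qed
    show "Q \<subseteq> ?T"
    proof
      fix q assume "q \<in> Q"
      then have "\<zero> \<in> R" "q = \<zero> \<oplus> q" using Icarr R_closed by auto
      then show "q \<in> ?T" using \<open>q \<in> Q\<close> by blast
    qed
    show "?T \<subseteq> U" using U(2,3) subringE(7)[OF U(1)] by blast
    show "set [\<one>] \<subseteq> U" using subringE(3)[OF U(1)] by simp
    show "?T \<subseteq> sp [\<one>]"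
    proof
      fix x assume "x \<in> ?T"
      then obtain r q where "r \<in> R" "q \<in> Q" "x = r \<oplus> q" by blast
      then show "x \<in> sp [\<one>]" using R_carr by (intro lspan_ConsI[of r _ q]) auto
    qed
  qed
  have "A \<noteq> {}"
  proof
    assume e: "A = {}"
    show False using TA unfolding e by (rule emptyE)
  qed
  moreover have "subring T S \<and> R \<subseteq> T" if "T \<in> A" for T
    using that unfolding A_def by simp
  ultimately have "\<exists>M\<in>A. \<forall>T\<in>A. M \<subseteq> T \<longrightarrow> T = M" by (rule maximal_member)
  then obtain M where M: "M \<in> A" and max: "\<And>T. T \<in> A \<Longrightarrow> M \<subseteq> T \<Longrightarrow> T = M" by metis
  from M obtain es where Ms: "subring M S" "R \<subseteq> M" "Q \<subseteq> M" "M \<subseteq> U"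
    and es: "set es \<subseteq> U" "M \<subseteq> sp es" unfolding A_def by blast
  interpret M: ideal_span Q S M 
    by (rule ideal_span.intro[OF is_ideal is_cring ideal_span_axioms.intro[OF Ms(1)]])
  have "U \<subseteq> M"
  proof
    fix a assume aU: "a \<in> U"
    then have a: "a \<in> carrier S" using Uc by blast
    note sub = set_pows[OF a]
    obtain d c where d: "c \<in> R" "c \<notin> Q" "c \<otimes> a [^] d \<in> sp (pows a d)" using algebraic[OF a] by blast
    obtain c' where c': "c' \<in> R" "c \<otimes> c' \<ominus> \<one> \<in> Q" using P d unfolding P_maximal_def by blast
    note cc = R_carr[OF d(1)] R_carr[OF c'(1)] a
    \<comment> \<open>This element equals a^d: the first term is the scaled relation, the second a
      correction in \<open>Q\<close>.\<close>
    have "c' \<otimes> (c \<otimes> a [^] d) \<ominus> (c \<otimes> c' \<ominus> \<one>) \<otimes> a [^] d \<in> sp (pows a d)"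
      using sp.sp_minus[OF sub sp.sp_smult[OF sub d(3) c'(1)] sp.sp_Q[OF sub]] I_r_closed[OF c'(2)] a
      by simp
    moreover have "(c \<otimes> c' \<ominus> \<one>) \<otimes> a [^] d = c \<otimes> c' \<otimes> a [^] d \<ominus> a [^] d"
      using cc by (simp add: minus_eq l_distr l_minus)
    moreover have "\<dots> = c' \<otimes> (c \<otimes> a [^] d) \<ominus> a [^] d"
      using cc by (simp add: m_ac)
    moreover have "x \<ominus> (x \<ominus> y) = y" if "x \<in> carrier S" "y \<in> carrier S" for x y
      using that by (simp add: minus_eq minus_add r_neg flip: a_assoc)
    ultimately have ad: "a [^] d \<in> sp (pows a d)" using cc by simp
    then have d0: "0 < d" using one_notin a by (cases d) auto
    let ?T = "lspan M Q (pows a d)"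
    have ad': "a [^] d \<in> ?T" using lspan_mono[OF Ms(2)] ad by blast
    have T: "subring ?T S" by (rule M.subring_integral[OF a d0 ad'])
    have MT: "M \<subseteq> ?T"
    proof
      fix m assume m: "m \<in> M"
      show "m \<in> ?T" using M.sp_pows_power[OF a m d0] M.U_carr[OF m] by simp
    qed
    have TU: "w \<in> lspan M Q (pows a e) \<Longrightarrow> w \<in> U" for w e
    proof (induction e arbitrary: w)
      case (Suc e)
      obtain u v where w: "u \<in> M" "v \<in> lspan M Q (pows a e)" "w = u \<otimes> a [^] e \<oplus> v"
        using Suc.prems unfolding pows.simps by (rule lspan_ConsE)
      have "a [^] e \<in> U"
        by (induction e) (use aU subringE(3,6)[OF U(1)] in auto)
      then show ?case unfolding w using subringE(6,7)[OF U(1)] Ms(4) w(1) Suc.IH[OF w(2)] by blast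
    qed (use U(3) in auto)
    have "?T \<in> A" unfolding A_def
    proof (intro CollectI conjI exI)
      show "?T \<subseteq> sp (concat (map (\<lambda>z. map (\<lambda>e. e \<otimes> z) es) (pows a d)))"
        using sp.sp_trans[OF _ es(2) sub] es(1) Uc by blast
      have "set (pows a d) \<subseteq> U"
      proof (induction d)
        case (Suc d)
        have "a [^] d \<in> U"
          by (induction d) (use aU subringE(3,6)[OF U(1)] in auto)
        then show ?case using Suc by simp
      qed simp
      then show "set (concat (map (\<lambda>z. map (\<lambda>e. e \<otimes> z) es) (pows a d))) \<subseteq> U"
        using es(1) subringE(6)[OF U(1)] by auto
    qed (use T MT Ms TU in auto)
    then have "?T = M" using max MT by blast
    moreover have "a \<in> ?T"
    \<comment> \<open>For d = 1 the list \<open>pows a d\<close> contains only 1; then a is in the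
      span by its integral equation instead of being a generator.\<close>
    proof (cases "d = 1")
      case True
      then show ?thesis using ad' a by simp
    next
      case False
      then have "\<one> \<otimes> a [^] (1::nat) \<in> ?T" using d0 by (intro M.sp_pows_power a M.U_closed) simp
      then show ?thesis using a by simp
    qed
    ultimately show "a \<in> M" by simp
  qed
  then show ?thesis using es by blast
qed

end

section \<open>Polynomials and unit content\<close>

text \<open>Applied to membership of coefficients, it provides the degree of a polynomial modulo an
  additive subgroup.\<close>

lemma ex_last_not:
  fixes N :: nat
  assumes "\<not> P k" "\<And>n. N < n \<Longrightarrow> P n"
  obtains n where "\<not> P n" "\<And>m. n < m \<Longrightarrow> P m"
proof -
  have "n \<le> N" if "\<not> P n" for n using that assms(2)[of n] by (rule contrapos_np) simp
  then have "{n. \<not> P n} \<subseteq> {..N}" by blast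
  then have fin: "finite {n. \<not> P n}" by (rule finite_subset) simp
  have ne: "{n. \<not> P n} \<noteq> {}" using assms(1) by blast
  show ?thesis
  proof (rule that)
    show "\<not> P (Max {n. \<not> P n})" using Max_in[OF fin ne] by simp
    fix m assume m: "Max {n. \<not> P n} < m"
    show "P m"
    proof (rule ccontr)
      assume "\<not> P m"
      then have "m \<le> Max {n. \<not> P n}" by (intro Max_ge[OF fin]) simp
      with m show False by simp
    qed
  qed
qed

lemma (in ring) finsum_mem:
  assumes V: "V \<subseteq> carrier R" "\<zero> \<in> V" "\<And>x y. \<lbrakk>x \<in> V; y \<in> V\<rbrakk> \<Longrightarrow> x \<oplus> y \<in> V"
  shows "finite A \<Longrightarrow> (\<And>i. i \<in> A \<Longrightarrow> f i \<in> V) \<Longrightarrow> finsum R f A \<in> V"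
proof (induction A rule: finite_induct)
  case (insert a A)
  have "f \<in> A \<rightarrow> carrier R" "f a \<in> carrier R" using insert.prems V(1) by auto
  then show ?case using insert V(3) by simp
qed (use V in simp)

text \<open>Krull's theorem, by Zorn's lemma on the ideals that contain \<open>J\<close> and avoid
  1.\<close>

lemma (in cring) exists_maximalideal:
  assumes J: "ideal J R" "\<one> \<notin> J"
  shows "\<exists>I. maximalideal I R \<and> J \<subseteq> I"
proof -
  define A where "A = {I. ideal I R \<and> J \<subseteq> I \<and> \<one> \<notin> I}"
  have "\<exists>M\<in>A. \<forall>I\<in>A. M \<subseteq> I \<longrightarrow> I = M"
  proof (rule subset_Zorn_nonempty)
    show "A \<noteq> {}" using J unfolding A_def by blast
    fix C assume C: "C \<noteq> {}" "subset.chain A C"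
    have CA: "ideal I R" "J \<subseteq> I" "\<one> \<notin> I" if "I \<in> C" for I
      using C(2) that unfolding subset_chain_def A_def by blast+
    have two: "\<exists>I\<in>C. x \<in> I \<and> y \<in> I" if "x \<in> \<Union>C" "y \<in> \<Union>C" for x y
      using C(2) that unfolding subset_chain_def by blast
    have "ideal (\<Union>C) R"
    proof (rule idealI)
      show "subgroup (\<Union>C) (add_monoid R)"
      proof (rule add.subgroupI)
        show "\<Union>C \<subseteq> carrier R" by (rule subsetI, elim UnionE) (rule ideal.Icarr[OF CA(1)])
        obtain I where I: "I \<in> C" using C(1) by blast
        have "\<zero> \<in> I" using additive_subgroup.zero_closed[OF ideal.axioms(1)[OF CA(1)[OF I]]] .
        then show "\<Union>C \<noteq> {}" using I by blast
        show "\<ominus> x \<in> \<Union>C" if x: "x \<in> \<Union>C" for x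
        proof -
          obtain I where I: "I \<in> C" "x \<in> I" using x by blast
          interpret I: ideal I R by (rule CA(1)[OF I(1)])
          show ?thesis using I.a_inv_closed[OF I(2)] I(1) by blast
        qed
        show "x \<oplus> y \<in> \<Union>C" if xy: "x \<in> \<Union>C" "y \<in> \<Union>C" for x y
        proof -
          obtain I where I: "I \<in> C" "x \<in> I" "y \<in> I" using two[OF xy] by blast
          interpret I: ideal I R by (rule CA(1)[OF I(1)])
          show ?thesis using I.a_closed[OF I(2,3)] I(1) by blast
        qed
      qed
    next
      fix a x assume "a \<in> \<Union>C" and x: "x \<in> carrier R"
      then obtain I where I: "I \<in> C" "a \<in> I" by blast
      interpret I: ideal I R by (rule CA(1)[OF I(1)])
      show "x \<otimes> a \<in> \<Union>C" "a \<otimes> x \<in> \<Union>C"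
        using I.I_l_closed[OF I(2) x] I.I_r_closed[OF I(2) x] I(1) by blast+
    qed (rule ring_axioms)
    moreover have "J \<subseteq> \<Union>C" using C(1) CA(2) by blast
    moreover have "\<one> \<notin> \<Union>C" using CA(3) by blast
    ultimately show "\<Union>C \<in> A" unfolding A_def by simp
  qed
  then obtain M where M: "M \<in> A" "\<And>I. I \<in> A \<Longrightarrow> M \<subseteq> I \<Longrightarrow> I = M" by blast
  then have Mi: "ideal M R" "J \<subseteq> M" "\<one> \<notin> M" by (auto simp: A_def)
  have "maximalideal M R"
  proof (rule maximalidealI)
    show "carrier R \<noteq> M" using Mi(3) by auto
    fix I assume I: "ideal I R" "M \<subseteq> I" "I \<subseteq> carrier R"
    show "I = M \<or> I = carrier R"
    proof (cases "\<one> \<in> I")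
      case True then show ?thesis using ideal.one_imp_carrier[OF I(1)] by simp
    next
      case False
      then have "I \<in> A" using I Mi(2) by (auto simp: A_def)
      then show ?thesis using M(2) I(2) by blast
    qed
  qed (rule Mi(1))
  then show ?thesis using Mi(2) by blast
qed

lemma subring_finsum:
  assumes "ring S" "subring R S" "finite A" "\<And>i. i \<in> A \<Longrightarrow> f i \<in> R"
  shows "finsum (S\<lparr>carrier := R\<rparr>) f A = finsum S f A"
proof -
  interpret S: ring S by fact
  interpret R: ring "S\<lparr>carrier := R\<rparr>" using S.subring_is_ring assms(2) .
  have sub: "R \<subseteq> carrier S" using subringE(1)[OF assms(2)] .
  show ?thesis using assms(3,4)
  proof (induction A rule: finite_induct)
    case (insert a A)
    have "f \<in> A \<rightarrow> carrier S" "f a \<in> carrier S" "f \<in> A \<rightarrow> carrier (S\<lparr>carrier := R\<rparr>)"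
      "f a \<in> carrier (S\<lparr>carrier := R\<rparr>)" using insert.prems sub by auto
    then show ?case using insert by (simp add: R.finsum_insert)
  qed simp
qed

section \<open>Polynomials with coefficients in a subset\<close>

text \<open>For a subring this is the polynomial subring, for an ideal it is the ideal that it
  generates in the polynomial ring.\<close>

definition polys :: "('a, 'm) ring_scheme \<Rightarrow> 'a set \<Rightarrow> (nat \<Rightarrow> 'a) set" where
  "polys A D = {f \<in> carrier (UP A). \<forall>n. coeff (UP A) f n \<in> D}"

context UP_cring
begin

lemma polysI: "\<lbrakk>f \<in> carrier P; \<And>n. up_ring.coeff P f n \<in> D\<rbrakk> \<Longrightarrow> f \<in> polys R D"
  by (simp add: polys_def P_def)

lemma polysD: "f \<in> polys R D \<Longrightarrow> f \<in> carrier P" "f \<in> polys R D \<Longrightarrow> up_ring.coeff P f n \<in> D"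
  by (simp_all add: polys_def P_def)

lemma subring_polys:
  assumes U: "subring U R"
  shows "subring (polys R U) P"
proof (rule P.subringI)
  note cl = subringE[OF U]
  show "polys R U \<subseteq> carrier P" using polysD(1) by blast
  show "\<one>\<^bsub>P\<^esub> \<in> polys R U" by (rule polysI) (auto simp: cl)
  show "\<ominus>\<^bsub>P\<^esub> h \<in> polys R U" if "h \<in> polys R U" for h
    using polysD[OF that] cl(5) by (intro polysI) auto
  show "h1 \<oplus>\<^bsub>P\<^esub> h2 \<in> polys R U" if "h1 \<in> polys R U" "h2 \<in> polys R U" for h1 h2
    using polysD[OF that(1)] polysD[OF that(2)] cl(7) by (intro polysI) auto
  show "h1 \<otimes>\<^bsub>P\<^esub> h2 \<in> polys R U" if h: "h1 \<in> polys R U" "h2 \<in> polys R U" for h1 h2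
  proof (rule polysI)
    note p = polysD[OF h(1)] polysD[OF h(2)]
    show "h1 \<otimes>\<^bsub>P\<^esub> h2 \<in> carrier P" using p by simp
    show "up_ring.coeff P (h1 \<otimes>\<^bsub>P\<^esub> h2) n \<in> U" for n
      unfolding coeff_mult[OF p(1,3)]
      by (rule R.finsum_mem[OF cl(1,2,7)]) (use p cl(6) in auto)
  qed
qed

lemma ideal_polys:
  assumes I: "ideal I R"
  shows "ideal (polys R I) P"
proof (rule idealI)
  interpret I: ideal I R by fact
  have z: "\<zero> \<in> I" using additive_subgroup.zero_closed[OF I.additive_subgroup_axioms] .
  have sub: "I \<subseteq> carrier R" using I.Icarr by blast
  show "subgroup (polys R I) (add_monoid P)"
  proof (rule P.add.subgroupI)
    show "polys R I \<subseteq> carrier P" using polysD(1) by blast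
    have "\<zero>\<^bsub>P\<^esub> \<in> polys R I" by (rule polysI) (auto simp: z)
    then show "polys R I \<noteq> {}" by blast
    show "\<ominus>\<^bsub>P\<^esub> h \<in> polys R I" if "h \<in> polys R I" for h
      using polysD[OF that] by (intro polysI) auto
    show "h1 \<oplus>\<^bsub>P\<^esub> h2 \<in> polys R I" if "h1 \<in> polys R I" "h2 \<in> polys R I" for h1 h2
      using polysD[OF that(1)] polysD[OF that(2)] by (intro polysI) auto
  qed
  have *: "x \<otimes>\<^bsub>P\<^esub> a \<in> polys R I" if "a \<in> polys R I" "x \<in> carrier P" for a x
  proof (rule polysI)
    note p = polysD[OF that(1)]
    show "x \<otimes>\<^bsub>P\<^esub> a \<in> carrier P" using p that by simp
    show "up_ring.coeff P (x \<otimes>\<^bsub>P\<^esub> a) n \<in> I" for n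
      unfolding coeff_mult[OF that(2) p(1)]
      by (rule R.finsum_mem[OF sub z]) (use p that I.I_l_closed in auto)
  qed
  show "x \<otimes>\<^bsub>P\<^esub> a \<in> polys R I" "a \<otimes>\<^bsub>P\<^esub> x \<in> polys R I" if "a \<in> polys R I" "x \<in> carrier P" for a x
    using *[OF that] P.m_comm[OF that(2) polysD(1)[OF that(1)]] by simp_all
qed (rule P.ring_axioms)

text \<open>Compare the product of the last coefficient of \<open>g\<close> outside \<open>Q\<close> with the last
  coefficient of \<open>f\<close> outside \<open>V\<close>.\<close>

lemma polys_saturated:
  assumes g: "g \<in> polys R D" "g \<notin> polys R Q" and f: "f \<in> carrier P" and gf: "g \<otimes>\<^bsub>P\<^esub> f \<in> polys R V"
    and V: "V \<subseteq> carrier R" "\<zero> \<in> V" "\<And>x y. \<lbrakk>x \<in> V; y \<in> V\<rbrakk> \<Longrightarrow> x \<oplus> y \<in> V" "\<And>x. x \<in> V \<Longrightarrow> \<ominus> x \<in> V"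
    and DV: "\<And>s v. \<lbrakk>s \<in> D; v \<in> V\<rbrakk> \<Longrightarrow> s \<otimes> v \<in> V"
    and QV: "\<And>q b. \<lbrakk>q \<in> Q; b \<in> carrier R\<rbrakk> \<Longrightarrow> q \<otimes> b \<in> V" and zQ: "\<zero> \<in> Q"
    and sat: "\<And>s b. \<lbrakk>s \<in> D; s \<notin> Q; b \<in> carrier R; s \<otimes> b \<in> V\<rbrakk> \<Longrightarrow> b \<in> V"
  shows "f \<in> polys R V"
proof (rule ccontr)
  assume "f \<notin> polys R V"
  then obtain k where k: "up_ring.coeff P f k \<notin> V" using polysI f by blast
  note gP = polysD(1)[OF g(1)] and gD = polysD(2)[OF g(1)]
  obtain l where l: "up_ring.coeff P g l \<notin> Q" using polysI gP g(2) by blast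
  obtain n where n: "up_ring.coeff P f n \<notin> V" "\<And>j. n < j \<Longrightarrow> up_ring.coeff P f j \<in> V"
    by (rule ex_last_not[of "\<lambda>j. up_ring.coeff P f j \<in> V" k "deg R f"]) (use k f V(2) deg_aboveD in auto)
  obtain m where m: "up_ring.coeff P g m \<notin> Q" "\<And>j. m < j \<Longrightarrow> up_ring.coeff P g j \<in> Q"
    by (rule ex_last_not[of "\<lambda>j. up_ring.coeff P g j \<in> Q" l "deg R g"]) (use l gP zQ deg_aboveD in auto)
  let ?F = "\<lambda>i. up_ring.coeff P g i \<otimes> up_ring.coeff P f (m + n - i)"
  have "?F i \<in> V" if "i \<in> {..m + n} - {m}" for i
  proof (cases "m < i")
    case True then show ?thesis using m(2) QV f by simp
  next
    case False
    then have "n < m + n - i" using that by auto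
    then show ?thesis using n(2) DV gD by blast
  qed
  then have rest: "finsum R ?F ({..m + n} - {m}) \<in> V"
    by (intro R.finsum_mem[OF V(1-3)]) auto
  have "up_ring.coeff P (g \<otimes>\<^bsub>P\<^esub> f) (m + n) = finsum R ?F (insert m ({..m + n} - {m}))"
    unfolding coeff_mult[OF gP f] by (rule arg_cong[where f = "finsum R ?F"]) auto
  also have "\<dots> = ?F m \<oplus> finsum R ?F ({..m + n} - {m})"
    using f gP by (intro R.finsum_insert) auto
  finally have "?F m \<oplus> finsum R ?F ({..m + n} - {m}) \<in> V" using polysD(2)[OF gf] by metis
  then have "(?F m \<oplus> finsum R ?F ({..m + n} - {m})) \<oplus> \<ominus> finsum R ?F ({..m + n} - {m}) \<in> V"
    using V(3,4) rest by blast
  then have "?F m \<in> V" using f gP subsetD[OF V(1) rest] by (simp add: R.a_assoc R.r_neg)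
  then have "up_ring.coeff P f n \<in> V" using sat[OF gD m(1)] f by simp
  then show False using n(1) by simp
qed

text \<open>Gauss's lemma in the form for prime ideals: the instance of
  \<open>polys_saturated\<close> in which \<open>D\<close> is the whole ring and \<open>V\<close> is
  \<open>Q\<close>, saturation being primality.\<close>

lemma primeideal_polys:
  assumes Q: "primeideal Q R"
  shows "primeideal (polys R Q) P"
proof (rule primeidealI)
  interpret Q: primeideal Q R by fact
  show "ideal (polys R Q) P" by (rule ideal_polys[OF Q.is_ideal])
  show "carrier P \<noteq> polys R Q"
  proof
    assume "carrier P = polys R Q"
    then have "up_ring.coeff P \<one>\<^bsub>P\<^esub> 0 \<in> Q" using polysD(2) P.one_closed by blast
    then show False using Q.one_imp_carrier Q.I_notcarr by simp
  qed
  fix g f assume g: "g \<in> carrier P" and f: "f \<in> carrier P" and gf: "g \<otimes>\<^bsub>P\<^esub> f \<in> polys R Q"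
  show "g \<in> polys R Q \<or> f \<in> polys R Q"
  proof (rule disjCI, rule ccontr)
    assume "f \<notin> polys R Q" "g \<notin> polys R Q"
    have gc: "g \<in> polys R (carrier R)" using g by (intro polysI) auto
    have "f \<in> polys R Q"
      by (rule polys_saturated[where V = Q, OF gc \<open>g \<notin> polys R Q\<close> f gf])
        (use g Q.I_prime Q.Icarr Q.I_l_closed Q.I_r_closed Q.a_closed Q.a_inv_closed
          additive_subgroup.zero_closed[OF Q.additive_subgroup_axioms] in auto)
    then show False using \<open>f \<notin> polys R Q\<close> by simp
  qed
qed (rule P.is_cring)

section \<open>Multiplicativity of unit content\<close>

lemma unit_content_iff:
  "p \<in> unit_content R \<longleftrightarrow>
     p \<in> carrier P \<and> (\<forall>J. ideal J R \<longrightarrow> (\<forall>n. up_ring.coeff P p n \<in> J) \<longrightarrow> J = carrier R)"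
proof -
  have "Idl (range (up_ring.coeff P p)) = carrier R \<longleftrightarrow>
      (\<forall>J. ideal J R \<longrightarrow> (\<forall>n. up_ring.coeff P p n \<in> J) \<longrightarrow> J = carrier R)" if p: "p \<in> carrier P"
  proof
    have sub: "range (up_ring.coeff P p) \<subseteq> carrier R" using p by auto
    show "\<forall>J. ideal J R \<longrightarrow> (\<forall>n. up_ring.coeff P p n \<in> J) \<longrightarrow> J = carrier R"
      if e: "Idl (range (up_ring.coeff P p)) = carrier R"
    proof (intro allI impI)
      fix J assume J: "ideal J R" "\<forall>n. up_ring.coeff P p n \<in> J"
      then have "Idl (range (up_ring.coeff P p)) \<subseteq> J" by (intro R.genideal_minimal) auto
      then show "J = carrier R" using e ideal.Icarr[OF J(1)] by blast
    qed
    show "Idl (range (up_ring.coeff P p)) = carrier R"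
      if all: "\<forall>J. ideal J R \<longrightarrow> (\<forall>n. up_ring.coeff P p n \<in> J) \<longrightarrow> J = carrier R"
      using all R.genideal_ideal[OF sub] R.genideal_self[OF sub] by blast
  qed
  then show ?thesis by (auto simp: unit_content_def P_def)
qed

lemma unit_content_prime:
  assumes "p \<in> unit_content R" "primeideal Q R"
  shows "p \<notin> polys R Q"
proof
  interpret Q: primeideal Q R by fact
  assume "p \<in> polys R Q"
  then have "Q = carrier R" using assms(1) polysD(2) Q.is_ideal unfolding unit_content_iff by blast
  then show False using Q.I_notcarr by simp
qed

text \<open>If the coefficients of f g lay in a proper ideal, they would lie in a maximal one; being
  prime, it would contain all coefficients of f or all coefficients of g.\<close>

lemma mult_closed_unit_content: "mult_closed P (unit_content R)"
proof (rule mult_closed.intro[OF P.is_cring mult_closed_axioms.intro])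
  show "unit_content R \<subseteq> carrier P" by (auto simp: unit_content_iff)
  show "\<one>\<^bsub>P\<^esub> \<in> unit_content R" unfolding unit_content_iff
  proof (intro conjI allI impI)
    fix J assume J: "ideal J R" "\<forall>n. up_ring.coeff P \<one>\<^bsub>P\<^esub> n \<in> J"
    then have "up_ring.coeff P \<one>\<^bsub>P\<^esub> 0 \<in> J" by blast
    then show "J = carrier R" using ideal.one_imp_carrier[OF J(1)] by simp
  qed simp
  fix f g assume fg: "f \<in> unit_content R" "g \<in> unit_content R"
  then have c: "f \<in> carrier P" "g \<in> carrier P" by (auto simp: unit_content_iff)
  show "f \<otimes>\<^bsub>P\<^esub> g \<in> unit_content R" unfolding unit_content_iff
  proof (intro conjI allI impI)
    fix J assume J: "ideal J R" "\<forall>n. up_ring.coeff P (f \<otimes>\<^bsub>P\<^esub> g) n \<in> J"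
    show "J = carrier R"
    proof (rule ccontr)
      assume "J \<noteq> carrier R"
      then have "\<one> \<notin> J" using ideal.one_imp_carrier[OF J(1)] by blast
      then obtain I where I: "maximalideal I R" "J \<subseteq> I" using R.exists_maximalideal[OF J(1)] by blast
      have p: "primeideal I R" by (rule R.maximalideal_prime[OF I(1)])
      interpret PI: primeideal "polys R I" P by (rule primeideal_polys[OF p])
      have "f \<otimes>\<^bsub>P\<^esub> g \<in> polys R I" using J(2) I(2) c by (intro polysI) auto
      then show False using PI.I_prime[OF c] unit_content_prime[OF _ p] fg by blast
    qed
  qed (use c in simp)
qed

end

lemma UP_subring:
  assumes S: "cring S" and R: "subring R S"
  defines "R' \<equiv> S\<lparr>carrier := R\<rparr>"
  shows "cring R'" "carrier (UP R') = polys S R" "id \<in> ring_hom (UP R') (UP S)"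
    "unit_content R' \<subseteq> unit_content S"
proof -
  interpret S: cring S by fact
  show cR: "cring R'"
    unfolding R'_def using S.subcringI'[OF R] S.subcring_iff[OF subringE(1)[OF R]] by simp
  interpret R: cring R' by fact
  interpret PS: UP_cring S "UP S" by unfold_locales
  interpret PR: UP_cring R' "UP R'" by unfold_locales
  note sub = subringE(1)[OF R]
  have up: "up R' = {f \<in> up S. \<forall>n. f n \<in> R}"
  proof (intro equalityI subsetI)
    fix f assume "f \<in> up R'"
    then show "f \<in> {f \<in> up S. \<forall>n. f n \<in> R}" using sub unfolding up_def R'_def Pi_def by simp blast
  next
    fix f assume "f \<in> {f \<in> up S. \<forall>n. f n \<in> R}"
    then show "f \<in> up R'" unfolding up_def R'_def Pi_def by simp
  qed
  show carr: "carrier (UP R') = polys S R"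
    unfolding polys_def UP_def up by (simp cong: conj_cong)
  have pR: "p n \<in> R" if "p \<in> up R'" for p n using that unfolding up by simp
  have upS: "p \<in> up S" if "p \<in> up R'" for p using that unfolding up by simp
  have cU: "carrier (UP A) = up A" for A :: "('a, 'm) ring_scheme" by (simp add: UP_def)
  have cf: "coeff (UP A) p n = p n" if "p \<in> up A" for p n and A :: "('a, 'm) ring_scheme"
    unfolding UP_def using that by simp
  show "id \<in> ring_hom (UP R') (UP S)"
  proof (rule ring_hom_memI)
    show "id x \<in> carrier (UP S)" if "x \<in> carrier (UP R')" for x
      using that upS unfolding cU by simp
    show "id (x \<otimes>\<^bsub>UP R'\<^esub> y) = id x \<otimes>\<^bsub>UP S\<^esub> id y"
      if "x \<in> carrier (UP R')" "y \<in> carrier (UP R')" for x y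
    proof -
      have xy: "x \<in> up R'" "y \<in> up R'" using that unfolding cU by simp_all
      have "finsum R' (\<lambda>i. x i \<otimes>\<^bsub>S\<^esub> y (n - i)) {..n} = finsum S (\<lambda>i. x i \<otimes>\<^bsub>S\<^esub> y (n - i)) {..n}" for n
        unfolding R'_def
        by (rule subring_finsum[OF S.ring_axioms R]) (use xy pR subringE(6)[OF R] in auto)
      then show ?thesis unfolding UP_def using xy upS[OF xy(1)] upS[OF xy(2)] by (simp, simp add: R'_def)
    qed
    show "id (x \<oplus>\<^bsub>UP R'\<^esub> y) = id x \<oplus>\<^bsub>UP S\<^esub> id y"
      if "x \<in> carrier (UP R')" "y \<in> carrier (UP R')" for x y
    proof -
      have xy: "x \<in> up R'" "y \<in> up R'" using that unfolding cU by simp_all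
      then show ?thesis unfolding UP_def using upS[OF xy(1)] upS[OF xy(2)] by (simp, simp add: R'_def)
    qed
    have "\<one>\<^bsub>R'\<^esub> = \<one>\<^bsub>S\<^esub>" "\<zero>\<^bsub>R'\<^esub> = \<zero>\<^bsub>S\<^esub>" by (simp_all add: R'_def)
    then show "id \<one>\<^bsub>UP R'\<^esub> = \<one>\<^bsub>UP S\<^esub>" unfolding UP_def by (simp cong: if_cong)
  qed
  show "unit_content R' \<subseteq> unit_content S"
  proof
    fix p assume "p \<in> unit_content R'"
    then have p: "p \<in> carrier (UP R')"
      and un: "\<And>J. \<lbrakk>ideal J R'; \<And>n. coeff (UP R') p n \<in> J\<rbrakk> \<Longrightarrow> J = carrier R'"
      by (auto simp: PR.unit_content_iff)
    have pu: "p \<in> up R'" using p unfolding cU .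
    show "p \<in> unit_content S" unfolding PS.unit_content_iff
    proof (intro conjI allI impI)
      show "p \<in> carrier (UP S)" using upS[OF pu] unfolding cU .
      fix J assume J: "ideal J S" "\<forall>n. coeff (UP S) p n \<in> J"
      interpret J: ideal J S by fact
      have hom: "id \<in> ring_hom R' S" by (rule ring_hom_memI) (use sub in \<open>auto simp: R'_def\<close>)
      interpret h: ring_hom_ring R' S id by (rule ring_hom_ringI2[OF R.ring_axioms S.ring_axioms hom])
      \<comment> \<open>The contraction of \<open>J\<close> to the subring contains all
        coefficients, so it contains 1, and therefore so does \<open>J\<close>.\<close>
      have "ideal {r \<in> carrier R'. id r \<in> J} R'" by (rule h.ideal_vimage[OF J(1)])
      moreover have "coeff (UP R') p n \<in> {r \<in> carrier R'. id r \<in> J}" for n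
        using J(2)[rule_format, of n] cf[OF pu, of n] cf[OF upS[OF pu], of n] pR[OF pu, of n] by (simp add: R'_def)
      ultimately have "{r \<in> carrier R'. id r \<in> J} = carrier R'" by (rule un)
      then have "\<one>\<^bsub>S\<^esub> \<in> J" using R.one_closed by (auto simp: R'_def)
      then show "J = carrier S" by (rule J.one_imp_carrier)
    qed
  qed
qed

section \<open>Intermediate rings of the polynomial extension\<close>

text \<open>Think of \<open>\<Gamma> h n\<close> as saying that \<open>h\<close> is represented by a polynomial of degree exactly
  \<open>n\<close>. Since the degree survives elimination, this replaces the usual count of equations
  and unknowns.\<close>

lemma (in ideal_span) dependency:
  assumes closed: "\<And>h1 h2 n1 n2 u1 u2. \<lbrakk>\<Gamma> h1 n1; \<Gamma> h2 n2; n1 < n2; u1 \<in> U; u1 \<notin> Q; u2 \<in> U\<rbrakk>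
      \<Longrightarrow> \<Gamma> (u1 \<otimes> h2 \<ominus> u2 \<otimes> h1) n2"
  shows "\<lbrakk>set zs \<subseteq> carrier A; \<And>n::nat. \<exists>m\<ge>n. \<exists>h\<in>sp zs. \<Gamma> h m\<rbrakk> \<Longrightarrow> \<exists>m\<ge>n. \<exists>h\<in>Q. \<Gamma> h m"
proof (induction zs arbitrary: n)
  case (Cons z zs)
  have zs: "set zs \<subseteq> carrier A" and z: "z \<in> carrier A" using Cons.prems(1) by auto
  show ?case
  proof (rule Cons.IH[OF zs])
    fix n
    obtain m1 h1 where 1: "n \<le> m1" "h1 \<in> sp (z # zs)" "\<Gamma> h1 m1" using Cons.prems(2) by blast
    \<comment> \<open>Eliminating z from h1 and h2 gives u1 h2 - u2 h1. A degree strictly above that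
      of h1 ensures that the subtraction does not disturb the top term of u1 h2.\<close>
    obtain m2 h2 where 2: "Suc m1 \<le> m2" "h2 \<in> sp (z # zs)" "\<Gamma> h2 m2" using Cons.prems(2) by blast
    obtain u1 v1 where h1: "u1 \<in> U" "v1 \<in> sp zs" "h1 = u1 \<otimes> z \<oplus> v1" using 1(2) by (rule lspan_ConsE)
    obtain u2 v2 where h2: "u2 \<in> U" "v2 \<in> sp zs" "h2 = u2 \<otimes> z \<oplus> v2" using 2(2) by (rule lspan_ConsE)
    note c = U_carr[OF h1(1)] U_carr[OF h2(1)] sp_carr[OF zs h1(2)] sp_carr[OF zs h2(2)] z
    show "\<exists>m\<ge>n. \<exists>h\<in>sp zs. \<Gamma> h m"
    proof (cases "u1 \<in> Q")
      \<comment> \<open>If the coefficient of z in h1 lies in \<open>Q\<close>, there is nothing to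
        eliminate: h1 is in the shorter span already.\<close>
      case True
      then have "h1 \<in> sp zs" unfolding h1(3)
        using sp_add[OF zs sp_Q[OF zs I_r_closed[OF True z]] h1(2)] by simp
      then show ?thesis using 1 by blast
    next
      case False
      have "u1 \<otimes> h2 \<ominus> u2 \<otimes> h1 = u1 \<otimes> v2 \<ominus> u2 \<otimes> v1"
      proof -
        have "u1 \<otimes> h2 = u1 \<otimes> u2 \<otimes> z \<oplus> u1 \<otimes> v2" "u2 \<otimes> h1 = u1 \<otimes> u2 \<otimes> z \<oplus> u2 \<otimes> v1"
          unfolding h1 h2 using c by (simp_all add: r_distr m_ac)
        moreover have "(x \<oplus> y) \<ominus> (x \<oplus> w) = y \<ominus> w"
          if "x \<in> carrier A" "y \<in> carrier A" "w \<in> carrier A" for x y w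
        proof -
          have "(x \<oplus> y) \<ominus> (x \<oplus> w) = (x \<oplus> \<ominus> x) \<oplus> (y \<oplus> \<ominus> w)"
            using that by (simp add: minus_eq minus_add a_ac del: r_neg)
          then show ?thesis using that by (simp add: minus_eq r_neg)
        qed
        ultimately show ?thesis using c by simp
      qed
      moreover have "u1 \<otimes> v2 \<ominus> u2 \<otimes> v1 \<in> sp zs"
        using sp_minus[OF zs sp_smult[OF zs h2(2) h1(1)] sp_smult[OF zs h1(2) h2(1)]] .
      moreover have "\<Gamma> (u1 \<otimes> h2 \<ominus> u2 \<otimes> h1) m2"
        using closed[OF 1(3) 2(3) _ h1(1) False h2(1)] 2(1) by simp
      moreover have "n \<le> m2" using 1(1) 2(1) by simp
      ultimately show ?thesis by metis
    qed
  qed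
qed simp

text \<open>Degrees are bounded modulo \<open>J\<close> only, so the top coefficients multiply only
  up to an element of \<open>J\<close>.\<close>

lemma (in UP_cring) top_coeff_mult:
  assumes J: "ideal J R" and f: "f \<in> carrier P" "\<And>j. n < j \<Longrightarrow> up_ring.coeff P f j \<in> J"
    and g: "g \<in> carrier P" "\<And>j. m < j \<Longrightarrow> up_ring.coeff P g j \<in> J"
  shows "up_ring.coeff P (f \<otimes>\<^bsub>P\<^esub> g) (n + m) \<ominus> up_ring.coeff P f n \<otimes> up_ring.coeff P g m \<in> J"
    and "n + m < k \<Longrightarrow> up_ring.coeff P (f \<otimes>\<^bsub>P\<^esub> g) k \<in> J"
proof -
  interpret J: ideal J R by fact
  have sub: "J \<subseteq> carrier R" using J.Icarr by blast
  have z: "\<zero> \<in> J" using additive_subgroup.zero_closed[OF J.additive_subgroup_axioms] .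
  have FJ: "up_ring.coeff P f i \<otimes> up_ring.coeff P g (k - i) \<in> J" if "n < i \<or> m < k - i" for i k
    using that f g J.I_l_closed J.I_r_closed by auto
  show "up_ring.coeff P (f \<otimes>\<^bsub>P\<^esub> g) k \<in> J" if k: "n + m < k"
    unfolding coeff_mult[OF f(1) g(1)]
  proof (rule R.finsum_mem[OF sub z])
    show "up_ring.coeff P f i \<otimes> up_ring.coeff P g (k - i) \<in> J" if "i \<in> {..k}" for i
      by (rule FJ) (use k that in auto)
  qed auto
  let ?F = "\<lambda>i. up_ring.coeff P f i \<otimes> up_ring.coeff P g (n + m - i)"
  have rest: "finsum R ?F ({..n + m} - {n}) \<in> J"
  proof (rule R.finsum_mem[OF sub z])
    show "?F i \<in> J" if "i \<in> {..n + m} - {n}" for i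
      by (rule FJ) (use that in auto)
  qed auto
  have "up_ring.coeff P (f \<otimes>\<^bsub>P\<^esub> g) (n + m) = finsum R ?F (insert n ({..n + m} - {n}))"
    unfolding coeff_mult[OF f(1) g(1)] by (rule arg_cong[where f = "finsum R ?F"]) auto
  also have "\<dots> = ?F n \<oplus> finsum R ?F ({..n + m} - {n})"
    using f g by (intro R.finsum_insert) auto
  finally have "up_ring.coeff P (f \<otimes>\<^bsub>P\<^esub> g) (n + m) \<ominus> ?F n = finsum R ?F ({..n + m} - {n})"
    using f(1) g(1) subsetD[OF sub rest] by (simp add: R.minus_eq R.a_ac R.r_neg1 R.r_neg2)
  then show "up_ring.coeff P (f \<otimes>\<^bsub>P\<^esub> g) (n + m) \<ominus> up_ring.coeff P f n \<otimes> up_ring.coeff P g m \<in> J"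
    using rest by simp
qed

sublocale fcp_prime \<subseteq> PX: UP_cring S "UP S"
  by unfold_locales

section \<open>Linear algebra in S[X] modulo Q[X]\<close>

context fcp_prime
begin

abbreviation "SX \<equiv> UP S"
abbreviation cf where "cf \<equiv> up_ring.coeff (UP S)"
abbreviation mon where "mon \<equiv> up_ring.monom (UP S)"
abbreviation "RX \<equiv> polys S R"
abbreviation "QX \<equiv> polys S Q"
abbreviation "RC \<equiv> (\<lambda>c. mon c 0) ` R"

lemma QX_ideal: "ideal QX SX"
  by (rule PX.ideal_polys[OF is_ideal])

lemma QX_prime: "primeideal QX SX"
  by (rule PX.primeideal_polys[OF primeideal_axioms])

lemma zero_Q: "\<zero> \<in> Q"
  using additive_subgroup.zero_closed[OF additive_subgroup_axioms] .

lemma coeff_const_mult: "\<lbrakk>c \<in> carrier S; f \<in> carrier SX\<rbrakk> \<Longrightarrow> cf (mon c 0 \<otimes>\<^bsub>SX\<^esub> f) n = c \<otimes> cf f n"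
  using PX.coeff_monom_mult[of c f 0 n] by simp

lemma coeff_shift:
  "\<lbrakk>c \<in> carrier S; f \<in> carrier SX; k \<le> n\<rbrakk> \<Longrightarrow> cf (mon c k \<otimes>\<^bsub>SX\<^esub> f) n = c \<otimes> cf f (n - k)"
  using PX.coeff_monom_mult[of c f k "n - k"] by simp

lemma subring_constants: "subring RC SX"
proof (rule PX.P.subringI)
  show "RC \<subseteq> carrier SX" using R_carr by auto
  show "\<one>\<^bsub>SX\<^esub> \<in> RC" using R_closed(2) PX.monom_one by (metis image_eqI)
  show "\<ominus>\<^bsub>SX\<^esub> h \<in> RC" if "h \<in> RC" for h
  proof -
    obtain c where c: "c \<in> R" "h = mon c 0" using \<open>h \<in> RC\<close> by blast
    have "\<ominus>\<^bsub>SX\<^esub> h = mon (\<ominus> c) 0" using PX.monom_a_inv R_carr c by simp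
    then show ?thesis using R_closed(3)[OF c(1)] by blast
  qed
  show "h1 \<otimes>\<^bsub>SX\<^esub> h2 \<in> RC" if "h1 \<in> RC" "h2 \<in> RC" for h1 h2
  proof -
    obtain a b where ab: "a \<in> R" "h1 = mon a 0" "b \<in> R" "h2 = mon b 0" using \<open>h1 \<in> RC\<close> \<open>h2 \<in> RC\<close> by blast
    have "h1 \<otimes>\<^bsub>SX\<^esub> h2 = mon (a \<otimes> b) 0"
      using PX.monom_mult[of a b 0 0] R_carr ab by simp
    then show ?thesis using R_closed(4)[OF ab(1,3)] by blast
  qed
  show "h1 \<oplus>\<^bsub>SX\<^esub> h2 \<in> RC" if "h1 \<in> RC" "h2 \<in> RC" for h1 h2
  proof -
    obtain a b where ab: "a \<in> R" "h1 = mon a 0" "b \<in> R" "h2 = mon b 0" using \<open>h1 \<in> RC\<close> \<open>h2 \<in> RC\<close> by blast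
    have "h1 \<oplus>\<^bsub>SX\<^esub> h2 = mon (a \<oplus> b) 0" using PX.monom_add[of a b 0] R_carr ab by simp
    then show ?thesis using R_closed(5)[OF ab(1,3)] by blast
  qed
qed

text \<open>The scalars are the constants from \<open>R\<close>, so that polynomials of bounded
  degree can form a finitely generated module.\<close>

sublocale px: ideal_span QX SX RC
  by (rule ideal_span.intro[OF QX_ideal PX.P.is_cring ideal_span_axioms.intro[OF subring_constants]])

lemma monom_span:
  "\<lbrakk>set es \<subseteq> carrier S; s \<in> sp es\<rbrakk> \<Longrightarrow> mon s N \<in> px.sp (map (\<lambda>e. mon e N) es)"
proof (induction es arbitrary: s)
  case Nil
  then have "s \<in> Q" by simp
  then have "mon s N \<in> QX" using Icarr zero_Q by (intro PX.polysI) auto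
  then show ?case by simp
next
  case (Cons e es)
  obtain u v where w: "u \<in> R" "v \<in> sp es" "s = u \<otimes> e \<oplus> v" using Cons.prems(2) by (rule lspan_ConsE)
  have c: "u \<in> carrier S" "e \<in> carrier S" "v \<in> carrier S"
    using w R_carr sp.sp_carr[of es v] Cons.prems by auto
  have "mon s N \<in> px.sp (mon e N # map (\<lambda>e. mon e N) es)"
  proof (rule PX.P.lspan_ConsI)
    show "mon u 0 \<in> RC" using w(1) by blast
    show "mon v N \<in> px.sp (map (\<lambda>e. mon e N) es)" using Cons w by simp
    show "mon s N = mon u 0 \<otimes>\<^bsub>SX\<^esub> mon e N \<oplus>\<^bsub>SX\<^esub> mon v N"
      unfolding w(3) using PX.monom_mult[of u e 0 N] PX.monom_add[of "u \<otimes> e" v N] c by simp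
  qed
  then show ?case by simp
qed

text \<open>The generators are e X^i with e in \<open>es\<close> and i < N; raising N by one splits
  off one more coefficient. Degrees are again counted modulo \<open>Q\<close>.\<close>

lemma bounded_degree_span:
  assumes es: "set es \<subseteq> carrier S" "carrier S \<subseteq> sp es"
  shows "\<exists>zs. set zs \<subseteq> carrier SX \<and>
    (\<forall>h\<in>carrier SX. (\<forall>j\<ge>N. cf h j \<in> Q) \<longrightarrow> h \<in> px.sp zs)"
proof (induction N)
  case 0
  have "h \<in> px.sp []" if "h \<in> carrier SX" "\<forall>j\<ge>0. cf h j \<in> Q" for h
    using that by (auto intro: PX.polysI)
  then show ?case by (intro exI[of _ "[]"]) simp
next
  case (Suc N)
  then obtain zs where zs: "set zs \<subseteq> carrier SX"
    "\<And>h. \<lbrakk>h \<in> carrier SX; \<And>j. N \<le> j \<Longrightarrow> cf h j \<in> Q\<rbrakk> \<Longrightarrow> h \<in> px.sp zs" by blast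
  have zs': "set (map (\<lambda>e. mon e N) es) \<subseteq> carrier SX" using es(1) by auto
  have "h \<in> px.sp (map (\<lambda>e. mon e N) es @ zs)"
    if h: "h \<in> carrier SX" "\<forall>j\<ge>Suc N. cf h j \<in> Q" for h
  proof -
    let ?m = "mon (cf h N) N"
    have m: "?m \<in> carrier SX" using h by simp
    have "?m \<in> px.sp (map (\<lambda>e. mon e N) es)"
      by (rule monom_span[OF es(1)]) (use es(2) h in auto)
    moreover have "h \<ominus>\<^bsub>SX\<^esub> ?m \<in> px.sp zs"
    proof (rule zs(2))
      show "cf (h \<ominus>\<^bsub>SX\<^esub> ?m) j \<in> Q" if "N \<le> j" for j
        using h that zero_Q by (cases "j = N") (simp_all add: PX.coeff_minus minus_eq r_neg)
    qed (use h m in simp)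
    ultimately have "?m \<oplus>\<^bsub>SX\<^esub> (h \<ominus>\<^bsub>SX\<^esub> ?m) \<in> px.sp (map (\<lambda>e. mon e N) es @ zs)"
      by (rule px.sp_append[OF zs' zs(1)])
    moreover have "?m \<oplus>\<^bsub>SX\<^esub> (h \<ominus>\<^bsub>SX\<^esub> ?m) = h"
      using h(1) m by (simp add: PX.P.minus_eq PX.P.a_ac PX.P.r_neg)
    ultimately show ?thesis by simp
  qed
  then show ?case using zs(1) zs' by (intro exI[of _ "map (\<lambda>e. mon e N) es @ zs"]) auto
qed

text \<open>The polynomials of bounded degree over \<open>S/Q\<close> form a space of finite dimension over
  \<open>R/(R \<inter> Q)\<close>, so some nontrivial combination of the \<open>X\<^sup>n g\<close> lies in \<open>I\<close>.\<close>

lemma torsion: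
  assumes P: P_maximal
    and I: "I \<subseteq> carrier SX" "QX \<subseteq> I" "\<And>f h. \<lbrakk>f \<in> I; h \<in> I\<rbrakk> \<Longrightarrow> f \<oplus>\<^bsub>SX\<^esub> h \<in> I"
      "\<And>c f. \<lbrakk>c \<in> R; f \<in> I\<rbrakk> \<Longrightarrow> mon c 0 \<otimes>\<^bsub>SX\<^esub> f \<in> I"
    and g: "g \<in> carrier SX"
    and red: "\<And>n. \<exists>h\<in>carrier SX. (\<forall>j\<ge>N. cf h j \<in> Q) \<and> mon \<one> n \<otimes>\<^bsub>SX\<^esub> g \<ominus>\<^bsub>SX\<^esub> h \<in> I"
  shows "\<exists>p\<in>RX. p \<notin> QX \<and> p \<otimes>\<^bsub>SX\<^esub> g \<in> I"
proof -
  obtain es where "set es \<subseteq> carrier S" "carrier S \<subseteq> sp es"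
    using finitely_generated[OF P carrier_is_subring] R_carr Icarr by blast
  then obtain zs where zs: "set zs \<subseteq> carrier SX"
    "\<And>h. \<lbrakk>h \<in> carrier SX; \<forall>j\<ge>N. cf h j \<in> Q\<rbrakk> \<Longrightarrow> h \<in> px.sp zs"
    using bounded_degree_span[of es N] by blast
  \<comment> \<open>Here h is a remainder of p g modulo \<open>I\<close>, and n is the degree modulo
    \<open>Q\<close> of the multiplier p, not of h. The monomials X^n supply bounded remainders for
    every n; elimination leads to a remainder in Q[X], which \<open>I\<close> contains, while p
    keeps a coefficient outside \<open>Q\<close>.\<close>
  define \<Gamma> where "\<Gamma> h n \<longleftrightarrow> h \<in> carrier SX \<and> (\<exists>p\<in>RX. cf p n \<notin> Q \<and> (\<forall>j>n. cf p j \<in> Q) \<and>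
    p \<otimes>\<^bsub>SX\<^esub> g \<ominus>\<^bsub>SX\<^esub> h \<in> I)" for h n
  have "\<exists>m\<ge>0. \<exists>h\<in>QX. \<Gamma> h m"
  proof (rule px.dependency[OF _ zs(1)])
    fix n
    obtain h where h: "h \<in> carrier SX" "\<forall>j\<ge>N. cf h j \<in> Q" "mon \<one> n \<otimes>\<^bsub>SX\<^esub> g \<ominus>\<^bsub>SX\<^esub> h \<in> I"
      using red by blast
    have "mon \<one> n \<in> RX" by (rule PX.polysI) (auto simp: R_closed)
    moreover have "cf (mon \<one> n) n \<notin> Q" "\<forall>j>n. cf (mon \<one> n) j \<in> Q" using one_notin zero_Q by auto
    ultimately have "\<Gamma> h n" unfolding \<Gamma>_def using h by blast
    then show "\<exists>m\<ge>n. \<exists>h\<in>px.sp zs. \<Gamma> h m" using zs(2)[OF h(1,2)] by blast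
  next
    fix h1 h2 n1 n2 u1 u2
    assume 1: "\<Gamma> h1 n1" and 2: "\<Gamma> h2 n2" and n: "n1 < n2"
      and u: "u1 \<in> RC" "u1 \<notin> QX" "u2 \<in> RC"
    obtain c1 c2 where c: "c1 \<in> R" "u1 = mon c1 0" "c2 \<in> R" "u2 = mon c2 0" using u by blast
    note cc = R_carr[OF c(1)] R_carr[OF c(3)]
    have c1: "c1 \<notin> Q"
    proof
      assume "c1 \<in> Q"
      then have "u1 \<in> QX" unfolding c using Icarr zero_Q by (intro PX.polysI) auto
      then show False using u by simp
    qed
    obtain p1 where p1: "p1 \<in> RX" "cf p1 n1 \<notin> Q" "\<forall>j>n1. cf p1 j \<in> Q" "p1 \<otimes>\<^bsub>SX\<^esub> g \<ominus>\<^bsub>SX\<^esub> h1 \<in> I"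
      and h1: "h1 \<in> carrier SX" using 1 unfolding \<Gamma>_def by blast
    obtain p2 where p2: "p2 \<in> RX" "cf p2 n2 \<notin> Q" "\<forall>j>n2. cf p2 j \<in> Q" "p2 \<otimes>\<^bsub>SX\<^esub> g \<ominus>\<^bsub>SX\<^esub> h2 \<in> I"
      and h2: "h2 \<in> carrier SX" using 2 unfolding \<Gamma>_def by blast
    have pc: "p1 \<in> carrier SX" "p2 \<in> carrier SX" using p1 p2 PX.polysD by blast+
    have uc: "u1 \<in> carrier SX" "u2 \<in> carrier SX" using c cc by auto
    let ?p = "u1 \<otimes>\<^bsub>SX\<^esub> p2 \<ominus>\<^bsub>SX\<^esub> u2 \<otimes>\<^bsub>SX\<^esub> p1"
    let ?h = "u1 \<otimes>\<^bsub>SX\<^esub> h2 \<ominus>\<^bsub>SX\<^esub> u2 \<otimes>\<^bsub>SX\<^esub> h1"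
    have cp: "cf ?p j = c1 \<otimes> cf p2 j \<ominus> c2 \<otimes> cf p1 j" for j
      unfolding c using cc pc by (simp add: PX.coeff_minus coeff_const_mult del: PX.coeff_mult)
    have pR: "?p \<in> RX"
    proof (rule PX.polysI)
      show "cf ?p j \<in> R" for j
        unfolding cp minus_eq
        by (intro R_closed(3,4,5) c(1,3) PX.polysD(2)[OF p1(1)] PX.polysD(2)[OF p2(1)])
    qed (use uc pc in simp)
    have top: "cf ?p n2 \<notin> Q"
    proof
      assume a: "cf ?p n2 \<in> Q"
      have q: "c2 \<otimes> cf p1 n2 \<in> Q" using p1(3) n I_l_closed cc by blast
      have "cf ?p n2 \<oplus> c2 \<otimes> cf p1 n2 = c1 \<otimes> cf p2 n2"
        unfolding cp using cc pc by (simp add: minus_eq a_assoc l_neg)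
      then have "c1 \<otimes> cf p2 n2 \<in> Q" using a_closed[OF a q] by simp
      then show False using Q_prime[OF cc(1) _ c1 p2(2)] pc by simp
    qed
    have tail: "\<forall>j>n2. cf ?p j \<in> Q"
    proof (intro allI impI)
      fix j assume j: "n2 < j"
      have "c1 \<otimes> cf p2 j \<in> Q" "c2 \<otimes> cf p1 j \<in> Q" using p1(3) p2(3) n j I_l_closed cc by auto
      then show "cf ?p j \<in> Q" unfolding cp minus_eq
        by (intro additive_subgroup.a_closed[OF additive_subgroup_axioms] a_inv_closed)
    qed
    \<comment> \<open>The multipliers undergo the same elimination as the remainders. The second
      scalar is negated as a constant, to match the closure of \<open>I\<close> under constants from
      \<open>R\<close>.\<close>
    have "?p \<otimes>\<^bsub>SX\<^esub> g \<ominus>\<^bsub>SX\<^esub> ?h = u1 \<otimes>\<^bsub>SX\<^esub> (p2 \<otimes>\<^bsub>SX\<^esub> g \<ominus>\<^bsub>SX\<^esub> h2) \<oplus>\<^bsub>SX\<^esub>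
        mon (\<ominus> c2) 0 \<otimes>\<^bsub>SX\<^esub> (p1 \<otimes>\<^bsub>SX\<^esub> g \<ominus>\<^bsub>SX\<^esub> h1)"
      using c cc pc uc g h1 h2
      by (simp add: PX.P.minus_eq PX.P.l_distr PX.P.r_distr PX.P.l_minus PX.P.r_minus PX.P.minus_add
          PX.P.m_assoc PX.P.a_ac)
    moreover have "\<dots> \<in> I" using I(3)[OF I(4)[OF c(1) p2(4)] I(4)[OF R_closed(3)[OF c(3)] p1(4)]] c by simp
    ultimately have "?p \<otimes>\<^bsub>SX\<^esub> g \<ominus>\<^bsub>SX\<^esub> ?h \<in> I" by simp
    moreover have "?h \<in> carrier SX" using uc h1 h2 by simp
    ultimately show "\<Gamma> ?h n2" unfolding \<Gamma>_def using pR top tail by blast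
  qed
  then obtain m h where "h \<in> QX" "\<Gamma> h m" by blast
  then obtain p where p: "p \<in> RX" "cf p m \<notin> Q" "p \<otimes>\<^bsub>SX\<^esub> g \<ominus>\<^bsub>SX\<^esub> h \<in> I" "h \<in> carrier SX" "h \<in> QX"
    unfolding \<Gamma>_def by blast
  have "(p \<otimes>\<^bsub>SX\<^esub> g \<ominus>\<^bsub>SX\<^esub> h) \<oplus>\<^bsub>SX\<^esub> h \<in> I" using I(3)[OF p(3)] I(2) p(5) by blast
  moreover have "(p \<otimes>\<^bsub>SX\<^esub> g \<ominus>\<^bsub>SX\<^esub> h) \<oplus>\<^bsub>SX\<^esub> h = p \<otimes>\<^bsub>SX\<^esub> g"
    using p(4) PX.polysD(1)[OF p(1)] g by (simp add: PX.P.minus_eq PX.P.a_assoc PX.P.l_neg)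
  moreover have "p \<notin> QX" using p(2) PX.polysD(2) by blast
  ultimately show ?thesis using p(1) by auto
qed

text \<open>Division with remainder by \<open>I\<close>: whenever leading terms of degree at least
  \<open>N\<close> can be matched from \<open>I\<close> modulo \<open>Q\<close>, the remainder has
  degree below \<open>N\<close> modulo \<open>Q\<close>. The set \<open>G\<close> keeps the matching
  confined to elements for which it is available; it is S[X] when dividing by one polynomial, and
  the larger ring when comparing two intermediate rings.\<close>

lemma division:
  assumes I: "I \<subseteq> carrier SX" "\<zero>\<^bsub>SX\<^esub> \<in> I" "\<And>f h. \<lbrakk>f \<in> I; h \<in> I\<rbrakk> \<Longrightarrow> f \<oplus>\<^bsub>SX\<^esub> h \<in> I"
    and G: "G \<subseteq> carrier SX" "\<And>f h. \<lbrakk>f \<in> G; h \<in> I\<rbrakk> \<Longrightarrow> f \<ominus>\<^bsub>SX\<^esub> h \<in> G"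
    and step: "\<And>f n. \<lbrakk>f \<in> G; N \<le> n; \<And>j. n < j \<Longrightarrow> cf f j \<in> Q\<rbrakk> \<Longrightarrow>
      \<exists>f'\<in>I. (\<forall>j>n. cf f' j \<in> Q) \<and> cf f n \<ominus> cf f' n \<in> Q"
    and f: "f \<in> G"
  shows "\<exists>h\<in>carrier SX. (\<forall>j\<ge>N. cf h j \<in> Q) \<and> f \<ominus>\<^bsub>SX\<^esub> h \<in> I"
proof -
  have "\<exists>h\<in>carrier SX. (\<forall>j\<ge>N. cf h j \<in> Q) \<and> f \<ominus>\<^bsub>SX\<^esub> h \<in> I"
    if "f \<in> G" "\<And>j. N + k \<le> j \<Longrightarrow> cf f j \<in> Q" for k f
    using that
  proof (induction k arbitrary: f)
    case 0
    have "f \<in> carrier SX" using 0(1) G(1) by blast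
    then have "f \<ominus>\<^bsub>SX\<^esub> f \<in> I" using I(2) by (simp add: PX.P.minus_eq PX.P.r_neg)
    then show ?case using 0 \<open>f \<in> carrier SX\<close> by (intro bexI[of _ f]) auto
  next
    case (Suc k)
    have fc: "f \<in> carrier SX" using Suc.prems(1) G(1) by blast
    obtain f' where f': "f' \<in> I" "\<forall>j>N + k. cf f' j \<in> Q" "cf f (N + k) \<ominus> cf f' (N + k) \<in> Q"
      using step[OF Suc.prems(1), of "N + k"] Suc.prems(2) by auto
    have f'c: "f' \<in> carrier SX" using f'(1) I(1) by blast
    have "\<exists>h\<in>carrier SX. (\<forall>j\<ge>N. cf h j \<in> Q) \<and> (f \<ominus>\<^bsub>SX\<^esub> f') \<ominus>\<^bsub>SX\<^esub> h \<in> I"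
    proof (rule Suc.IH)
      show "f \<ominus>\<^bsub>SX\<^esub> f' \<in> G" by (rule G(2)[OF Suc.prems(1) f'(1)])
      show "cf (f \<ominus>\<^bsub>SX\<^esub> f') j \<in> Q" if "N + k \<le> j" for j
      proof (cases "j = N + k")
        case True
        then show ?thesis using f'(3) fc f'c by (simp add: PX.coeff_minus)
      next
        case False
        then have "cf f j \<in> Q" "cf f' j \<in> Q" using that Suc.prems(2)[of j] f'(2) by auto
        then show ?thesis using fc f'c by (simp add: PX.coeff_minus minus_eq)
      qed
    qed
    then obtain h where h: "h \<in> carrier SX" "\<forall>j\<ge>N. cf h j \<in> Q" "(f \<ominus>\<^bsub>SX\<^esub> f') \<ominus>\<^bsub>SX\<^esub> h \<in> I" by blast
    have "((f \<ominus>\<^bsub>SX\<^esub> f') \<ominus>\<^bsub>SX\<^esub> h) \<oplus>\<^bsub>SX\<^esub> f' \<in> I" by (rule I(3)[OF h(3) f'(1)])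
    moreover have "((f \<ominus>\<^bsub>SX\<^esub> f') \<ominus>\<^bsub>SX\<^esub> h) \<oplus>\<^bsub>SX\<^esub> f' = (f \<ominus>\<^bsub>SX\<^esub> h) \<oplus>\<^bsub>SX\<^esub> (f' \<oplus>\<^bsub>SX\<^esub> \<ominus>\<^bsub>SX\<^esub> f')"
      using fc f'c h(1) unfolding PX.P.minus_eq by (simp only: PX.P.a_ac PX.P.a_closed PX.P.a_inv_closed)
    ultimately have "f \<ominus>\<^bsub>SX\<^esub> h \<in> I" using fc f'c h(1) by (simp add: PX.P.r_neg)
    then show ?case using h by blast
  qed
  moreover have "cf f j \<in> Q" if "N + Suc (deg S f) \<le> j" for j
    using PX.deg_aboveD[of f j] that f G(1) zero_Q by auto
  ultimately show ?thesis using f by blast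
qed

end

section \<open>Denominators and leading coefficients modulo Q\<close>

context fcp_prime
begin

lemma coeff_shift_tail:
  assumes a: "a \<in> carrier S" and f: "f \<in> carrier SX" "\<And>j. m < j \<Longrightarrow> cf f j \<in> Q" and j: "m + k < j"
  shows "cf (mon a k \<otimes>\<^bsub>SX\<^esub> f) j \<in> Q"
proof -
  have "cf (mon a k \<otimes>\<^bsub>SX\<^esub> f) j = a \<otimes> cf f (j - k)" using j by (intro coeff_shift a f(1)) simp
  also have "\<dots> \<in> Q" using j by (intro I_l_closed f(2) a) simp
  finally show ?thesis .
qed

text \<open>The analogue of \<open>fraction_inverse\<close> for R[X] in S[X], where FCP is not at
  hand. Division by f leaves remainders of bounded degree modulo I = f S[X] + Q[X], so
  \<open>torsion\<close> for g = 1 puts an element of R[X] outside Q[X] into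
  \<open>I\<close>.\<close>

lemma polynomial_fraction:
  assumes P: P_maximal and f: "f \<in> carrier SX" "f \<notin> QX"
  shows "\<exists>s\<in>carrier SX. \<exists>p\<in>RX. p \<notin> QX \<and> f \<otimes>\<^bsub>SX\<^esub> s \<ominus>\<^bsub>SX\<^esub> p \<in> QX"
proof -
  note QXa = additive_subgroup.a_closed[OF px.additive_subgroup_axioms]
  obtain l where l: "cf f l \<notin> Q" using PX.polysI f by blast
  obtain m where m: "cf f m \<notin> Q" "\<And>j. m < j \<Longrightarrow> cf f j \<in> Q"
    by (rule ex_last_not[of "\<lambda>j. cf f j \<in> Q" l "deg S f"]) (use l f zero_Q PX.deg_aboveD in auto)
  \<comment> \<open>The leading coefficient of f modulo \<open>Q\<close> is invertible there, which
    is what division by f requires.\<close>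
  obtain b where b: "b \<in> carrier S" "cf f m \<otimes> b \<ominus> \<one> \<in> Q"
    using Q_maximal[OF P _ m(1)] f by auto
  define I where "I = {f \<otimes>\<^bsub>SX\<^esub> s \<oplus>\<^bsub>SX\<^esub> q | s q. s \<in> carrier SX \<and> q \<in> QX}"
  have II: "f \<otimes>\<^bsub>SX\<^esub> s \<oplus>\<^bsub>SX\<^esub> q \<in> I" if "s \<in> carrier SX" "q \<in> QX" for s q
    unfolding I_def using that by blast
  have zQX: "\<zero>\<^bsub>SX\<^esub> \<in> QX" using additive_subgroup.zero_closed[OF px.additive_subgroup_axioms] .
  have If: "f \<otimes>\<^bsub>SX\<^esub> s \<in> I" if "s \<in> carrier SX" for s using II[OF that zQX] f that by simp
  have IE: "\<exists>s q. s \<in> carrier SX \<and> q \<in> QX \<and> x = f \<otimes>\<^bsub>SX\<^esub> s \<oplus>\<^bsub>SX\<^esub> q" if "x \<in> I" for x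
    using that unfolding I_def by blast
  have I1: "I \<subseteq> carrier SX" unfolding I_def using f px.Icarr by auto
  have I2: "QX \<subseteq> I"
  proof
    fix q assume q: "q \<in> QX"
    show "q \<in> I" using II[OF PX.P.zero_closed q] f px.Icarr[OF q] by simp
  qed
  have I3: "x \<oplus>\<^bsub>SX\<^esub> y \<in> I" if xy: "x \<in> I" "y \<in> I" for x y
  proof -
    obtain s q where x: "s \<in> carrier SX" "q \<in> QX" "x = f \<otimes>\<^bsub>SX\<^esub> s \<oplus>\<^bsub>SX\<^esub> q" using IE[OF xy(1)] by blast
    obtain t r where y: "t \<in> carrier SX" "r \<in> QX" "y = f \<otimes>\<^bsub>SX\<^esub> t \<oplus>\<^bsub>SX\<^esub> r" using IE[OF xy(2)] by blast
    have "x \<oplus>\<^bsub>SX\<^esub> y = f \<otimes>\<^bsub>SX\<^esub> (s \<oplus>\<^bsub>SX\<^esub> t) \<oplus>\<^bsub>SX\<^esub> (q \<oplus>\<^bsub>SX\<^esub> r)"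
      unfolding x y using f x y px.Icarr by (simp add: PX.P.r_distr PX.P.a_ac)
    then show ?thesis using II[OF _ QXa[OF x(2) y(2)], of "s \<oplus>\<^bsub>SX\<^esub> t"] x y by simp
  qed
  have I4: "c \<otimes>\<^bsub>SX\<^esub> x \<in> I" if cx: "c \<in> carrier SX" "x \<in> I" for c x
  proof -
    obtain s q where x: "s \<in> carrier SX" "q \<in> QX" "x = f \<otimes>\<^bsub>SX\<^esub> s \<oplus>\<^bsub>SX\<^esub> q" using IE[OF cx(2)] by blast
    have "c \<otimes>\<^bsub>SX\<^esub> x = f \<otimes>\<^bsub>SX\<^esub> (c \<otimes>\<^bsub>SX\<^esub> s) \<oplus>\<^bsub>SX\<^esub> c \<otimes>\<^bsub>SX\<^esub> q"
      unfolding x using f x cx px.Icarr by (simp add: PX.P.r_distr PX.P.m_ac)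
    then show ?thesis using II[of "c \<otimes>\<^bsub>SX\<^esub> s" "c \<otimes>\<^bsub>SX\<^esub> q"] x cx px.I_l_closed by simp
  qed
  have "\<exists>p\<in>RX. p \<notin> QX \<and> p \<otimes>\<^bsub>SX\<^esub> \<one>\<^bsub>SX\<^esub> \<in> I"
  proof (rule torsion[OF P I1 I2 I3, where N = m])
    show "mon c 0 \<otimes>\<^bsub>SX\<^esub> x \<in> I" if "c \<in> R" "x \<in> I" for c x
      using I4[OF _ that(2)] R_carr[OF that(1)] by simp
    show "\<exists>h\<in>carrier SX. (\<forall>j\<ge>m. cf h j \<in> Q) \<and> mon \<one> n \<otimes>\<^bsub>SX\<^esub> \<one>\<^bsub>SX\<^esub> \<ominus>\<^bsub>SX\<^esub> h \<in> I" for n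
    proof (rule division[OF I1 _ I3, where G = "carrier SX"])
      show "\<zero>\<^bsub>SX\<^esub> \<in> I" using I2 zQX by blast
      fix h n assume h: "h \<in> carrier SX" "m \<le> n" "\<And>j. n < j \<Longrightarrow> cf h j \<in> Q"
      let ?f = "mon (b \<otimes> cf h n) (n - m) \<otimes>\<^bsub>SX\<^esub> f"
      have c: "b \<otimes> cf h n \<in> carrier S" using b h by simp
      have "?f \<in> I" using If[of "mon (b \<otimes> cf h n) (n - m)"] c f by (simp add: PX.P.m_comm)
      moreover have "\<forall>j>n. cf ?f j \<in> Q"
      proof (intro allI impI)
        fix j assume "n < j"
        then have "m + (n - m) < j" using h(2) by simp
        then show "cf ?f j \<in> Q" using coeff_shift_tail[OF c f(1) m(2)] by blast
      qed
      moreover have "cf h n \<ominus> cf ?f n \<in> Q"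
      proof -
        have "cf ?f n = b \<otimes> cf h n \<otimes> cf f m"
          using coeff_shift[OF c f(1), of "n - m" n] h(2) by simp
        moreover have "cf h n \<ominus> b \<otimes> cf h n \<otimes> cf f m = \<ominus> (cf f m \<otimes> b \<ominus> \<one>) \<otimes> cf h n"
        proof -
          have "\<ominus> (x \<otimes> b \<ominus> \<one>) \<otimes> y = \<ominus> (x \<otimes> b \<otimes> y) \<oplus> y" if "x \<in> carrier S" "y \<in> carrier S" for x y
            using that b(1) by (simp add: minus_eq minus_add l_distr l_minus)
          from this[of "cf f m" "cf h n"]
          have 1: "\<ominus> (cf f m \<otimes> b \<ominus> \<one>) \<otimes> cf h n = \<ominus> (cf f m \<otimes> b \<otimes> cf h n) \<oplus> cf h n"
            using h(1) f(1) by simp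
          have 2: "b \<otimes> cf h n \<otimes> cf f m = cf f m \<otimes> b \<otimes> cf h n"
            using b(1) h(1) f(1) by (simp add: m_ac)
          show ?thesis unfolding 1 2 using b(1) h(1) f(1) by (simp add: minus_eq a_comm)
        qed
        ultimately show ?thesis using I_r_closed[OF a_inv_closed[OF b(2)]] h(1) by simp
      qed
      ultimately show "\<exists>f'\<in>I. (\<forall>j>n. cf f' j \<in> Q) \<and> cf h n \<ominus> cf f' n \<in> Q" by blast
    qed (use I1 in auto)
  qed simp_all
  then obtain p where p: "p \<in> RX" "p \<notin> QX" "p \<otimes>\<^bsub>SX\<^esub> \<one>\<^bsub>SX\<^esub> \<in> I" by blast
  have pc: "p \<in> carrier SX" using PX.polysD(1)[OF p(1)] .
  obtain s q where x: "s \<in> carrier SX" "q \<in> QX" "p = f \<otimes>\<^bsub>SX\<^esub> s \<oplus>\<^bsub>SX\<^esub> q"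
    using IE[OF p(3)] pc by auto
  have "f \<otimes>\<^bsub>SX\<^esub> s \<ominus>\<^bsub>SX\<^esub> p = \<ominus>\<^bsub>SX\<^esub> q"
    unfolding x using f x px.Icarr by (simp add: PX.P.minus_eq PX.P.minus_add PX.P.r_neg2)
  then have "f \<otimes>\<^bsub>SX\<^esub> s \<ominus>\<^bsub>SX\<^esub> p \<in> QX" using px.a_inv_closed[OF x(2)] by simp
  then show ?thesis using p x(1) by blast
qed

text \<open>Coefficients in \<open>Q\<close> are ignored: these are the leading coefficients modulo \<open>Q\<close>.\<close>

definition lead :: "(nat \<Rightarrow> 'a) set \<Rightarrow> 'a set" where
  "lead V = {cf f n | f n. f \<in> V \<and> (\<forall>j>n. cf f j \<in> Q)}"

lemma leadE:
  assumes "s \<in> lead V"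
  obtains f n where "f \<in> V" "\<And>j. n < j \<Longrightarrow> cf f j \<in> Q" "s = cf f n"
  using assms unfolding lead_def by blast

lemma leadI: "\<lbrakk>f \<in> V; \<And>j. n < j \<Longrightarrow> cf f j \<in> Q; s = cf f n\<rbrakk> \<Longrightarrow> s \<in> lead V"
  unfolding lead_def by blast

text \<open>Elements of \<open>R - Q\<close> are invertible modulo \<open>Q\<close> with inverses
  from \<open>R\<close>, so dividing by them stays in \<open>U\<close>.\<close>

lemma saturated_if_P_maximal:
  assumes P_maximal "subring U S" "R \<subseteq> U" "Q \<subseteq> U"
  shows "U \<in> saturated_subrings S R Q"
proof (rule saturated_subringsI[OF assms(2-4)])
  fix b s assume b: "b \<in> carrier S" "s \<in> R" "s \<notin> Q" "s \<otimes> b \<in> U"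
  obtain s' where s': "s' \<in> R" "s \<otimes> s' \<ominus> \<one> \<in> Q" using assms(1) b unfolding P_maximal_def by blast
  note c = b(1) R_carr[OF b(2)] R_carr[OF s'(1)]
  have "s' \<otimes> (s \<otimes> b) \<in> U" using subringE(6)[OF assms(2) _ b(4)] s'(1) assms(3) by blast
  moreover have "(s \<otimes> s' \<ominus> \<one>) \<otimes> b \<in> U" using I_r_closed[OF s'(2) b(1)] assms(4) by blast
  ultimately have "s' \<otimes> (s \<otimes> b) \<oplus> \<ominus> ((s \<otimes> s' \<ominus> \<one>) \<otimes> b) \<in> U"
    using subringE(5,7)[OF assms(2)] by blast
  moreover have "(s \<otimes> s' \<ominus> \<one>) \<otimes> b = s' \<otimes> (s \<otimes> b) \<ominus> b"
  proof -
    have "(s \<otimes> s' \<ominus> \<one>) \<otimes> b = s \<otimes> s' \<otimes> b \<ominus> b" using c by (simp add: minus_eq l_distr l_minus)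
    then show ?thesis using c by (simp add: m_ac)
  qed
  moreover have "x \<oplus> \<ominus> (x \<ominus> b) = b" if "x \<in> carrier S" for x
    using that b(1) by (simp add: minus_eq minus_add r_neg2)
  ultimately show "b \<in> U" using c by simp
qed

lemma RX_mem: "c \<in> R \<Longrightarrow> mon c k \<in> RX"
  using R_carr R_closed(1) by (intro PX.polysI) auto

lemma QX_mem: "q \<in> Q \<Longrightarrow> mon q k \<in> QX"
  using Icarr zero_Q by (intro PX.polysI) auto

lemma lead_saturated:
  assumes P: P_maximal and V: "subring V SX" "RX \<subseteq> V" "QX \<subseteq> V"
  shows "lead V \<in> saturated_subrings S R Q"
proof (rule saturated_if_P_maximal[OF P])
  note cl = subringE[OF V(1)]
  have Vc: "f \<in> carrier SX" if "f \<in> V" for f using cl(1) that by blast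
  show RL: "R \<subseteq> lead V"
  proof
    fix r assume r: "r \<in> R"
    show "r \<in> lead V"
      by (rule leadI[of "mon r 0" _ 0]) (use r RX_mem V(2) R_carr zero_Q in auto)
  qed
  show "Q \<subseteq> lead V"
  proof
    fix r assume r: "r \<in> Q"
    show "r \<in> lead V"
      by (rule leadI[of "mon r 0" _ 0]) (use r QX_mem V(3) Icarr zero_Q in auto)
  qed
  show "subring (lead V) S"
  proof (rule subringI)
    show "lead V \<subseteq> carrier S" using Vc by (auto elim!: leadE)
    show "\<one> \<in> lead V" using RL R_closed(2) by blast
    show "\<ominus> h \<in> lead V" if h: "h \<in> lead V" for h
    proof -
      obtain f n where f: "f \<in> V" "\<And>j. n < j \<Longrightarrow> cf f j \<in> Q" "h = cf f n" using h by (rule leadE) blast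
      show ?thesis by (rule leadI[of "\<ominus>\<^bsub>SX\<^esub> f" _ n]) (use f Vc cl(5) in auto)
    qed
  next
    fix h1 h2 assume h: "h1 \<in> lead V" "h2 \<in> lead V"
    obtain f n where f: "f \<in> V" "\<And>j. n < j \<Longrightarrow> cf f j \<in> Q" "h1 = cf f n" using h(1) by (rule leadE) blast
    obtain g m where g: "g \<in> V" "\<And>j. m < j \<Longrightarrow> cf g j \<in> Q" "h2 = cf g m" using h(2) by (rule leadE) blast
    note fg = Vc[OF f(1)] Vc[OF g(1)]
    have XV: "mon \<one> k \<in> V" for k using RX_mem R_closed(2) V(2) by blast
    show "h1 \<oplus> h2 \<in> lead V"
    \<comment> \<open>Powers of X belong to \<open>V\<close> and bring both polynomials to degree n
      + m. Cancellation is harmless, since \<open>lead\<close> allows the coefficient at the chosen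
      place to vanish.\<close>
    proof (rule leadI[of "mon \<one> m \<otimes>\<^bsub>SX\<^esub> f \<oplus>\<^bsub>SX\<^esub> mon \<one> n \<otimes>\<^bsub>SX\<^esub> g" _ "n + m"])
      show "mon \<one> m \<otimes>\<^bsub>SX\<^esub> f \<oplus>\<^bsub>SX\<^esub> mon \<one> n \<otimes>\<^bsub>SX\<^esub> g \<in> V"
        using cl(7)[OF cl(6)[OF XV f(1)] cl(6)[OF XV g(1)]] .
      show "cf (mon \<one> m \<otimes>\<^bsub>SX\<^esub> f \<oplus>\<^bsub>SX\<^esub> mon \<one> n \<otimes>\<^bsub>SX\<^esub> g) j \<in> Q" if "n + m < j" for j
      proof -
        have "cf (mon \<one> m \<otimes>\<^bsub>SX\<^esub> f) j \<in> Q" "cf (mon \<one> n \<otimes>\<^bsub>SX\<^esub> g) j \<in> Q"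
          using coeff_shift_tail[OF one_closed fg(1) f(2)] coeff_shift_tail[OF one_closed fg(2) g(2)] that
          by (simp_all add: add.commute del: PX.coeff_mult)
        then show ?thesis using fg by (simp del: PX.coeff_mult)
      qed
      show "h1 \<oplus> h2 = cf (mon \<one> m \<otimes>\<^bsub>SX\<^esub> f \<oplus>\<^bsub>SX\<^esub> mon \<one> n \<otimes>\<^bsub>SX\<^esub> g) (n + m)"
        using fg f g by (simp add: coeff_shift del: PX.coeff_mult)
    qed
    note t = PX.top_coeff_mult[OF is_ideal fg(1) f(2) fg(2) g(2)]
    \<comment> \<open>The top coefficient of the product is the desired one up to q in
      \<open>Q\<close>; subtracting q X^(n+m), an element of Q[X] and so of \<open>V\<close>, makes
      it exact.\<close>
    define q where "q = cf (f \<otimes>\<^bsub>SX\<^esub> g) (n + m) \<ominus> cf f n \<otimes> cf g m"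
    have q: "q \<in> Q" using t(1) by (simp add: q_def)
    let ?F = "f \<otimes>\<^bsub>SX\<^esub> g \<ominus>\<^bsub>SX\<^esub> mon q (n + m)"
    show "h1 \<otimes> h2 \<in> lead V"
    proof (rule leadI[of ?F _ "n + m"])
      have "mon q (n + m) \<in> V" using QX_mem[OF q] V(3) by blast
      then show "?F \<in> V" unfolding PX.P.minus_eq using cl(7)[OF cl(6)[OF f(1) g(1)] cl(5)] by blast
      show "cf ?F j \<in> Q" if "n + m < j" for j
      proof -
        have "cf (f \<otimes>\<^bsub>SX\<^esub> g) j \<in> Q" using t(2) that by simp
        then show ?thesis using that fg Icarr[OF q] by (simp add: PX.coeff_minus minus_eq del: PX.coeff_mult)
      qed
      show "h1 \<otimes> h2 = cf ?F (n + m)"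
        using fg Icarr[OF q] unfolding f(3) g(3)
        by (simp add: q_def PX.coeff_minus minus_eq minus_add r_neg2 del: PX.coeff_mult PX.monom_mult)
    qed
  qed
qed

lemma lead_mono: "V \<subseteq> W \<Longrightarrow> lead V \<subseteq> lead W"
  unfolding lead_def by blast

text \<open>Each of the finitely many generators is a leading coefficient in some degree m, and
  multiplication by powers of X reaches every degree from m on; \<open>N\<close> is the maximum of
  these degrees. From then on every element of the span occurs in every degree.\<close>

lemma lead_representatives:
  assumes V: "subring V SX" "RX \<subseteq> V" "QX \<subseteq> V"
  shows "set es \<subseteq> lead V \<Longrightarrow>
    \<exists>N. \<forall>t\<in>sp es. \<forall>n\<ge>N. \<exists>f\<in>V. cf f n = t \<and> (\<forall>j>n. cf f j \<in> Q)"
proof (induction es)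
  case Nil
  have "\<exists>f\<in>V. cf f n = t \<and> (\<forall>j>n. cf f j \<in> Q)" if "t \<in> sp []" for t n
    by (rule bexI[of _ "mon t n"]) (use that QX_mem V(3) Icarr zero_Q in auto)
  then show ?case by blast
next
  case (Cons e es)
  note cl = subringE[OF V(1)]
  have Vc: "f \<in> carrier SX" if "f \<in> V" for f using cl(1) that by blast
  obtain N where N: "\<And>t n. \<lbrakk>t \<in> sp es; N \<le> n\<rbrakk> \<Longrightarrow> \<exists>f\<in>V. cf f n = t \<and> (\<forall>j>n. cf f j \<in> Q)"
    using Cons by auto
  have "e \<in> lead V" using Cons.prems by simp
  then obtain f m where f: "f \<in> V" "\<And>j. m < j \<Longrightarrow> cf f j \<in> Q" "e = cf f m" by (rule leadE) blast
  have "\<exists>g\<in>V. cf g n = t \<and> (\<forall>j>n. cf g j \<in> Q)" if t: "t \<in> sp (e # es)" and n: "max N m \<le> n" for t n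
  proof -
    obtain u v where w: "u \<in> R" "v \<in> sp es" "t = u \<otimes> e \<oplus> v" using t by (rule lspan_ConsE)
    obtain h where h: "h \<in> V" "cf h n = v" "\<forall>j>n. cf h j \<in> Q" using N[OF w(2), of n] n by auto
    note c = R_carr[OF w(1)] Vc[OF f(1)] Vc[OF h(1)]
    let ?g = "mon u (n - m) \<otimes>\<^bsub>SX\<^esub> f \<oplus>\<^bsub>SX\<^esub> h"
    have "mon u (n - m) \<in> V" using RX_mem[OF w(1)] V(2) by blast
    then have "?g \<in> V" using cl(7)[OF cl(6)[OF _ f(1)] h(1)] by blast
    moreover have "cf ?g n = t"
      using c n h(2) unfolding w(3) f(3) by (simp add: coeff_shift del: PX.coeff_mult)
    moreover have "\<forall>j>n. cf ?g j \<in> Q"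
    proof (intro allI impI)
      fix j assume j: "n < j"
      have "cf (mon u (n - m) \<otimes>\<^bsub>SX\<^esub> f) j \<in> Q"
        by (rule coeff_shift_tail[OF c(1,2) f(2)]) (use j n in auto)
      then show "cf ?g j \<in> Q" using c h(3) j by (simp del: PX.coeff_mult)
    qed
    ultimately show ?thesis by blast
  qed
  then show ?case by blast
qed

text \<open>Suppose \<open>V\<close> and \<open>W\<close> have the same leading coefficients. These
  are finitely generated, so from some degree on the leading term of any element of \<open>W\<close>
  is matched by an element of \<open>V\<close>, and \<open>W\<close> is \<open>V\<close> plus
  polynomials of bounded degree modulo \<open>Q\<close>. By \<open>torsion\<close>, any w in
  \<open>W\<close> has a multiple p w in \<open>V\<close> with p in R[X] outside Q[X], and
  saturation of \<open>V\<close> gives w in \<open>V\<close>.\<close>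

lemma lead_strict:
  assumes P: P_maximal
    and V: "V \<in> saturated_subrings SX RX QX" and W: "W \<in> saturated_subrings SX RX QX" and VW: "V \<subset> W"
  shows "lead V \<subset> lead W"
proof -
  note Vs = saturated_subringsD[OF V] and Ws = saturated_subringsD[OF W]
  note Vcl = subringE[OF Vs(1)] and Wcl = subringE[OF Ws(1)]
  have "lead V \<noteq> lead W"
  proof
    assume eq: "lead V = lead W"
    note L = saturated_subringsD[OF lead_saturated[OF P Vs(1-3)]]
    obtain es where es: "set es \<subseteq> lead V" "lead V \<subseteq> sp es"
      using finitely_generated[OF P L(1-3)] by blast
    obtain N where N: "\<And>t n. \<lbrakk>t \<in> sp es; N \<le> n\<rbrakk> \<Longrightarrow> \<exists>f\<in>V. cf f n = t \<and> (\<forall>j>n. cf f j \<in> Q)"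
      using lead_representatives[OF Vs(1-3) es(1)] by blast
    obtain w where w: "w \<in> W" "w \<notin> V" using VW by blast
    have wc: "w \<in> carrier SX" using w(1) Wcl(1) by blast
    have "\<exists>p\<in>RX. p \<notin> QX \<and> p \<otimes>\<^bsub>SX\<^esub> w \<in> V"
    proof (rule torsion[OF P Vcl(1) Vs(3) Vcl(7) _ wc, where N = N])
      show "mon c 0 \<otimes>\<^bsub>SX\<^esub> f \<in> V" if "c \<in> R" "f \<in> V" for c f
        using Vcl(6)[OF subsetD[OF Vs(2) RX_mem[OF that(1)]] that(2)] .
      fix n
      show "\<exists>h\<in>carrier SX. (\<forall>j\<ge>N. cf h j \<in> Q) \<and> mon \<one> n \<otimes>\<^bsub>SX\<^esub> w \<ominus>\<^bsub>SX\<^esub> h \<in> V"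
      proof (rule division[OF Vcl(1,2,7) Wcl(1)])
        show "mon \<one> n \<otimes>\<^bsub>SX\<^esub> w \<in> W"
          using Wcl(6)[OF subsetD[OF Ws(2) RX_mem[OF R_closed(2)]] w(1)] .
        show "f \<ominus>\<^bsub>SX\<^esub> h \<in> W" if "f \<in> W" "h \<in> V" for f h
          unfolding PX.P.minus_eq using Wcl(7)[OF that(1) Wcl(5)[OF psubsetD[OF VW that(2)]]] .
        fix f n assume f: "f \<in> W" "N \<le> n" "\<And>j. n < j \<Longrightarrow> cf f j \<in> Q"
        have fc: "f \<in> carrier SX" using f(1) Wcl(1) by blast
        have "cf f n \<in> lead W" by (rule leadI[OF f(1,3) refl])
        then have "cf f n \<in> sp es" using es(2) eq by blast
        then obtain f' where f': "f' \<in> V" "cf f' n = cf f n" "\<forall>j>n. cf f' j \<in> Q"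
          using N f(2) by blast
        have "cf f n \<ominus> cf f' n \<in> Q" unfolding f'(2) minus_eq using fc zero_Q by (simp add: r_neg)
        then show "\<exists>f'\<in>V. (\<forall>j>n. cf f' j \<in> Q) \<and> cf f n \<ominus> cf f' n \<in> Q" using f' by blast
      qed
    qed
    then obtain p where "p \<in> RX" "p \<notin> QX" "p \<otimes>\<^bsub>SX\<^esub> w \<in> V" by blast
    then have "w \<in> V" using Vs(4)[OF wc] by blast
    then show False using w(2) by simp
  qed
  then show ?thesis using lead_mono[of V W] VW by blast
qed

lemma family_length_polynomial_le:
  assumes P_maximal
  shows "family_length (saturated_subrings SX RX QX) \<le> family_length (saturated_subrings S R Q)"
  by (rule family_length_le[where g = lead])
    (use lead_saturated[OF assms saturated_subringsD(1-3)] lead_strict[OF assms] in blast)+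

lemma family_length_le_polynomial:
  "family_length (saturated_subrings S R Q) \<le> family_length (saturated_subrings SX RX QX)"
proof (rule family_length_le[where g = "polys S"])
  fix U assume U: "U \<in> saturated_subrings S R Q"
  note Us = saturated_subringsD[OF U]
  note cl = subringE[OF Us(1)]
  show "polys S U \<in> saturated_subrings SX RX QX"
  proof (rule saturated_subringsI)
    show "subring (polys S U) SX" by (rule PX.subring_polys[OF Us(1)])
    show "RX \<subseteq> polys S U" "QX \<subseteq> polys S U" using Us(2,3) unfolding polys_def by blast+
    fix f g assume f: "f \<in> carrier SX" and g: "g \<in> RX" "g \<notin> QX" "g \<otimes>\<^bsub>SX\<^esub> f \<in> polys S U"
    show "f \<in> polys S U"
    proof (rule PX.polys_saturated[OF g(1,2) f g(3) cl(1,2,7,5)])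
      show "s \<otimes> v \<in> U" if "s \<in> R" "v \<in> U" for s v using cl(6)[OF _ that(2)] that(1) Us(2) by blast
      show "q \<otimes> b \<in> U" if "q \<in> Q" "b \<in> carrier S" for q b using I_r_closed[OF that] Us(3) by blast
      show "\<zero> \<in> Q" by (rule zero_Q)
      show "b \<in> U" if "s \<in> R" "s \<notin> Q" "b \<in> carrier S" "s \<otimes> b \<in> U" for s b
        using Us(4)[OF that(3,1,2,4)] .
    qed
  qed
next
  fix U V assume UV: "U \<in> saturated_subrings S R Q" "V \<in> saturated_subrings S R Q" "U \<subset> V"
  note Us = saturated_subringsD[OF UV(1)] and Vs = saturated_subringsD[OF UV(2)]
  obtain v where v: "v \<in> V" "v \<notin> U" using UV(3) by blast
  have vc: "v \<in> carrier S" using v(1) subringE(1)[OF Vs(1)] by blast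
  have "mon v 0 \<in> polys S V" using vc v(1) subringE(2)[OF Vs(1)] by (intro PX.polysI) auto
  moreover have "mon v 0 \<notin> polys S U" using PX.polysD(2)[of "mon v 0" U 0] vc v(2) by auto
  moreover have "polys S U \<subseteq> polys S V" using UV(3) unfolding polys_def by blast
  ultimately show "polys S U \<subset> polys S V" by (intro psubset_witnessI)
qed

end

section \<open>The Nagata extension\<close>

context field_valued_hom
begin

lemma fractions_add:
  assumes e: "e \<in> fractions E \<psi> D" and f: "f \<in> fractions E \<psi> D"
  shows "e \<oplus>\<^bsub>E\<^esub> f \<in> fractions E \<psi> D"
proof -
  obtain a b where ab: "e \<in> carrier E" "a \<in> D" "b \<in> D" "\<psi> b \<noteq> \<zero>\<^bsub>E\<^esub>" "e \<otimes>\<^bsub>E\<^esub> \<psi> b = \<psi> a"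
    using e unfolding fractions_def by blast
  obtain c d where cd: "f \<in> carrier E" "c \<in> D" "d \<in> D" "\<psi> d \<noteq> \<zero>\<^bsub>E\<^esub>" "f \<otimes>\<^bsub>E\<^esub> \<psi> d = \<psi> c"
    using f unfolding fractions_def by blast
  have "(e \<oplus>\<^bsub>E\<^esub> f) \<otimes>\<^bsub>E\<^esub> (\<psi> b \<otimes>\<^bsub>E\<^esub> \<psi> d) = (e \<otimes>\<^bsub>E\<^esub> \<psi> b) \<otimes>\<^bsub>E\<^esub> \<psi> d \<oplus>\<^bsub>E\<^esub> (f \<otimes>\<^bsub>E\<^esub> \<psi> d) \<otimes>\<^bsub>E\<^esub> \<psi> b"
    using ab(1,3) cd(1,3) by (simp add: E.m_ac E.l_distr E.r_distr)
  then have "(e \<oplus>\<^bsub>E\<^esub> f) \<otimes>\<^bsub>E\<^esub> \<psi> (b \<otimes>\<^bsub>B\<^esub> d) = \<psi> (a \<otimes>\<^bsub>B\<^esub> d \<oplus>\<^bsub>B\<^esub> c \<otimes>\<^bsub>B\<^esub> b)"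
    unfolding ab(5) cd(5) using ab cd by simp
  moreover have "\<psi> (b \<otimes>\<^bsub>B\<^esub> d) \<noteq> \<zero>\<^bsub>E\<^esub>" using ab cd by (simp add: E.integral_iff)
  moreover have "b \<otimes>\<^bsub>B\<^esub> d \<in> D" "a \<otimes>\<^bsub>B\<^esub> d \<oplus>\<^bsub>B\<^esub> c \<otimes>\<^bsub>B\<^esub> b \<in> D" using ab cd D_closed by simp_all
  ultimately show ?thesis unfolding fractions_def using E.a_closed[OF ab(1) cd(1)] by blast
qed

lemma fractions_divide:
  assumes x: "x \<in> carrier E" and y: "y \<in> fractions E \<psi> D" "y \<noteq> \<zero>\<^bsub>E\<^esub>"
    and xy: "x \<otimes>\<^bsub>E\<^esub> y \<in> fractions E \<psi> D"
  shows "x \<in> fractions E \<psi> D"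
proof -
  obtain a b where ab: "y \<in> carrier E" "a \<in> D" "b \<in> D" "\<psi> b \<noteq> \<zero>\<^bsub>E\<^esub>" "y \<otimes>\<^bsub>E\<^esub> \<psi> b = \<psi> a"
    using y(1) unfolding fractions_def by blast
  obtain c d where cd: "c \<in> D" "d \<in> D" "\<psi> d \<noteq> \<zero>\<^bsub>E\<^esub>" "x \<otimes>\<^bsub>E\<^esub> y \<otimes>\<^bsub>E\<^esub> \<psi> d = \<psi> c"
    using xy unfolding fractions_def by blast
  have "x \<otimes>\<^bsub>E\<^esub> (\<psi> a \<otimes>\<^bsub>E\<^esub> \<psi> d) = (x \<otimes>\<^bsub>E\<^esub> y \<otimes>\<^bsub>E\<^esub> \<psi> d) \<otimes>\<^bsub>E\<^esub> \<psi> b"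
    unfolding ab(5)[symmetric] using x ab(1,3) cd(2) by (simp add: E.m_ac)
  then have "x \<otimes>\<^bsub>E\<^esub> \<psi> (a \<otimes>\<^bsub>B\<^esub> d) = \<psi> (c \<otimes>\<^bsub>B\<^esub> b)"
    unfolding cd(4) using ab(2,3) cd(1,2) by simp
  moreover have "y \<otimes>\<^bsub>E\<^esub> \<psi> b \<noteq> \<zero>\<^bsub>E\<^esub>"
    using E.integral_iff[OF ab(1), of "\<psi> b"] ab(3,4) y(2) by simp
  then have "\<psi> (a \<otimes>\<^bsub>B\<^esub> d) \<noteq> \<zero>\<^bsub>E\<^esub>" unfolding ab(5) using ab(2) cd by (simp add: E.integral_iff)
  moreover have "a \<otimes>\<^bsub>B\<^esub> d \<in> D" "c \<otimes>\<^bsub>B\<^esub> b \<in> D" using ab cd D_closed by simp_all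
  ultimately show ?thesis unfolding fractions_def using x by blast
qed

end

lemma (in UP_cring) carrier_subset_if_monoms:
  assumes V: "\<zero>\<^bsub>P\<^esub> \<in> V" "\<And>f g. \<lbrakk>f \<in> V; g \<in> V\<rbrakk> \<Longrightarrow> f \<oplus>\<^bsub>P\<^esub> g \<in> V"
    and f: "f \<in> carrier P" and mon: "\<And>n. up_ring.monom P (up_ring.coeff P f n) n \<in> V"
  shows "f \<in> V"
proof -
  let ?V = "V \<inter> carrier P"
  have "finsum P (\<lambda>i. up_ring.monom P (up_ring.coeff P f i) i) {..deg R f} \<in> ?V"
    by (rule P.finsum_mem) (use V f mon in auto)
  then show ?thesis using up_repr[OF f] by simp
qed

context fcp_prime
begin

lemma residue_field_valued: "field_valued_hom S (residue_field S Q) (residue_class S Q) R"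
proof -
  interpret Q: prime_localization Q S unfolding prime_localization_def by (rule primeideal_axioms)
  show ?thesis
    by (intro field_valued_hom.intro field_valued_hom_axioms.intro Q.field_residue_field
      Q.residue_class_hom R is_cring)
qed

text \<open>Applies the two comparisons for a homomorphism to a field. Their condition on
  denominators holds since a denominator outside \<open>Q\<close> can be replaced by one from
  \<open>R\<close>.\<close>

lemma residual_length:
  "family_length (subrings_above (residue_field S Q) (fractions (residue_field S Q) (residue_class S Q) R))
    = family_length (saturated_subrings S R Q)"
proof -
  interpret Q: prime_localization Q S unfolding prime_localization_def by (rule primeideal_axioms)
  interpret h: field_valued_hom S "residue_field S Q" "residue_class S Q" R by (rule residue_field_valued)
  have ker: "h.ker = Q"
    unfolding h.ker_def using Q.residue_class_eq_zero_iff Icarr by blast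
  show ?thesis
  proof (rule antisym)
    show "family_length (saturated_subrings S R Q) \<le>
      family_length (subrings_above (residue_field S Q) (fractions (residue_field S Q) (residue_class S Q) R))"
      using h.family_length_saturated_le unfolding ker .
    show "family_length (subrings_above (residue_field S Q) (fractions (residue_field S Q) (residue_class S Q) R))
      \<le> family_length (saturated_subrings S R Q)"
    proof (rule h.family_length_le_saturated[unfolded ker])
      fix e assume e: "e \<in> carrier (residue_field S Q)"
      obtain a s where a: "a \<in> carrier S" "s \<in> carrier S - Q"
        "e \<otimes>\<^bsub>residue_field S Q\<^esub> residue_class S Q s = residue_class S Q a"
        using Q.residue_field_quotients[OF e] .
      \<comment> \<open>Extending the fraction a/s by s' gives the denominator r from
        \<open>R\<close>.\<close>
      obtain s' r where s': "s' \<in> carrier S" "r \<in> R" "r \<notin> Q" "s \<otimes> s' \<ominus> r \<in> Q"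
        using fraction_inverse[of s] a(2) by blast
      have c: "s \<in> carrier S" "r \<in> carrier S" using a s' R_carr by auto
      have "residue_class S Q (s \<otimes> s' \<ominus> r) = \<zero>\<^bsub>residue_field S Q\<^esub>"
        using s'(4) Q.residue_class_eq_zero_iff[of "s \<otimes> s' \<ominus> r"] c s' by simp
      then have "residue_class S Q (s \<otimes> s') = residue_class S Q r"
        using c s'(1) by (simp add: minus_eq h.E.minus_eq[symmetric])
      then have "e \<otimes>\<^bsub>residue_field S Q\<^esub> residue_class S Q r = residue_class S Q (a \<otimes> s')"
        using a e c s'(1) h.E.m_assoc[of e "residue_class S Q s" "residue_class S Q s'"] by simp
      moreover have "residue_class S Q r \<noteq> \<zero>\<^bsub>residue_field S Q\<^esub>"
        using s'(3) c Q.residue_class_eq_zero_iff by simp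
      moreover have "a \<otimes> s' \<in> carrier S" using a s' by simp
      ultimately show "\<exists>b\<in>carrier S. \<exists>s\<in>R. residue_class S Q s \<noteq> \<zero>\<^bsub>residue_field S Q\<^esub> \<and>
          e \<otimes>\<^bsub>residue_field S Q\<^esub> residue_class S Q s = residue_class S Q b"
        using s'(2) by blast
    qed
  qed
qed

end

section \<open>Residue fields of the Nagata ring\<close>

locale nagata_prime = fcp_extension S R for S (structure) and R +
  fixes Q'
  assumes prime: "primeideal Q' (localization (UP S) (unit_content S))"

sublocale nagata_prime \<subseteq> PX: UP_cring S "UP S"
  by unfold_locales

sublocale nagata_prime \<subseteq> N: mult_closed "UP S" "unit_content S"
  by (rule PX.mult_closed_unit_content)

sublocale nagata_prime \<subseteq> Q': prime_localization Q' "localization (UP S) (unit_content S)"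
  unfolding prime_localization_def by (rule prime)

context nagata_prime
begin

abbreviation "\<kappa> \<equiv> residue_field (localization (UP S) (unit_content S)) Q'"
abbreviation "\<rho> \<equiv> residue_class (localization (UP S) (unit_content S)) Q'"
text \<open>The composite S[X] -> S(X) -> kappa(Q'). It presents kappa(Q') as a field of quotients
  of polynomials, with the contraction of \<open>Q'\<close> to S[X] as kernel.\<close>

definition \<psi> where "\<psi> f = \<rho> (N.frac f \<one>\<^bsub>UP S\<^esub>)"
abbreviation "RX \<equiv> polys S R"

lemma psi_hom: "\<psi> \<in> ring_hom (UP S) \<kappa>"
  using ring_hom_trans[OF N.of_ring_hom Q'.residue_class_hom] unfolding \<psi>_def comp_def .

lemma field_valued: "field_valued_hom (UP S) \<kappa> \<psi> D" if "subring D (UP S)"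
  by (intro field_valued_hom.intro field_valued_hom_axioms.intro Q'.field_residue_field
      psi_hom that PX.P.is_cring)

sublocale K: field_valued_hom "UP S" \<kappa> \<psi> RX
  by (rule field_valued[OF PX.subring_polys[OF R]])

lemma mem_ker_iff: "f \<in> K.ker \<longleftrightarrow> f \<in> carrier (UP S) \<and> N.frac f \<one>\<^bsub>UP S\<^esub> \<in> Q'"
  unfolding K.ker_def \<psi>_def using Q'.residue_class_eq_zero_iff[OF N.frac_closed] N.M_one by blast

text \<open>Such polynomials become units in S(X), and a proper ideal contains no unit.\<close>

lemma unit_content_notin_ker: "s \<in> unit_content S \<Longrightarrow> \<psi> s \<noteq> \<zero>\<^bsub>\<kappa>\<^esub>"
proof
  assume s: "s \<in> unit_content S" and z: "\<psi> s = \<zero>\<^bsub>\<kappa>\<^esub>"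
  have sc: "s \<in> carrier (UP S)" using s by (rule N.M_carr)
  have "N.frac s \<one>\<^bsub>UP S\<^esub> \<in> Q'" using z sc K.ker_iff[OF sc] mem_ker_iff by simp
  then have "N.frac \<one>\<^bsub>UP S\<^esub> s \<otimes>\<^bsub>N.L\<^esub> N.frac s \<one>\<^bsub>UP S\<^esub> \<in> Q'"
    using N.frac_closed[OF PX.P.one_closed s] by (rule Q'.I_l_closed)
  then show False unfolding N.frac_unit[OF s] by simp
qed

lemma rho_frac:
  assumes "f \<in> carrier (UP S)" "s \<in> unit_content S"
  shows "\<rho> (N.frac f s) \<in> carrier \<kappa>" "\<rho> (N.frac f s) \<otimes>\<^bsub>\<kappa>\<^esub> \<psi> s = \<psi> f"
proof -
  have c: "N.frac f s \<in> carrier N.L" "N.frac s \<one>\<^bsub>UP S\<^esub> \<in> carrier N.L"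
    using assms N.M_one by (auto intro!: N.frac_closed N.M_carr)
  show "\<rho> (N.frac f s) \<in> carrier \<kappa>" by (rule ring_hom_closed[OF Q'.residue_class_hom c(1)])
  show "\<rho> (N.frac f s) \<otimes>\<^bsub>\<kappa>\<^esub> \<psi> s = \<psi> f"
    unfolding \<psi>_def ring_hom_mult[OF Q'.residue_class_hom c, symmetric] N.frac_cancel[OF assms] ..
qed

text \<open>Quotients of fractions are quotients of their numerators and denominators, so
  denominators of unit content may be dropped. Applied to the image of R(X) and to all of
  S(X).\<close>

lemma fractions_localization:
  assumes D: "subring D (UP S)" and M: "M \<subseteq> unit_content S" "M \<subseteq> D" "\<one>\<^bsub>UP S\<^esub> \<in> M"
  shows "fractions \<kappa> \<rho> {N.frac f s | f s. f \<in> D \<and> s \<in> M} = fractions \<kappa> \<psi> D"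
proof -
  interpret D: field_valued_hom "UP S" \<kappa> \<psi> D by (rule field_valued[OF D])
  have rf: "\<rho> (N.frac f s) \<in> fractions \<kappa> \<psi> D" if "f \<in> D" "s \<in> M" for f s
  proof -
    have "\<rho> (N.frac f s) \<in> carrier \<kappa>" "\<rho> (N.frac f s) \<otimes>\<^bsub>\<kappa>\<^esub> \<psi> s = \<psi> f" "\<psi> s \<noteq> \<zero>\<^bsub>\<kappa>\<^esub>" "s \<in> D"
      using rho_frac[of f s] that M unit_content_notin_ker by auto
    then show ?thesis unfolding fractions_def using that(1) by blast
  qed
  show ?thesis
  proof (intro equalityI subsetI)
    fix e assume "e \<in> fractions \<kappa> \<rho> {N.frac f s | f s. f \<in> D \<and> s \<in> M}"
    then obtain f s g t where e: "e \<in> carrier \<kappa>" "f \<in> D" "s \<in> M" "g \<in> D" "t \<in> M"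
      "\<rho> (N.frac g t) \<noteq> \<zero>\<^bsub>\<kappa>\<^esub>" "e \<otimes>\<^bsub>\<kappa>\<^esub> \<rho> (N.frac g t) = \<rho> (N.frac f s)"
      unfolding fractions_def by blast
    show "e \<in> fractions \<kappa> \<psi> D"
      by (rule D.fractions_divide[OF e(1) rf[OF e(4,5)] e(6)]) (simp only: e(7) rf[OF e(2,3)])
  next
    fix e assume "e \<in> fractions \<kappa> \<psi> D"
    then obtain a b where e: "e \<in> carrier \<kappa>" "a \<in> D" "b \<in> D" "\<psi> b \<noteq> \<zero>\<^bsub>\<kappa>\<^esub>" "e \<otimes>\<^bsub>\<kappa>\<^esub> \<psi> b = \<psi> a"
      unfolding fractions_def by blast
    then show "e \<in> fractions \<kappa> \<rho> {N.frac f s | f s. f \<in> D \<and> s \<in> M}"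
      unfolding fractions_def \<psi>_def using M(3) by blast
  qed
qed

lemma carrier_residue: "carrier \<kappa> \<subseteq> fractions \<kappa> \<psi> (carrier (UP S))"
proof
  fix e assume e: "e \<in> carrier \<kappa>"
  obtain a s where a: "a \<in> carrier N.L" "s \<in> carrier N.L - Q'" "e \<otimes>\<^bsub>\<kappa>\<^esub> \<rho> s = \<rho> a"
    using Q'.residue_field_quotients[OF e] .
  have "\<rho> s \<noteq> \<zero>\<^bsub>\<kappa>\<^esub>" using a(2) Q'.residue_class_eq_zero_iff by blast
  then have "e \<in> fractions \<kappa> \<rho> (carrier N.L)" unfolding fractions_def using e a by blast
  then show "e \<in> fractions \<kappa> \<psi> (carrier (UP S))"
    unfolding N.carrier_L
    using fractions_localization[OF PX.P.carrier_is_subring order.refl N.M_sub N.M_one] by simp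
qed

definition Q0 where "Q0 = {a \<in> carrier S. up_ring.monom (UP S) a 0 \<in> K.ker}"

lemma fcp_prime_Q0: "fcp_prime S R Q0"
proof -
  interpret ker: primeideal K.ker "UP S" by (rule K.primeideal_ker)
  have "(\<lambda>a. up_ring.monom (UP S) a 0) \<in> ring_hom S (UP S)" by (rule PX.const_ring_hom)
  from contraction_primeideal[OF is_cring K.primeideal_ker this]
  have "primeideal Q0 S" unfolding contraction_def Q0_def .
  then show ?thesis by (intro fcp_prime.intro fcp_extension_axioms)
qed

lemma residual_length_nagata:
  "\<exists>Q. primeideal Q S \<and> family_length (subrings_above \<kappa> (fractions \<kappa> \<psi> RX)) \<le>
    family_length (subrings_above (residue_field S Q) (fractions (residue_field S Q) (residue_class S Q) R))"
proof -
  interpret Q0: fcp_prime S R Q0 by (rule fcp_prime_Q0)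
  interpret ker: primeideal K.ker "UP S" by (rule K.primeideal_ker)
  let ?mon = "up_ring.monom (UP S)" and ?cf = "up_ring.coeff (UP S)"
  have mon_ker: "?mon a n \<in> K.ker" if "a \<in> Q0" for a n
  proof -
    have a: "a \<in> carrier S" "?mon a 0 \<in> K.ker" using that unfolding Q0_def by blast+
    have "?mon a 0 \<otimes>\<^bsub>UP S\<^esub> ?mon \<one> n \<in> K.ker" by (rule ker.I_r_closed[OF a(2)]) simp
    then show ?thesis using PX.monom_mult[of a \<one> 0 n] a(1) by simp
  qed
  have QXker: "polys S Q0 \<subseteq> K.ker"
  proof
    fix f assume f: "f \<in> polys S Q0"
    show "f \<in> K.ker"
      by (rule PX.carrier_subset_if_monoms[OF _ _ PX.polysD(1)[OF f]])
        (use mon_ker PX.polysD(2)[OF f] additive_subgroup.a_closed[OF ker.additive_subgroup_axioms]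
          additive_subgroup.zero_closed[OF ker.additive_subgroup_axioms] in auto)
  qed
  have le: "family_length (subrings_above \<kappa> (fractions \<kappa> \<psi> RX)) \<le> family_length (saturated_subrings S R Q0)"
  \<comment> \<open>The condition says that the class of b in kappa(Q0) is not a quotient of
    elements of \<open>R\<close>, that is, the residual extension at \<open>Q0\<close> is
    nontrivial.\<close>
  proof (cases "\<exists>b\<in>carrier S. \<forall>s\<in>R. \<forall>r\<in>R. s \<notin> Q0 \<longrightarrow> s \<otimes> b \<ominus> r \<notin> Q0")
    case True
    then obtain b where b: "b \<in> carrier S" "\<And>s r. \<lbrakk>s \<in> R; s \<notin> Q0; r \<in> R\<rbrakk> \<Longrightarrow> s \<otimes> b \<ominus> r \<notin> Q0" by blast
    have P: Q0.P_maximal by (rule Q0.P_maximal_if[OF b])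
    \<comment> \<open>A polynomial in the kernel with a coefficient outside \<open>Q0\<close>, which
      is invertible modulo \<open>Q0\<close>, could be changed within the kernel into one of unit
      content.\<close>
    have "K.ker \<subseteq> polys S Q0"
    proof (rule subsetI, rule ccontr)
      fix f assume f: "f \<in> K.ker" "f \<notin> polys S Q0"
      have fc: "f \<in> carrier (UP S)" using f(1) mem_ker_iff by blast
      obtain n where n: "?cf f n \<notin> Q0" using PX.polysI fc f(2) by blast
      have nc: "?cf f n \<in> carrier S" using fc by simp
      obtain c where c: "c \<in> carrier S" "?cf f n \<otimes> c \<ominus> \<one> \<in> Q0" using Q0.Q_maximal[OF P nc n] by blast
      \<comment> \<open>Adding \<open>q \<in> Q\<close> as a new top coefficient makes the content of \<open>f\<close> the unit ideal.\<close>
      define q where "q = ?cf f n \<otimes> c \<ominus> \<one>"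
      have q: "q \<in> Q0" "q \<in> carrier S" using c nc by (simp_all add: q_def)
      define g where "g = f \<oplus>\<^bsub>UP S\<^esub> ?mon q (Suc (deg S f))"
      have gker: "g \<in> K.ker" unfolding g_def
        using additive_subgroup.a_closed[OF ker.additive_subgroup_axioms f(1) mon_ker[OF q(1)]] .
      have "g \<in> unit_content S" unfolding PX.unit_content_iff
      proof (intro conjI allI impI)
        show "g \<in> carrier (UP S)" using fc q by (simp add: g_def)
        fix J assume J: "ideal J S" "\<forall>n. ?cf g n \<in> J"
        interpret J: ideal J S by (rule J(1))
        have nd: "n \<le> deg S f" using PX.deg_aboveD[of f n] fc n Q0.zero_Q by (metis not_le)
        have "?cf g n \<in> J" "?cf g (Suc (deg S f)) \<in> J" using J(2) by blast+
        then have "?cf f n \<in> J" "q \<in> J"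
          using fc q nd PX.deg_aboveD[of f "Suc (deg S f)"] by (auto simp: g_def split: if_splits)
        then have "?cf f n \<otimes> c \<oplus> \<ominus> q \<in> J"
          using additive_subgroup.a_closed[OF J.additive_subgroup_axioms J.I_r_closed[OF _ c(1)] J.a_inv_closed]
          by blast
        moreover have "?cf f n \<otimes> c \<oplus> \<ominus> q = \<one>"
          unfolding q_def using nc c by (simp add: minus_eq minus_add r_neg2)
        ultimately show "J = carrier S" by (intro J.one_imp_carrier) simp
      qed
      moreover have "\<psi> g = \<zero>\<^bsub>\<kappa>\<^esub>" using gker unfolding K.ker_def by blast
      ultimately show False using unit_content_notin_ker by blast
    qed
    then have ker: "K.ker = polys S Q0" using QXker by blast
    have "family_length (subrings_above \<kappa> (fractions \<kappa> \<psi> RX)) \<le>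
        family_length (saturated_subrings (UP S) RX (polys S Q0))"
    \<comment> \<open>Denominators in S[X] are replaced by ones from R[X] by means of
      \<open>polynomial_fraction\<close>.\<close>
    proof (rule K.family_length_le_saturated[unfolded ker])
      fix e assume "e \<in> carrier \<kappa>"
      then have e: "e \<in> carrier \<kappa>" "e \<in> fractions \<kappa> \<psi> (carrier (UP S))" using carrier_residue by auto
      then obtain a s where a: "a \<in> carrier (UP S)" "s \<in> carrier (UP S)" "\<psi> s \<noteq> \<zero>\<^bsub>\<kappa>\<^esub>"
        "e \<otimes>\<^bsub>\<kappa>\<^esub> \<psi> s = \<psi> a" unfolding fractions_def by blast
      have "s \<notin> polys S Q0" using K.ker_iff[OF a(2)] a(3) unfolding ker by blast
      then obtain t p where t: "t \<in> carrier (UP S)" "p \<in> RX" "p \<notin> polys S Q0"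
        "s \<otimes>\<^bsub>UP S\<^esub> t \<ominus>\<^bsub>UP S\<^esub> p \<in> polys S Q0"
        using Q0.polynomial_fraction[OF P a(2)] by blast
      have pc: "p \<in> carrier (UP S)" using PX.polysD(1)[OF t(2)] .
      have "s \<otimes>\<^bsub>UP S\<^esub> t \<ominus>\<^bsub>UP S\<^esub> p \<in> carrier (UP S)" using a(2) t(1) pc by simp
      from K.ker_iff[OF this] have "\<psi> (s \<otimes>\<^bsub>UP S\<^esub> t \<ominus>\<^bsub>UP S\<^esub> p) = \<zero>\<^bsub>\<kappa>\<^esub>"
        using t(4) unfolding ker by blast
      then have "\<psi> (s \<otimes>\<^bsub>UP S\<^esub> t) = \<psi> p"
        using a(2) t(1) pc by (simp add: PX.P.minus_eq K.E.minus_eq[symmetric])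
      then have "e \<otimes>\<^bsub>\<kappa>\<^esub> \<psi> p = \<psi> (a \<otimes>\<^bsub>UP S\<^esub> t)"
        using a e(1) t(1) K.E.m_assoc[of e "\<psi> s" "\<psi> t"] by simp
      moreover have "\<psi> p \<noteq> \<zero>\<^bsub>\<kappa>\<^esub>" using K.ker_iff[OF pc] t(3) unfolding ker by blast
      moreover have "a \<otimes>\<^bsub>UP S\<^esub> t \<in> carrier (UP S)" using a t by simp
      ultimately show "\<exists>b\<in>carrier (UP S). \<exists>s\<in>RX. \<psi> s \<noteq> \<zero>\<^bsub>\<kappa>\<^esub> \<and> e \<otimes>\<^bsub>\<kappa>\<^esub> \<psi> s = \<psi> b"
        using t(2) by blast
    qed
    also have "\<dots> \<le> family_length (saturated_subrings S R Q0)"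
      by (rule Q0.family_length_polynomial_le[OF P])
    finally show ?thesis .
  next
    case False
    \<comment> \<open>It is enough to treat a monomial b X^n: if s b is congruent to r modulo
      \<open>Q0\<close>, its image is the quotient of those of r X^n and s.\<close>
    have psi: "\<psi> f \<in> fractions \<kappa> \<psi> RX" if f: "f \<in> carrier (UP S)" for f
    proof -
      have "f \<in> {f \<in> carrier (UP S). \<psi> f \<in> fractions \<kappa> \<psi> RX}"
      proof (rule PX.carrier_subset_if_monoms[OF _ _ f])
        show "\<zero>\<^bsub>UP S\<^esub> \<in> {f \<in> carrier (UP S). \<psi> f \<in> fractions \<kappa> \<psi> RX}"
          using K.image_mem_fractions[OF K.D_closed(2)] by simp
        show "f \<oplus>\<^bsub>UP S\<^esub> g \<in> {f \<in> carrier (UP S). \<psi> f \<in> fractions \<kappa> \<psi> RX}"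
          if "f \<in> {f \<in> carrier (UP S). \<psi> f \<in> fractions \<kappa> \<psi> RX}"
            "g \<in> {f \<in> carrier (UP S). \<psi> f \<in> fractions \<kappa> \<psi> RX}" for f g
          using that K.fractions_add by simp
        fix n
        let ?b = "?cf f n"
        have b: "?b \<in> carrier S" using f by simp
        then obtain s r where s: "s \<in> R" "r \<in> R" "s \<notin> Q0" "s \<otimes> ?b \<ominus> r \<in> Q0" using False by blast
        have c: "s \<in> carrier S" "r \<in> carrier S" using s Q0.R_carr by auto
        have "\<psi> (?mon (s \<otimes> ?b \<ominus> r) n) = \<zero>\<^bsub>\<kappa>\<^esub>"
          using mon_ker[OF s(4), of n] unfolding K.ker_def by blast
        moreover have "?mon (s \<otimes> ?b \<ominus> r) n = ?mon (s \<otimes> ?b) n \<ominus>\<^bsub>UP S\<^esub> ?mon r n"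
          using b c by (simp add: minus_eq PX.P.minus_eq PX.monom_add PX.monom_a_inv del: PX.monom_mult)
        ultimately have "\<psi> (?mon (s \<otimes> ?b) n) = \<psi> (?mon r n)"
          using b c by (simp add: PX.P.minus_eq K.E.minus_eq[symmetric] del: PX.monom_mult)
        then have "\<psi> (?mon ?b n) \<otimes>\<^bsub>\<kappa>\<^esub> \<psi> (?mon s 0) = \<psi> (?mon r n)"
          using b c PX.monom_mult[of s ?b 0 n] K.E.m_comm by simp
        moreover have "\<psi> (?mon s 0) \<noteq> \<zero>\<^bsub>\<kappa>\<^esub>" using s(3) c unfolding Q0_def K.ker_def by simp
        moreover have "?mon r n \<in> RX" "?mon s 0 \<in> RX" using Q0.RX_mem s by blast+
        moreover have mc: "?mon ?b n \<in> carrier (UP S)" using b by simp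
        ultimately have "\<psi> (?mon ?b n) \<in> fractions \<kappa> \<psi> RX"
          unfolding fractions_def using K.hom_closed[OF mc] by blast
        then show "?mon ?b n \<in> {f \<in> carrier (UP S). \<psi> f \<in> fractions \<kappa> \<psi> RX}" using mc by blast
      qed
      then show ?thesis by simp
    qed
    have "carrier \<kappa> \<subseteq> fractions \<kappa> \<psi> RX"
    proof
      fix e assume "e \<in> carrier \<kappa>"
      then have e: "e \<in> carrier \<kappa>" "e \<in> fractions \<kappa> \<psi> (carrier (UP S))" using carrier_residue by auto
      then obtain a s where a: "a \<in> carrier (UP S)" "s \<in> carrier (UP S)" "\<psi> s \<noteq> \<zero>\<^bsub>\<kappa>\<^esub>"
        "e \<otimes>\<^bsub>\<kappa>\<^esub> \<psi> s = \<psi> a" unfolding fractions_def by blast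
      show "e \<in> fractions \<kappa> \<psi> RX"
        by (rule K.fractions_divide[OF e(1) psi[OF a(2)] a(3)]) (simp only: a(4) psi[OF a(1)])
    qed
    then have "family_length (subrings_above \<kappa> (fractions \<kappa> \<psi> RX)) = 0" by (rule K.family_length_eq_0)
    then show ?thesis by simp
  qed
  show ?thesis
    by (rule exI[of _ Q0], rule conjI) (use Q0.primeideal_axioms le Q0.residual_length in simp_all)
qed

end

text \<open>The prime Q S(X) is proper because Q[X] contains no polynomial of unit content, and the
  kernel of the map from S[X] to its residue field is exactly Q[X].\<close>

lemma (in fcp_prime) residual_length_le_nagata:
  "\<exists>Q'. primeideal Q' (localization (UP S) (unit_content S)) \<and>
    family_length (subrings_above (residue_field S Q) (fractions (residue_field S Q) (residue_class S Q) R)) \<le>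
    family_length (subrings_above (residue_field (localization (UP S) (unit_content S)) Q')
      (fractions (residue_field (localization (UP S) (unit_content S)) Q')
        (nagata_prime.\<psi> S Q') (polys S R)))"
proof -
  interpret N: mult_closed "UP S" "unit_content S" by (rule PX.mult_closed_unit_content)
  have d: "polys S Q \<inter> unit_content S = {}" using PX.unit_content_prime[OF _ primeideal_axioms] by blast
  let ?Q' = "N.extended (polys S Q)"
  have p: "primeideal ?Q' (localization (UP S) (unit_content S))"
    by (rule N.extended_primeideal[OF QX_prime d])
  interpret N': nagata_prime S R ?Q'
    by (intro nagata_prime.intro nagata_prime_axioms.intro fcp_extension_axioms p)
  have "N'.K.ker = polys S Q"
  proof (rule Set.set_eqI)
    fix f
    show "f \<in> N'.K.ker \<longleftrightarrow> f \<in> polys S Q"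
      using N'.mem_ker_iff[of f] N.mem_extended[OF QX_prime d _ N.M_one, of f] PX.polysD(1)[of f Q] by blast
  qed
  then have "family_length (saturated_subrings (UP S) (polys S R) (polys S Q)) \<le>
      family_length (subrings_above N'.\<kappa> (fractions N'.\<kappa> N'.\<psi> (polys S R)))"
    using N'.K.family_length_saturated_le by simp
  then show ?thesis
    using family_length_le_polynomial p residual_length by (intro exI[of _ ?Q']) auto
qed

section \<open>Comparison of the suprema\<close>

lemma image_Collect_pairs:
  assumes "\<And>a s. \<lbrakk>P a; T s\<rbrakk> \<Longrightarrow> f (c a s) = d a s"
  shows "f ` {c a s | a s. P a \<and> T s} = {d a s | a s. P a \<and> T s}"
  using assms by (auto simp: image_iff) metis+

theorem theorem3p7:
  fixes S :: "('a, 'm) ring_scheme" and R :: "'a set"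
  assumes "cring S"
    and "subcring R S" and "R \<subset> carrier S"
    and "FCP (S\<lparr>carrier := R\<rparr>) S id"
  shows "Lambda (S\<lparr>carrier := R\<rparr>) S id =
    Lambda (nagata (S\<lparr>carrier := R\<rparr>)) (nagata S) (nagata_map S)"
proof -
  let ?R = "S\<lparr>carrier := R\<rparr>"
  let ?N = "localization (UP S) (unit_content S)"
  interpret S: cring S by fact
  have R: "subring R S" using subcring.axioms(1)[OF assms(2)] .
  note sub = UP_subring[OF assms(1) R]
  have fcp: "fcp_extension S R"
  proof (intro fcp_extension.intro fcp_extension_axioms.intro assms(1) R)
    fix C assume "subset.chain {T. subring T S \<and> R \<subseteq> T} C"
    moreover have "{T. subring T S \<and> R \<subseteq> T} = subalgebras ?R S id"
      unfolding subalgebras_def using S.subcringI' subcring.axioms(1) by fastforce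
    ultimately show "finite C" using assms(4) unfolding FCP_def by simp
  qed
  interpret R': cring ?R by (rule sub(1))
  interpret PR: UP_cring ?R "UP ?R" by unfold_locales
  interpret PS: UP_cring S "UP S" by unfold_locales
  note mR = PR.mult_closed_unit_content and mS = PS.mult_closed_unit_content
  have idR: "id \<in> ring_hom ?R S"
    by (rule ring_hom_memI) (use subringE(1)[OF R] in auto)
  let ?F = "\<lambda>Q. family_length (subrings_above (residue_field S Q) (fractions (residue_field S Q) (residue_class S Q) R))"
  let ?G = "\<lambda>Q. family_length (subrings_above (residue_field ?N Q) (fractions (residue_field ?N Q) (nagata_prime.\<psi> S Q) (polys S R)))"
  have L1: "Lambda ?R S id = (SUP Q\<in>{Q. primeideal Q S}. ?F Q)"
    unfolding Lambda_def
  proof (rule SUP_cong[OF refl])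
    fix Q assume "Q \<in> {Q. primeideal Q S}"
    then show "extension_length (residue_field ?R (contraction ?R id Q)) (residue_field S Q) (residual_map S id Q) = ?F Q"
      using extension_length_residual[OF sub(1) _ idR] by simp
  qed
  have hsub: "id ` unit_content ?R \<subseteq> unit_content S" using sub(4) by simp
  have h: "nagata_map S \<in> ring_hom (nagata ?R) (nagata S)"
    unfolding nagata_map_def nagata_def by (rule localization_map_hom[OF mR mS sub(3) hsub])
  have cN: "cring (nagata ?R)" unfolding nagata_def by (rule mult_closed.cring_L[OF mR])
  \<comment> \<open>The denominators here have unit content over \<open>R\<close>, which is stronger
    than lying in R[X] and having unit content over \<open>S\<close>; the next use of
    \<open>fractions_localization\<close> removes them altogether.\<close>
  have img: "nagata_map S ` carrier (nagata ?R) =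
      {frac_class (UP S) (unit_content S) f s | f s. f \<in> polys S R \<and> s \<in> unit_content ?R}"
  proof -
    have carr: "carrier (nagata ?R) =
        {frac_class (UP ?R) (unit_content ?R) f s | f s. f \<in> polys S R \<and> s \<in> unit_content ?R}"
      unfolding nagata_def mult_closed.carrier_L[OF mR] sub(2) ..
    have m: "nagata_map S (frac_class (UP ?R) (unit_content ?R) f s) = frac_class (UP S) (unit_content S) f s"
      if "f \<in> polys S R" "s \<in> unit_content ?R" for f s
      unfolding nagata_map_def
      using localization_map_frac[OF mR mS sub(3) hsub, of f s] that sub(2) by simp
    show ?thesis unfolding carr by (rule image_Collect_pairs) (rule m)
  qed
  have L2: "Lambda (nagata ?R) (nagata S) (nagata_map S) = (SUP Q\<in>{Q. primeideal Q ?N}. ?G Q)"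
    unfolding Lambda_def
  proof (rule SUP_cong)
    show "{Q. primeideal Q (nagata S)} = {Q. primeideal Q ?N}" by (simp add: nagata_def)
    fix Q assume "Q \<in> {Q. primeideal Q ?N}"
    then have Q: "primeideal Q ?N" by simp
    interpret N: nagata_prime S R Q by (intro nagata_prime.intro nagata_prime_axioms.intro fcp Q)
    have M: "unit_content ?R \<subseteq> polys S R" "\<one>\<^bsub>UP S\<^esub> \<in> unit_content ?R"
      using mult_closed.M_sub[OF mR] mult_closed.M_one[OF mR] ring_hom_one[OF sub(3)] sub(2) by auto
    have "fractions (residue_field ?N Q) (residue_class ?N Q) (nagata_map S ` carrier (nagata ?R)) =
        fractions (residue_field ?N Q) N.\<psi> (polys S R)"
      unfolding img by (rule N.fractions_localization[OF PS.subring_polys[OF R] sub(4) M])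
    then show "extension_length (residue_field (nagata ?R) (contraction (nagata ?R) (nagata_map S) Q))
        (residue_field (nagata S) Q) (residual_map (nagata S) (nagata_map S) Q) = ?G Q"
      using extension_length_residual[OF cN _ h, of Q] Q by (simp add: nagata_def[of S])
  qed
  show ?thesis unfolding L1 L2
  \<comment> \<open>For each prime on one side there is a prime on the other whose residual
    extension is at least as long; the primes are not matched bijectively.\<close>
  proof (rule antisym)
    show "(SUP Q\<in>{Q. primeideal Q S}. ?F Q) \<le> (SUP Q\<in>{Q. primeideal Q ?N}. ?G Q)"
    proof (rule SUP_mono)
      fix Q assume "Q \<in> {Q. primeideal Q S}"
      then interpret fcp_prime S R Q by (intro fcp_prime.intro fcp) simp
      show "\<exists>Q'\<in>{Q. primeideal Q ?N}. ?F Q \<le> ?G Q'" using residual_length_le_nagata by blast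
    qed
    show "(SUP Q\<in>{Q. primeideal Q ?N}. ?G Q) \<le> (SUP Q\<in>{Q. primeideal Q S}. ?F Q)"
    proof (rule SUP_mono)
      fix Q assume "Q \<in> {Q. primeideal Q ?N}"
      then interpret N: nagata_prime S R Q
        by (intro nagata_prime.intro nagata_prime_axioms.intro fcp) simp
      show "\<exists>Q0\<in>{Q. primeideal Q S}. ?G Q \<le> ?F Q0" using N.residual_length_nagata by blast
    qed
  qed
qed

end
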